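(* $$\sup_{\|b\|_{\mathcal B}\le 1}\sigma^2(b)\;=\;\sup_{\|b\|_{\mathcal B}\le 1}C_{\mathrm{LIL}}^2(b)\;=\;\lim_{\tau\to 0}\frac{4}{|\tau|^2}\cdot\sup_{\|b\|_{\mathcal B}\le 1}\beta_b(\tau),$$ where the suprema are over all $b\in\mathcal B$ with $\|b\|_{\mathcal B}\le 1$ and $\tau\in\mathbb C$ (in particular, the limit on the right exists). The common value is denoted $\Sigma^2_{\mathcal B}$.
   Context: $\mathbb D$ is the open unit disk in $\mathbb C$. The Bloch space $\mathcal B$ consists of the analytic functions $b$ on $\mathbb D$ with $\|b\|_{\mathcal B}:=\sup_{z\in\mathbb D}(1-|z|^2)|b'(z)|<\infty$. For $b\in\mathcal B$ define: - the asymptotic variance $$\sigma^2(b)=\limsup_{r\to1^-}\frac{1}{2\pi|\log(1-r)|}\int_{|z|=r}|b(z)|^2\,|dz|;$$ - the LIL constant $$C_{\mathrm{LIL}}(b)=\operatorname*{ess\,sup}_{\theta\in[0,2\pi)}\left\{\limsup_{r\to1^-}\frac{|b(re^{i\theta})|}{\sqrt{\log\frac1{1-r}\,\log\log\log\frac1{1-r}}}\right\};$$ - the integral means spectrum $$\beta_b(\tau)=\limsup_{r\to1^-}\frac{1}{|\log(1-r)|}\cdot\log\int_{|z|=r}\bigl|e^{\tau b(z)}\bigr|\,|dz|,\qquad\tau\in\mathbb C.$$ Here $|dz|$ is arc length. *)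

theory Defs
  imports "HOL-Analysis.Analysis" "HOL-Probability.Essential_Supremum"
begin

text \<open>
  Functions on the open unit disk are total functions \<^typ>\<open>complex \<Rightarrow> complex\<close>; everything below depends
  only on their values on \<^term>\<open>ball 0 1 :: complex set\<close>. Suprema and upper limits are taken in
  \<^typ>\<open>ereal\<close>, where they always exist.
\<close>

definition bloch_norm :: "(complex \<Rightarrow> complex) \<Rightarrow> ereal" where
  "bloch_norm b = (SUP z\<in>ball 0 1. ereal ((1 - (cmod z)\<^sup>2) * cmod (deriv b z)))"

definition bloch_space :: "(complex \<Rightarrow> complex) set" where
  "bloch_space = {b. b analytic_on ball 0 1 \<and> bloch_norm b < \<infinity>}"

definition bloch_unit_ball :: "(complex \<Rightarrow> complex) set" where
  "bloch_unit_ball = {b \<in> bloch_space. bloch_norm b \<le> 1}"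

text \<open>Integral over the circle of radius \<open>r\<close> about \<open>0\<close> with respect to arc length, \<open>|dz| = r d\<theta>\<close>.\<close>

definition circle_integral :: "real \<Rightarrow> (complex \<Rightarrow> real) \<Rightarrow> real" where
  "circle_integral r f = integral {0..2*pi} (\<lambda>\<theta>. f (of_real r * cis \<theta>) * r)"

definition asymptotic_variance :: "(complex \<Rightarrow> complex) \<Rightarrow> ereal" where
  "asymptotic_variance b = Limsup (at_left 1)
     (\<lambda>r. ereal (1 / (2 * pi * \<bar>ln (1 - r)\<bar>) * circle_integral r (\<lambda>z. (cmod (b z))\<^sup>2)))"

text \<open>
  The iterated logarithm is positive as soon as \<open>r\<close> is close enough to \<open>1\<close>, so other values of \<open>r\<close>
  do not affect the upper limit. The library's \<^const>\<open>esssup\<close> is \<open>\<infinity>\<close> on non-measurable functions; this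
  does not occur for analytic \<open>b\<close>, as by continuity in \<open>r\<close> near \<open>1\<close> the upper limit may be taken
  along rational \<open>r\<close>, and so is a Borel function of \<open>\<theta>\<close>.
\<close>

definition lil_constant :: "(complex \<Rightarrow> complex) \<Rightarrow> ereal" where
  "lil_constant b = esssup (lebesgue_on {0..<2*pi})
     (\<lambda>\<theta>. Limsup (at_left 1)
        (\<lambda>r. ereal (cmod (b (of_real r * cis \<theta>)) /
                    sqrt (ln (1 / (1 - r)) * ln (ln (ln (1 / (1 - r))))))))"

definition integral_means_spectrum :: "(complex \<Rightarrow> complex) \<Rightarrow> complex \<Rightarrow> ereal" where
  "integral_means_spectrum b \<tau> = Limsup (at_left 1)
     (\<lambda>r. ereal (1 / \<bar>ln (1 - r)\<bar> * ln (circle_integral r (\<lambda>z. cmod (exp (\<tau> * b z))))))"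

end

theory Submission
  imports Defs "HOL-Complex_Analysis.Complex_Analysis" "HOL-Real_Asymp.Real_Asymp" "HOL-Probability.Probability"
begin

text \<open>
  Let \<open>V t\<close> be the supremum over the unit ball of the mean of \<open>|b - b 0|\<^sup>2\<close> over the circle of
  hyperbolic size \<open>t\<close>, that is \<open>|z| = 1 - exp (- t)\<close>. The unit ball is invariant under disc
  automorphisms, and averaging over a large circle can be compared with a walk whose steps have
  hyperbolic size \<open>T\<close>. Since a step has conditional mean \<open>0\<close>, second moments add up along the walk, so
  that \<open>V\<close> is almost subadditive and \<open>V t / t\<close> tends to a constant \<open>S\<close>. Exponential moments multiply
  along the walk, \<open>mean |exp (\<tau> b)| \<le> C exp (|\<tau>|\<^sup>2 / 4 (S + \<epsilon>) t)\<close> for small \<open>\<tau>\<close>, uniformly over the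
  ball. This bounds all three quantities by \<open>S\<close>, the iterated logarithm through a dyadic maximal
  inequality and the Borel-Cantelli lemma.

  Conversely let \<open>f\<^sub>k\<close> nearly realise \<open>V (T\<^sub>k)\<close>. Then \<open>\<Sum> f\<^sub>k (\<rho>\<^sub>k z ^ d\<^sub>k)\<close> with
  \<open>d\<^sub>k\<^sub>+\<^sub>1 / d\<^sub>k\<close> of order \<open>exp (T\<^sub>k)\<close> has Bloch norm at most \<open>1 + \<eta>\<close>, and on circles it is, up to a bounded
  error, a sum of independent digit functions of the angle whose variances add up to \<open>S\<close> times the
  hyperbolic size. Constant \<open>T\<^sub>k\<close> yields the lower bound for the spectrum, slowly growing \<open>T\<^sub>k\<close> the
  lower bounds for the asymptotic variance and the iterated logarithm.
\<close>

subsection \<open>The unit ball of the Bloch space\<close>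

text \<open>A large circle is not the law of a walk with smaller steps: the end point overshoots or
  falls short. Both are controlled by the potential -ln (1 - |z|^2), whose mean grows by a fixed
  amount per step and whose maximum grows by at most 2 ln 2 more. The loss per step is bounded,
  hence negligible against T. The factor 4 / |\<tau>|^2 and the absence of a 2 in the iterated
  logarithm have one source: b^2 is analytic, so Re b carries half of the mean of |b|^2, and a real
  variable of variance S t / 2 has exponential moments exp (|\<tau>|^2 S t / 4) and iterated
  logarithm constant sqrt S. In the converse, dilating f_k bounds its derivative by exp (T_k) up to
  the circle; this separates the scales of the terms and lets each be rounded to finitely many
  digits. For the spectrum a rounding error that grows linearly with a small rate is harmless, but
  the other two quantities need a bounded total. Extra factors (k + 1)^2 in d_(k+1) / d_k provide
  it, and T_k must grow for their logarithms to stay small against T_k.\<close>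

lemma bloch_unit_ball_iff:
  "b \<in> bloch_unit_ball \<longleftrightarrow>
     b holomorphic_on ball 0 1 \<and> (\<forall>z\<in>ball 0 1. (1 - (cmod z)\<^sup>2) * cmod (deriv b z) \<le> 1)"
proof -
  have *: "bloch_norm b \<le> 1 \<longleftrightarrow> (\<forall>z\<in>ball 0 1. (1 - (cmod z)\<^sup>2) * cmod (deriv b z) \<le> 1)"
    by (simp add: bloch_norm_def SUP_le_iff)
  have "bloch_norm b \<le> 1 \<Longrightarrow> bloch_norm b < \<infinity>"
    by (metis ereal_less(3) leD linorder_cases one_ereal_def order_le_less_trans less_ereal.simps(4))
  with * show ?thesis
    by (auto simp: bloch_unit_ball_def bloch_space_def analytic_on_open)
qed

lemma bloch_unit_ballI:
  assumes "\<And>z. cmod z < 1 \<Longrightarrow> (b has_field_derivative b' z) (at z)"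
    and "\<And>z. cmod z < 1 \<Longrightarrow> (1 - (cmod z)\<^sup>2) * cmod (b' z) \<le> 1"
  shows "b \<in> bloch_unit_ball"
proof -
  have "deriv b z = b' z" if "cmod z < 1" for z
    using assms(1)[OF that] by (rule DERIV_imp_deriv)
  moreover have "b holomorphic_on ball 0 1"
    by (rule holomorphic_onI) (use assms(1) in \<open>auto simp: field_differentiable_def intro: DERIV_subset\<close>)
  ultimately show ?thesis using assms(2) by (auto simp: bloch_unit_ball_iff)
qed

lemma bloch_unit_ballD:
  assumes "b \<in> bloch_unit_ball" "cmod z < 1"
  shows "(b has_field_derivative deriv b z) (at z)" "(1 - (cmod z)\<^sup>2) * cmod (deriv b z) \<le> 1"
    "cmod (deriv b z) \<le> 1 / (1 - (cmod z)\<^sup>2)"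
proof -
  show "(b has_field_derivative deriv b z) (at z)"
    using assms by (auto simp: bloch_unit_ball_iff intro!: holomorphic_derivI[of b "ball 0 1"])
  show *: "(1 - (cmod z)\<^sup>2) * cmod (deriv b z) \<le> 1"
    using assms by (auto simp: bloch_unit_ball_iff)
  have "(cmod z)\<^sup>2 < 1" using assms by (simp add: power_less_one_iff abs_square_less_1)
  with * show "cmod (deriv b z) \<le> 1 / (1 - (cmod z)\<^sup>2)" by (simp add: field_simps)
qed

lemma bloch_unit_ball_holomorphic: "b \<in> bloch_unit_ball \<Longrightarrow> b holomorphic_on ball 0 1"
  by (simp add: bloch_unit_ball_iff)

lemma bloch_unit_ball_continuous: "b \<in> bloch_unit_ball \<Longrightarrow> continuous_on (ball 0 1) b"
  by (simp add: bloch_unit_ball_iff holomorphic_on_imp_continuous_on)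

lemma zero_in_bloch_unit_ball: "(\<lambda>_. 0) \<in> bloch_unit_ball"
  by (rule bloch_unit_ballI[where b' = "\<lambda>_. 0"]) auto

lemma bloch_unit_ball_minus_const:
  assumes "b \<in> bloch_unit_ball" shows "(\<lambda>z. b z - c) \<in> bloch_unit_ball"
  by (rule bloch_unit_ballI[where b' = "deriv b"])
     (use bloch_unit_ballD[OF assms] in \<open>auto intro!: derivative_eq_intros\<close>)

lemma bloch_unit_ball_mult:
  assumes "b \<in> bloch_unit_ball" "cmod c \<le> 1" shows "(\<lambda>z. c * b z) \<in> bloch_unit_ball"
proof (rule bloch_unit_ballI[where b' = "\<lambda>z. c * deriv b z"])
  fix z :: complex assume z: "cmod z < 1"
  show "((\<lambda>z. c * b z) has_field_derivative c * deriv b z) (at z)"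
    using bloch_unit_ballD(1)[OF assms(1) z] by (auto intro!: derivative_eq_intros)
  have "cmod c * ((1 - (cmod z)\<^sup>2) * cmod (deriv b z)) \<le> 1 * 1"
    using z by (intro mult_mono assms bloch_unit_ballD(2)) (auto simp: power_le_one)
  then show "(1 - (cmod z)\<^sup>2) * cmod (c * deriv b z) \<le> 1"
    by (simp add: norm_mult mult_ac)
qed

section \<open>Moebius invariance of the unit ball\<close>

definition disc_aut :: "complex \<Rightarrow> complex \<Rightarrow> complex" where
  "disc_aut a w = (w + a) / (1 + cnj a * w)"

lemma disc_aut_denom:
  assumes "cmod a < 1" "cmod w < 1" shows "1 + cnj a * w \<noteq> 0"
proof
  assume "1 + cnj a * w = 0"
  then have "cnj a * w = -1" by (simp add: add_eq_0_iff)
  then have "cmod a * cmod w = 1" by (metis complex_mod_cnj norm_minus_cancel norm_mult norm_one)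
  moreover have "cmod a * cmod w < 1"
    using mult_strict_mono[of "cmod a" 1 "cmod w" 1] assms by auto
  ultimately show False by simp
qed

text \<open>Together with \<open>disc_aut_deriv\<close> this is the case of equality in the
  Schwarz-Pick lemma; its logarithm is the transformation rule of the potential
  \<open>disc_pot\<close>.\<close>

lemma disc_aut_norm:
  assumes "cmod a < 1" "cmod w < 1"
  shows "1 - (cmod (disc_aut a w))\<^sup>2 = (1 - (cmod a)\<^sup>2) * (1 - (cmod w)\<^sup>2) / (cmod (1 + cnj a * w))\<^sup>2"
proof -
  have nz: "cmod (1 + cnj a * w) \<noteq> 0" using disc_aut_denom[OF assms] by simp
  have "complex_of_real ((cmod (1 + cnj a * w))\<^sup>2 - (cmod (w + a))\<^sup>2) =
        complex_of_real ((1 - (cmod a)\<^sup>2) * (1 - (cmod w)\<^sup>2))"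
    unfolding of_real_diff of_real_mult complex_norm_square by (simp add: complex_norm_square algebra_simps)
  then have "(cmod (1 + cnj a * w))\<^sup>2 - (cmod (w + a))\<^sup>2 = (1 - (cmod a)\<^sup>2) * (1 - (cmod w)\<^sup>2)"
    using of_real_eq_iff by blast
  then show ?thesis using nz by (simp add: disc_aut_def norm_divide power_divide field_simps)
qed

lemma disc_aut_less_1:
  assumes "cmod a < 1" "cmod w < 1"
  shows "cmod (disc_aut a w) < 1"
proof -
  have "0 < (1 - (cmod a)\<^sup>2) * (1 - (cmod w)\<^sup>2) / (cmod (1 + cnj a * w))\<^sup>2"
    using assms disc_aut_denom[OF assms]
    by (intro divide_pos_pos mult_pos_pos) (auto simp: abs_square_less_1)
  then have "(cmod (disc_aut a w))\<^sup>2 < 1" using disc_aut_norm[OF assms] by linarith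
  then show ?thesis by (simp add: abs_square_less_1)
qed

lemma disc_aut_0: "disc_aut a 0 = a" by (simp add: disc_aut_def)

lemma disc_aut_deriv:
  assumes "cmod a < 1" "cmod w < 1"
  shows "(disc_aut a has_field_derivative (1 - (cmod a)\<^sup>2) / (1 + cnj a * w)\<^sup>2) (at w)"
proof -
  have "((\<lambda>w. (w + a) / (1 + cnj a * w)) has_field_derivative (1 - (cmod a)\<^sup>2) / (1 + cnj a * w)\<^sup>2) (at w)"
    using disc_aut_denom[OF assms]
    by (auto intro!: derivative_eq_intros simp: of_real_diff complex_norm_square simp del: of_real_power)
       (simp add: algebra_simps power2_eq_square)
  then show ?thesis by (simp add: disc_aut_def[abs_def])
qed

text \<open>Equality in Schwarz-Pick, (1 - |w|^2) |\<phi>'(w)| = 1 - |\<phi>(w)|^2 for \<phi> =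
  \<open>disc_aut a\<close>, makes the Bloch quantity of the composition at \<open>w\<close> that of
  \<open>b\<close> at \<phi>(w). As \<phi>(0) = a, every point can be moved to the centre, where
  circle means are available.\<close>

lemma bloch_unit_ball_disc_aut:
  assumes b: "b \<in> bloch_unit_ball" and a: "cmod a < 1"
  shows "(\<lambda>w. b (disc_aut a w)) \<in> bloch_unit_ball"
proof (rule bloch_unit_ballI[where b' = "\<lambda>w. deriv b (disc_aut a w) * ((1 - (cmod a)\<^sup>2) / (1 + cnj a * w)\<^sup>2)"])
  fix w :: complex assume w: "cmod w < 1"
  note 1 = bloch_unit_ballD[OF b disc_aut_less_1[OF a w]]
  show "((\<lambda>w. b (disc_aut a w)) has_field_derivative
      deriv b (disc_aut a w) * ((1 - (cmod a)\<^sup>2) / (1 + cnj a * w)\<^sup>2)) (at w)"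
    using DERIV_chain2[OF 1(1) disc_aut_deriv[OF a w]] by simp
  have "cmod (of_real (1 - (cmod a)\<^sup>2)) = 1 - (cmod a)\<^sup>2"
    using a by (simp only: norm_of_real) (simp add: power_le_one)
  then have "(1 - (cmod w)\<^sup>2) * cmod (deriv b (disc_aut a w) * ((1 - (cmod a)\<^sup>2) / (1 + cnj a * w)\<^sup>2))
    = (1 - (cmod (disc_aut a w))\<^sup>2) * cmod (deriv b (disc_aut a w))"
    unfolding disc_aut_norm[OF a w] by (simp add: norm_mult norm_divide norm_power del: of_real_diff)
  then show "(1 - (cmod w)\<^sup>2) * cmod (deriv b (disc_aut a w) * ((1 - (cmod a)\<^sup>2) / (1 + cnj a * w)\<^sup>2)) \<le> 1"
    using 1(2) by simp
qed

lemma bloch_unit_ball_rotate: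
  assumes b: "b \<in> bloch_unit_ball" and a: "cmod a = 1"
  shows "(\<lambda>w. b (a * w)) \<in> bloch_unit_ball"
proof (rule bloch_unit_ballI[where b' = "\<lambda>w. deriv b (a * w) * a"])
  fix w :: complex assume w: "cmod w < 1"
  then have aw: "cmod (a * w) < 1" using a by (simp add: norm_mult)
  show "((\<lambda>w. b (a * w)) has_field_derivative deriv b (a * w) * a) (at w)"
    by (rule DERIV_chain2[where f = b and g = "\<lambda>w. a * w", OF bloch_unit_ballD(1)[OF b aw]])
       (auto intro!: derivative_eq_intros)
  show "(1 - (cmod w)\<^sup>2) * cmod (deriv b (a * w) * a) \<le> 1"
    using bloch_unit_ballD(2)[OF b aw] a by (simp add: norm_mult)
qed

text \<open>The derivative bound 1 / (1 - t^2) integrated along a radius. Two radii are kept because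
  the comparison of arcs needs the growth from \<open>r\<close> to \<open>s\<close> alone.\<close>

lemma bloch_radial_growth:
  assumes b: "b \<in> bloch_unit_ball" and z: "cmod z = 1" and r: "0 \<le> r" "r \<le> s" "s < 1"
  shows "cmod (b (of_real s * z) - b (of_real r * z)) \<le>
    (ln ((1 + s) / (1 - s)) - ln ((1 + r) / (1 - r))) / 2"
proof (cases "r = s")
  case False
  with r have rs: "r < s" by simp
  let ?f = "\<lambda>t. b (of_real t * z)" and ?\<phi> = "\<lambda>t. ln ((1 + t) / (1 - t)) / 2"
  have d: "(?f has_vector_derivative deriv b (of_real t * z) * z) (at t)" if t: "0 \<le> t" "t < 1" for t
  proof -
    have "((\<lambda>t. of_real t * z) has_vector_derivative z) (at t)"
      by (rule derivative_eq_intros refl)+ simp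
    moreover have "(b has_field_derivative deriv b (of_real t * z)) (at (of_real t * z))"
      using t z by (intro bloch_unit_ballD(1)[OF b]) (simp add: norm_mult)
    ultimately have "(b \<circ> (\<lambda>t. of_real t * z) has_vector_derivative z * deriv b (of_real t * z)) (at t)"
      by (rule field_vector_diff_chain_at)
    then show ?thesis by (simp add: o_def mult.commute)
  qed
  have dphi: "(?\<phi> has_real_derivative 1 / (1 - t\<^sup>2)) (at t)" if t: "0 \<le> t" "t < 1" for t
  proof -
    have "1 - t\<^sup>2 = (1 - t) * (1 + t)" by (simp add: algebra_simps power2_eq_square)
    then show ?thesis using t
      by (auto intro!: derivative_eq_intros simp: divide_simps)
  qed
  have "norm (?f s - ?f r) \<le> ?\<phi> s - ?\<phi> r"
  proof (rule differentiable_bound_general[OF rs])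
    show "continuous_on {r..s} ?f"
      using d r by (intro continuous_at_imp_continuous_on ballI)
        (auto intro!: has_vector_derivative_continuous d)
    show "continuous_on {r..s} ?\<phi>"
      using dphi r by (intro continuous_at_imp_continuous_on ballI) (auto intro!: DERIV_isCont dphi)
    show "(?f has_vector_derivative deriv b (of_real x * z) * z) (at x)" if "r < x" "x < s" for x
      using that r d by auto
    show "(?\<phi> has_vector_derivative 1 / (1 - x\<^sup>2)) (at x)" if "r < x" "x < s" for x
      using that r dphi[of x] by (auto simp: has_real_derivative_iff_has_vector_derivative)
    show "norm (deriv b (of_real x * z) * z) \<le> 1 / (1 - x\<^sup>2)" if "r < x" "x < s" for x
      using bloch_unit_ballD(3)[OF b, of "of_real x * z"] that r z by (simp add: norm_mult)
  qed
  then show ?thesis by (simp add: diff_divide_distrib)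
qed simp

lemma bloch_growth_0:
  assumes "b \<in> bloch_unit_ball" "cmod z < 1"
  shows "cmod (b z - b 0) \<le> ln ((1 + cmod z) / (1 - cmod z)) / 2"
proof (cases "z = 0")
  case False
  then have "cmod (sgn z) = 1" "of_real (cmod z) * sgn z = z"
    by (simp add: norm_sgn, simp add: sgn_div_norm scaleR_conv_of_real)
  then show ?thesis
    using bloch_radial_growth[OF assms(1), of "sgn z" 0 "cmod z"] assms(2) by simp
qed simp

lemma cis_2pi_periodic: "cis (2 * pi * (x + of_int n)) = cis (2 * pi * x)"
  by (simp add: cis.ctr distrib_left mult.commute[of _ "of_int n"] sin_cos_eq[symmetric])
     (metis cos_int_2pin sin_int_2pin cos_add sin_add mult.commute mult_zero_right diff_zero add.right_neutral mult.right_neutral)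

subsection \<open>Circle means\<close>

lemma has_integral_circle_mean:
  assumes f: "f holomorphic_on ball 0 1" and r: "0 \<le> r" "r < 1"
  shows "((\<lambda>x. f (of_real r * cis (2 * pi * x))) has_integral f 0) {0..1}"
proof (cases "r = 0")
  case True
  then show ?thesis using has_integral_const_real[of "f 0" 0 1] by simp
next
  case False
  with r have r0: "0 < r" by simp
  have "((\<lambda>u. f u / (u - 0)) has_contour_integral (2 * of_real pi * \<i> * f 0)) (circlepath 0 r)"
    by (rule Cauchy_integral_circlepath_simple)
       (use r r0 in \<open>auto intro: holomorphic_on_subset[OF f]\<close>)
  then have *: "((\<lambda>x. f (circlepath 0 r x) / circlepath 0 r x * vector_derivative (circlepath 0 r) (at x))
      has_integral (2 * of_real pi * \<i> * f 0)) {0..1}"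
    by (simp add: has_contour_integral)
  have "f (circlepath 0 r x) / circlepath 0 r x * vector_derivative (circlepath 0 r) (at x)
      = (2 * of_real pi * \<i>) * f (of_real r * cis (2 * pi * x))" for x
    unfolding vector_derivative_circlepath using r0 by (simp add: circlepath cis_conv_exp mult_ac)
  then have "((\<lambda>x. (2 * of_real pi * \<i>) * f (of_real r * cis (2 * pi * x)))
      has_integral (2 * of_real pi * \<i> * f 0)) {0..1}"
    using * by simp
  from has_integral_mult_right[OF this, of "1 / (2 * of_real pi * \<i>)"] show ?thesis by simp
qed

text \<open>Angles are measured in turns, so that the circle is the unit interval with total mass 1;
  dyadic intervals and digits of the angle refer to this parameter.\<close>

definition circle_mean :: "real \<Rightarrow> (complex \<Rightarrow> 'a::banach) \<Rightarrow> 'a" where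
  "circle_mean r u = integral {0..1} (\<lambda>x. u (of_real r * cis (2 * pi * x)))"

lemma continuous_on_circle:
  assumes "continuous_on (ball 0 1) u" "0 \<le> r" "r < 1"
  shows "continuous_on A (\<lambda>x. u (of_real r * cis (2 * pi * x)))"
  by (rule continuous_on_compose2[OF assms(1)]) (use assms in \<open>auto intro!: continuous_intros simp: norm_mult\<close>)

lemma integrable_on_circle:
  fixes u :: "complex \<Rightarrow> 'a::banach"
  assumes "continuous_on (ball 0 1) u" "0 \<le> r" "r < 1"
  shows "(\<lambda>x. u (of_real r * cis (2 * pi * x))) integrable_on {a..b}"
  by (rule integrable_continuous_real) (rule continuous_on_circle[OF assms])

lemma circle_mean_holomorphic:
  assumes "f holomorphic_on ball 0 1" "0 \<le> r" "r < 1"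
  shows "circle_mean r f = f 0"
  using has_integral_circle_mean[OF assms] by (simp add: circle_mean_def integral_unique)

lemma circle_mean_add:
  fixes u v :: "complex \<Rightarrow> 'a::banach"
  assumes "continuous_on (ball 0 1) u" "continuous_on (ball 0 1) v" "0 \<le> r" "r < 1"
  shows "circle_mean r (\<lambda>z. u z + v z) = circle_mean r u + circle_mean r v"
  unfolding circle_mean_def by (intro integral_add integrable_on_circle assms)

lemma circle_mean_const [simp]: "circle_mean r (\<lambda>z. c) = c"
  unfolding circle_mean_def by simp

lemma circle_mean_cmult: "circle_mean r (\<lambda>z. c * u z) = (c::real) * circle_mean r u"
  unfolding circle_mean_def by simp

lemma circle_mean_mono:
  fixes u v :: "complex \<Rightarrow> real"
  assumes "continuous_on (ball 0 1) u" "continuous_on (ball 0 1) v" "0 \<le> r" "r < 1"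
    and "\<And>z. cmod z = r \<Longrightarrow> u z \<le> v z"
  shows "circle_mean r u \<le> circle_mean r v"
  unfolding circle_mean_def
  by (intro integral_le integrable_on_circle assms) (use assms in \<open>auto simp: norm_mult\<close>)

lemma circle_mean_nonneg:
  fixes u :: "complex \<Rightarrow> real"
  assumes "continuous_on (ball 0 1) u" "0 \<le> r" "r < 1" and "\<And>z. cmod z = r \<Longrightarrow> 0 \<le> u z"
  shows "0 \<le> circle_mean r u"
  using circle_mean_mono[of "\<lambda>_. 0" u r] assms by simp

lemma circle_mean_Re:
  assumes "continuous_on (ball 0 1) u" "0 \<le> r" "r < 1"
  shows "circle_mean r (\<lambda>z. Re (u z)) = Re (circle_mean r u)"
  unfolding circle_mean_def
  using integral_linear[OF integrable_on_circle[OF assms] bounded_linear_Re] by (simp add: o_def)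

text \<open>Pythagoras: |h|^2 and |h - h 0|^2 differ by the real part of the analytic function
  \<open>q\<close>, whose mean is its value at 0.\<close>

lemma circle_mean_square_holomorphic:
  assumes h: "h holomorphic_on ball 0 1" and r: "0 \<le> r" "r < 1"
  shows "circle_mean r (\<lambda>z. (cmod (h z))\<^sup>2) = (cmod (h 0))\<^sup>2 + circle_mean r (\<lambda>z. (cmod (h z - h 0))\<^sup>2)"
proof -
  note c = holomorphic_on_imp_continuous_on[OF h]
  define q where "q z = 2 * cnj (h 0) * h z - of_real ((cmod (h 0))\<^sup>2)" for z
  have qh: "q holomorphic_on ball 0 1" unfolding q_def by (intro holomorphic_intros h)
  note qc = holomorphic_on_imp_continuous_on[OF qh]
  have "(cmod (h z))\<^sup>2 = (cmod (h z - h 0))\<^sup>2 + Re (q z)" for z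
    unfolding cmod_power2 q_def by (simp add: power2_eq_square algebra_simps)
  then have "circle_mean r (\<lambda>z. (cmod (h z))\<^sup>2) = circle_mean r (\<lambda>z. (cmod (h z - h 0))\<^sup>2 + Re (q z))"
    by (intro arg_cong[where f = "circle_mean r"] ext)
  also have "\<dots> = circle_mean r (\<lambda>z. (cmod (h z - h 0))\<^sup>2) + Re (circle_mean r q)"
    using r by (subst circle_mean_add) (auto intro!: continuous_intros c qc circle_mean_Re)
  also have "circle_mean r q = q 0" by (rule circle_mean_holomorphic[OF qh r])
  also have "Re (q 0) = (cmod (h 0))\<^sup>2"
    unfolding cmod_power2 q_def by (simp add: power2_eq_square)
  finally show ?thesis by simp
qed

lemma circle_mean_rotate:
  fixes u :: "complex \<Rightarrow> 'a::euclidean_space"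
  assumes u: "continuous_on (ball 0 1) u" and r: "0 \<le> r" "r < 1" and w: "cmod w = 1"
  shows "circle_mean r (\<lambda>z. u (w * z)) = circle_mean r u"
proof -
  obtain a where a: "0 \<le> a" "a < 2 * pi" "w = cis a"
    using complex_norm_eq_1_exp_eq w by (metis Arg2pi_eq cis_conv_exp Arg2pi_ge_0 Arg2pi_lt_2pi mult_1 of_real_1)
  define s where "s = a / (2 * pi)"
  have s: "0 \<le> s" "s < 1" "w = cis (2 * pi * s)" using a by (auto simp: s_def field_simps)
  let ?f = "\<lambda>x. u (of_real r * cis (2 * pi * x))"
  have per: "?f (x + 1) = ?f x" for x
    using cis_2pi_periodic[of x 1] by simp
  have int: "?f integrable_on {c..d}" for c d by (rule integrable_on_circle[OF u r])
  have "circle_mean r (\<lambda>z. u (w * z)) = integral {0..1} (\<lambda>x. ?f (x + s))"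
    unfolding circle_mean_def by (simp add: s cis_mult distrib_left mult_ac add.commute)
  also have "\<dots> = integral {s..1 + s} ?f"
    using integral_shift_Icc_real[of 0 1 ?f s] by (simp add: o_def add.commute[of s])
  also have "\<dots> = integral {s..1} ?f + integral {1..1 + s} ?f"
    using s by (intro Henstock_Kurzweil_Integration.integral_combine[symmetric] int) auto
  also have "integral {1..1 + s} ?f = integral {0..s} (\<lambda>x. ?f (x + 1))"
    using integral_shift_Icc_real[of 0 s ?f 1] by (simp add: o_def add.commute[of 1])
  also have "\<dots> = integral {0..s} ?f" by (simp only: per)
  also have "integral {s..1} ?f + integral {0..s} ?f = integral {0..1} ?f"
    using s Henstock_Kurzweil_Integration.integral_combine[of 0 s 1 ?f] int by (simp add: add.commute)
  finally show ?thesis by (simp add: circle_mean_def)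
qed

text \<open>The pairing \<open>K w\<close> of \<open>g\<close> on the circle through
  \<open>w\<close> with \<open>g\<close> on the circle of radius \<open>r\<close> is analytic in
  \<open>w\<close>, equals the smaller mean at w = r, and on |w| = R is at most the average of the
  two means, by AM-GM and rotation invariance. The maximum principle compares the two.\<close>

lemma circle_mean_square_mono:
  assumes g: "g holomorphic_on ball 0 1" and r: "0 \<le> r" "r \<le> R" "R < 1"
  shows "circle_mean r (\<lambda>z. (cmod (g z))\<^sup>2) \<le> circle_mean R (\<lambda>z. (cmod (g z))\<^sup>2)"
proof -
  note c = holomorphic_on_imp_continuous_on[OF g]
  have c2: "continuous_on (ball 0 1) (\<lambda>z. (cmod (g z))\<^sup>2)" by (intro continuous_intros c)
  let ?I = "\<lambda>r. circle_mean r (\<lambda>z. (cmod (g z))\<^sup>2)"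
  have r1: "r < 1" using r by simp
  define K where "K w = integral (cbox 0 1) (\<lambda>x. g (w * cis (2 * pi * x)) * cnj (g (of_real r * cis (2 * pi * x))))" for w
  have cr: "continuous_on A (\<lambda>x. g (of_real r * cis (2 * pi * x)))" for A
    by (rule continuous_on_circle[OF c r(1) r1])
  have cw: "continuous_on A (\<lambda>x. g (w * cis (2 * pi * x)))" if "cmod w < 1" for A w
    by (rule continuous_on_compose2[OF c]) (use that in \<open>auto intro!: continuous_intros simp: norm_mult\<close>)
  have K: "K holomorphic_on ball 0 1"
    unfolding K_def
  proof (rule leibniz_rule_holomorphic)
    fix w :: complex and x :: real assume w: "w \<in> ball 0 1"
    have "w * cis (2 * pi * x) \<in> ball 0 1" using w by (simp add: norm_mult)
    then have "(g has_field_derivative deriv g (w * cis (2 * pi * x))) (at (w * cis (2 * pi * x)))"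
      by (intro holomorphic_derivI[OF g]) auto
    then have "((\<lambda>w. g (w * cis (2 * pi * x))) has_field_derivative deriv g (w * cis (2 * pi * x)) * cis (2 * pi * x)) (at w within ball 0 1)"
      by (rule DERIV_chain2[where f = g and g = "\<lambda>w. w * cis (2 * pi * x)"]) (auto intro!: derivative_eq_intros)
    from DERIV_cmult_right[OF this]
    show "((\<lambda>w. g (w * cis (2 * pi * x)) * cnj (g (of_real r * cis (2 * pi * x)))) has_field_derivative
      deriv g (w * cis (2 * pi * x)) * cis (2 * pi * x) * cnj (g (of_real r * cis (2 * pi * x)))) (at w within ball 0 1)"
      by simp
    show "(\<lambda>x. g (w * cis (2 * pi * x)) * cnj (g (of_real r * cis (2 * pi * x)))) integrable_on cbox 0 1"
      using w by (intro integrable_continuous continuous_intros cw cr) auto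
  next
    have "continuous_on (ball 0 1) (deriv g)"
      by (intro holomorphic_on_imp_continuous_on holomorphic_deriv g) auto
    then have 1: "continuous_on (ball 0 1 \<times> cbox 0 1) (\<lambda>p. deriv g (fst p * cis (2 * pi * snd p)))"
      by (rule continuous_on_compose2) (auto intro!: continuous_intros simp: norm_mult)
    have 2: "continuous_on (ball 0 1 \<times> cbox 0 1) (\<lambda>p. g (of_real r * cis (2 * pi * snd p)))"
      by (rule continuous_on_compose2[OF cr[of UNIV]]) (auto intro!: continuous_intros)
    show "continuous_on (ball 0 1 \<times> cbox 0 1) (\<lambda>(w, x). deriv g (w * cis (2 * pi * x)) * cis (2 * pi * x) * cnj (g (of_real r * cis (2 * pi * x))))"
      unfolding case_prod_unfold by (intro continuous_intros 1 2)
  qed auto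
  have IR: "0 \<le> ?I R" "0 \<le> ?I r"
    using r by (auto intro!: circle_mean_nonneg c2)
  have bd: "cmod (K w) \<le> (?I R + ?I r) / 2" if w: "cmod w = R" for w
  proof (cases "R = 0")
    case True
    with w r have "w = 0" "r = 0" "R = 0" by auto
    then show ?thesis by (simp add: K_def norm_mult power2_eq_square circle_mean_def)
  next
    case False
    then have R0: "R > 0" using r by simp
    define v where "v = w / of_real R"
    have v: "cmod v = 1" "w = v * of_real R" using w R0 by (auto simp: v_def norm_divide)
    have "cmod (K w) \<le> integral (cbox 0 1) (\<lambda>x. (cmod (g (v * (of_real R * cis (2 * pi * x)))))\<^sup>2 / 2 + (cmod (g (of_real r * cis (2 * pi * x))))\<^sup>2 / 2)"
      unfolding K_def
    proof (rule integral_norm_bound_integral)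
      show "(\<lambda>x. g (w * cis (2 * pi * x)) * cnj (g (of_real r * cis (2 * pi * x)))) integrable_on cbox 0 1"
        using w r by (intro integrable_continuous continuous_intros cw cr) auto
      show "(\<lambda>x. (cmod (g (v * (of_real R * cis (2 * pi * x)))))\<^sup>2 / 2 + (cmod (g (of_real r * cis (2 * pi * x))))\<^sup>2 / 2) integrable_on cbox 0 1"
        unfolding mult.assoc[symmetric] v(2)[symmetric]
        using w r by (intro integrable_continuous continuous_intros cw cr) auto
      fix x :: real
      have "a * b \<le> a\<^sup>2 / 2 + b\<^sup>2 / 2" for a b :: real
        using sum_squares_bound[of a b] by simp
      then show "cmod (g (w * cis (2 * pi * x)) * cnj (g (of_real r * cis (2 * pi * x)))) \<le>
         (cmod (g (v * (of_real R * cis (2 * pi * x)))))\<^sup>2 / 2 + (cmod (g (of_real r * cis (2 * pi * x))))\<^sup>2 / 2"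
        by (simp add: norm_mult v(2) mult.assoc)
    qed
    also have "\<dots> = circle_mean R (\<lambda>z. (cmod (g (v * z)))\<^sup>2) / 2 + ?I r / 2"
      unfolding circle_mean_def
      apply (subst Henstock_Kurzweil_Integration.integral_add)
      subgoal
        unfolding mult.assoc[symmetric] v(2)[symmetric]
        using w r by (intro integrable_continuous continuous_intros cw cr) auto
      subgoal
        using w r by (intro integrable_continuous continuous_intros cw cr) auto
      by simp
    also have "circle_mean R (\<lambda>z. (cmod (g (v * z)))\<^sup>2) = ?I R"
      by (rule circle_mean_rotate[of "\<lambda>z. (cmod (g z))\<^sup>2"]) (use r v c2 in auto)
    finally show ?thesis by simp
  qed
  have "cmod (K (of_real r)) \<le> (?I R + ?I r) / 2"
  proof (rule maximum_modulus_frontier[where f = K and S = "cball 0 R" and \<xi> = "of_real r"])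
    show "K holomorphic_on interior (cball 0 R)"
      by (rule holomorphic_on_subset[OF K]) (use r in auto)
    show "continuous_on (closure (cball 0 R)) K"
      using r by (intro continuous_on_subset[OF holomorphic_on_imp_continuous_on[OF K]]) auto
    show "\<And>z. z \<in> frontier (cball 0 R) \<Longrightarrow> cmod (K z) \<le> (?I R + ?I r) / 2"
      using bd r by (auto simp: frontier_cball)
    show "of_real r \<in> cball (0::complex) R" using r by simp
  qed auto
  moreover have "K (of_real r) = of_real (?I r)"
  proof -
    have "((\<lambda>x. (cmod (g (of_real r * cis (2 * pi * x))))\<^sup>2) has_integral ?I r) {0..1}"
      unfolding circle_mean_def by (intro integrable_integral integrable_on_circle[OF c2 r(1) r1])
    from has_integral_linear[OF this bounded_linear_of_real[where 'a=complex]]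
    show ?thesis unfolding K_def
      by (simp add: o_def complex_norm_square integral_unique del: of_real_power)
  qed
  ultimately have "?I r \<le> (?I R + ?I r) / 2" using IR by simp
  then show ?thesis by simp
qed

subsection \<open>Random walks in the disc\<close>

text \<open>A potential of the hyperbolic metric: its invariant Laplacian is constant, so its mean
  over a hyperbolic circle exceeds the value at the centre by an amount that depends on the radius
  only. It serves as the clock of the walk.\<close>

definition disc_pot :: "complex \<Rightarrow> real" where
  "disc_pot z = - ln (1 - (cmod z)\<^sup>2)"

lemma disc_pot_of_real: "disc_pot (of_real r) = - ln (1 - r\<^sup>2)" by (simp add: disc_pot_def)

lemma disc_pot_nonneg: "cmod z < 1 \<Longrightarrow> 0 \<le> disc_pot z"
  by (simp add: disc_pot_def abs_square_less_1)

lemma disc_pot_le_iff: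
  assumes "cmod z < 1" "cmod w < 1" shows "disc_pot z \<le> disc_pot w \<longleftrightarrow> cmod z \<le> cmod w"
proof -
  have "0 < 1 - (cmod z)\<^sup>2" "0 < 1 - (cmod w)\<^sup>2" using assms by (auto simp: abs_square_less_1)
  then have "disc_pot z \<le> disc_pot w \<longleftrightarrow> (cmod z)\<^sup>2 \<le> (cmod w)\<^sup>2" by (simp add: disc_pot_def)
  then show ?thesis by (simp add: power2_le_iff_abs_le)
qed

lemma continuous_on_disc_pot: "continuous_on (ball 0 1) disc_pot"
  unfolding disc_pot_def[abs_def]
proof (intro continuous_intros ballI)
  fix z :: complex assume "z \<in> ball 0 1"
  then have "(cmod z)\<^sup>2 < 1" by (simp add: abs_square_less_1)
  then show "1 - (cmod z)\<^sup>2 \<noteq> 0" by simp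
qed

text \<open>The cross term is the real part of an analytic function of \<open>w\<close> that
  vanishes at 0, so it disappears in circle means; pointwise it is at most 2 ln 2, as the modulus of
  \<open>1 + cnj a * w\<close> is at most 2.\<close>

lemma disc_pot_disc_aut:
  assumes "cmod a < 1" "cmod w < 1"
  shows "disc_pot (disc_aut a w) = disc_pot a + disc_pot w + 2 * Re (Ln (1 + cnj a * w))"
proof -
  have "0 < cmod (1 + cnj a * w)" using disc_aut_denom[OF assms] by simp
  moreover have "0 < 1 - (cmod a)\<^sup>2" "0 < 1 - (cmod w)\<^sup>2" using assms by (auto simp: abs_square_less_1)
  ultimately show ?thesis
    using disc_aut_denom[OF assms] unfolding disc_pot_def disc_aut_norm[OF assms]
    by (simp add: ln_div ln_mult ln_realpow Re_Ln)
qed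

lemma disc_pot_disc_aut_le:
  assumes "cmod a < 1" "cmod w < 1"
  shows "disc_pot (disc_aut a w) \<le> disc_pot a + disc_pot w + 2 * ln 2"
proof -
  have "cmod (1 + cnj a * w) \<le> 1 + cmod a * cmod w"
    by (metis complex_mod_cnj norm_mult norm_one norm_triangle_ineq)
  also have "\<dots> \<le> 2" using mult_le_one[of "cmod a" "cmod w"] assms by simp
  finally have "ln (cmod (1 + cnj a * w)) \<le> ln 2"
    using disc_aut_denom[OF assms] by simp
  then show ?thesis
    using disc_aut_denom[OF assms] by (simp add: disc_pot_disc_aut[OF assms] Re_Ln)
qed

lemma one_plus_cnj_mult_not_nonpos:
  assumes "cmod a < 1" "cmod w < 1" shows "1 + cnj a * w \<notin> \<real>\<^sub>\<le>\<^sub>0"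
proof -
  have "cmod (cnj a * w) < 1"
    using mult_strict_mono[of "cmod a" 1 "cmod w" 1] assms by (simp add: norm_mult)
  then have "0 < Re (1 + cnj a * w)"
    using abs_Re_le_cmod[of "cnj a * w"] by (simp del: times_complex.simps) 
  then show ?thesis by (auto simp: complex_nonpos_Reals_iff)
qed

lemma circle_mean_disc_pot:
  assumes a: "cmod a < 1" and r: "0 \<le> r" "r < 1"
  shows "circle_mean r (\<lambda>w. disc_pot (disc_aut a w)) = disc_pot a + disc_pot (of_real r)"
proof -
  have h: "(\<lambda>w. Ln (1 + cnj a * w)) holomorphic_on ball 0 1"
    using one_plus_cnj_mult_not_nonpos[OF a] by (auto intro!: holomorphic_intros)
  have "circle_mean r (\<lambda>w. disc_pot (disc_aut a w)) =
        integral {0..1} (\<lambda>x. disc_pot a + disc_pot (of_real r) + 2 * Re (Ln (1 + cnj a * (of_real r * cis (2 * pi * x)))))"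
    unfolding circle_mean_def using a r
    by (intro integral_cong) (subst disc_pot_disc_aut; simp add: norm_mult disc_pot_def)
  also have "\<dots> = circle_mean r (\<lambda>w. disc_pot a + disc_pot (of_real r) + 2 * Re (Ln (1 + cnj a * w)))"
    by (simp add: circle_mean_def)
  also have "\<dots> = disc_pot a + disc_pot (of_real r) + circle_mean r (\<lambda>w. 2 * Re (Ln (1 + cnj a * w)))"
    using r by (subst circle_mean_add) (auto intro!: continuous_intros holomorphic_on_imp_continuous_on[OF h])
  also have "circle_mean r (\<lambda>w. 2 * Re (Ln (1 + cnj a * w))) = 2 * Re (circle_mean r (\<lambda>w. Ln (1 + cnj a * w)))"
    unfolding circle_mean_cmult using r by (subst circle_mean_Re) (auto intro!: holomorphic_on_imp_continuous_on[OF h])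
  also have "circle_mean r (\<lambda>w. Ln (1 + cnj a * w)) = 0"
    using circle_mean_holomorphic[OF h r] by simp
  finally show ?thesis by simp
qed

lemma disc_aut_circle_comp_continuous:
  assumes u: "continuous_on (ball 0 1) u" and a: "cmod a < 1"
  shows "continuous_on (ball 0 1) (\<lambda>w. u (disc_aut a w))"
proof (rule continuous_on_compose2[OF u])
  show "continuous_on (ball 0 1) (disc_aut a)"
    by (intro continuous_at_imp_continuous_on ballI DERIV_isCont[OF disc_aut_deriv[OF a]]) auto
qed (use disc_aut_less_1[OF a] in auto)

text \<open>
  One step of the random walk with kernel the hyperbolic circle of radius \<open>\<rho>\<close> raises the mean of
  \<^const>\<open>disc_pot\<close> by exactly \<open>disc_pot \<rho>\<close> and its maximum by at most \<open>disc_pot \<rho> + 2 ln 2\<close>. Hence after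
  \<open>n\<close> steps the walk is outside the circle of radius \<open>r\<close> with the probability implicit below.
\<close>

lemma radial_walk_bound:
  fixes U :: "complex \<Rightarrow> real"
  assumes U: "continuous_on (ball 0 1) U" "\<And>z. cmod z < 1 \<Longrightarrow> 0 \<le> U z"
    and mono: "\<And>z w. cmod z \<le> cmod w \<Longrightarrow> cmod w < 1 \<Longrightarrow> U z \<le> U w"
    and \<rho>: "0 \<le> \<rho>" "\<rho> < 1" and \<kappa>: "1 \<le> \<kappa>" and c: "0 \<le> c"
    and step: "\<And>z. cmod z < 1 \<Longrightarrow> circle_mean \<rho> (\<lambda>w. U (disc_aut z w)) \<le> \<kappa> * U z + c"
    and r: "0 \<le> r" "r < 1" and n: "disc_pot (of_real r) \<le> n * disc_pot (of_real \<rho>)"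
  shows "U (of_real r) * (n * disc_pot (of_real \<rho>) - disc_pot (of_real r)) \<le>
    (n * (disc_pot (of_real \<rho>) + 2 * ln 2) - disc_pot (of_real r)) * (\<kappa> ^ n * (U 0 + n * c))"
proof -
  define F where "F = disc_pot (of_real \<rho>)"
  define X where "X = disc_pot (of_real r)"
  define Y where "Y = n * (F + 2 * ln 2)"
  have F0: "0 \<le> F" using \<rho> by (simp add: F_def disc_pot_nonneg)
  have "0 \<le> n * (2 * ln (2::real))" by simp
  then have XY: "X \<le> Y" using n unfolding F_def X_def Y_def distrib_left by linarith
  have Ur: "0 \<le> U (of_real r)" using U r by auto
  \<comment> \<open>Induction for a walk at \<open>z\<close> with \<open>m\<close> steps left. Its
    final potential has mean \<open>disc_pot z + m * F\<close> and never exceeds \<open>Y\<close>,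
    so it ends beyond radius \<open>r\<close>, where \<open>U\<close> is at least
    \<open>U r\<close>, with probability at least \<open>(disc_pot z + m * F - X) / (Y - X)\<close>.
    The factor after \<open>Y - X\<close> on the right bounds the mean of \<open>U\<close> at the
    end.\<close>
  have "U (of_real r) * (disc_pot z + m * F - X) \<le> (Y - X) * (\<kappa> ^ m * (U z + m * c))"
    if "cmod z < 1" "disc_pot z + m * (F + 2 * ln 2) \<le> Y" for m z
    using that
  proof (induction m arbitrary: z)
    case 0
    show ?case
    proof (cases "X \<le> disc_pot z")
      case True
      then have "r \<le> cmod z" using disc_pot_le_iff[of "of_real r" z] 0 r by (simp add: X_def)
      then have "U (of_real r) \<le> U z" using mono[of "of_real r" z] 0 r by simp
      then have "U (of_real r) * (disc_pot z - X) \<le> U z * (Y - X)"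
        using True 0 Ur by (intro mult_mono) auto
      then show ?thesis by (simp add: mult.commute)
    next
      case False
      then have "U (of_real r) * (disc_pot z - X) \<le> 0"
        using Ur by (intro mult_nonneg_nonpos) auto
      also have "0 \<le> (Y - X) * U z" using XY U 0 by (intro mult_nonneg_nonneg) auto
      finally show ?thesis by simp
    qed
  next
    case (Suc m)
    have Uc: "continuous_on (ball 0 1) (\<lambda>w. U (disc_aut z w))"
      by (rule disc_aut_circle_comp_continuous[OF U(1) Suc.prems(1)])
    have Pc: "continuous_on (ball 0 1) (\<lambda>w. disc_pot (disc_aut z w))"
      by (rule disc_aut_circle_comp_continuous[OF continuous_on_disc_pot Suc.prems(1)])
    have "U (of_real r) * (disc_pot z + Suc m * F - X) =
        circle_mean \<rho> (\<lambda>w. U (of_real r) * (disc_pot (disc_aut z w) + (m * F - X)))"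
      unfolding circle_mean_cmult
      by (subst circle_mean_add)
        (use \<rho> in \<open>auto intro!: Pc simp: circle_mean_disc_pot[OF Suc.prems(1) \<rho>] F_def distrib_right\<close>)
    also have "\<dots> \<le> circle_mean \<rho> (\<lambda>w. (Y - X) * (\<kappa> ^ m * (U (disc_aut z w) + m * c)))"
    proof (intro circle_mean_mono \<rho>)
      fix w :: complex assume w: "cmod w = \<rho>"
      have "disc_pot w = F" using w \<rho> by (simp add: F_def disc_pot_def)
      then have "disc_pot (disc_aut z w) + m * (F + 2 * ln 2) \<le> Y"
        using disc_pot_disc_aut_le[of z w] Suc.prems w \<rho> by (simp add: algebra_simps)
      then show "U (of_real r) * (disc_pot (disc_aut z w) + (m * F - X)) \<le>
          (Y - X) * (\<kappa> ^ m * (U (disc_aut z w) + m * c))"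
        using Suc.IH[of "disc_aut z w"] disc_aut_less_1[of z w] Suc.prems w \<rho> by (simp add: add_diff_eq)
    qed (auto intro!: continuous_intros Uc Pc)
    also have "\<dots> = (Y - X) * (\<kappa> ^ m * (circle_mean \<rho> (\<lambda>w. U (disc_aut z w)) + m * c))"
      unfolding circle_mean_cmult by (subst circle_mean_add) (use \<rho> in \<open>auto intro!: Uc\<close>)
    also have "\<dots> \<le> (Y - X) * (\<kappa> ^ m * (\<kappa> * (U z + Suc m * c)))"
    proof (intro mult_left_mono)
      have "c * (1 + real m) \<le> \<kappa> * (c * (1 + real m))"
        using \<kappa> c mult_right_mono[of 1 \<kappa> "c * (1 + real m)"] by simp
      then show "circle_mean \<rho> (\<lambda>w. U (disc_aut z w)) + m * c \<le> \<kappa> * (U z + Suc m * c)"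
        using step[OF Suc.prems(1)] by (simp add: algebra_simps)
    qed (use XY \<kappa> in auto)
    finally show ?case by (simp add: mult_ac)
  qed
  from this[of 0 n] show ?thesis
    by (simp add: Y_def X_def F_def disc_pot_def)
qed

text \<open>Averaging |g|^2 over all rotations gives the radial function \<open>U\<close>, which is
  the circle mean and hence increases with the radius, as \<open>radial_walk_bound\<close> demands.
  The rotation \<open>a\<close> in the hypothesis lets the step estimate be integrated over
  rotations once the two integrals are exchanged.\<close>

lemma radial_walk_bound_circle:
  assumes g: "g holomorphic_on ball 0 1"
    and \<rho>: "0 \<le> \<rho>" "\<rho> < 1" and \<kappa>: "1 \<le> \<kappa>" and c: "0 \<le> c"
    and step: "\<And>a z. cmod a = 1 \<Longrightarrow> cmod z < 1 \<Longrightarrow>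
      circle_mean \<rho> (\<lambda>w. (cmod (g (a * disc_aut z w)))\<^sup>2) \<le> \<kappa> * (cmod (g (a * z)))\<^sup>2 + c"
    and r: "0 \<le> r" "r < 1" and n: "disc_pot (of_real r) \<le> n * disc_pot (of_real \<rho>)"
  shows "circle_mean r (\<lambda>z. (cmod (g z))\<^sup>2) * (n * disc_pot (of_real \<rho>) - disc_pot (of_real r)) \<le>
    (n * (disc_pot (of_real \<rho>) + 2 * ln 2) - disc_pot (of_real r)) * (\<kappa> ^ n * ((cmod (g 0))\<^sup>2 + n * c))"
proof -
  note gc = holomorphic_on_imp_continuous_on[OF g]
  define u where "u z = (cmod (g z))\<^sup>2" for z
  have uc: "continuous_on (ball 0 1) u" unfolding u_def by (intro continuous_intros gc)
  define U where "U z = integral (cbox 0 1) (\<lambda>x. u (cis (2 * pi * x) * z))" for z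
  have U_eq: "U z = circle_mean (cmod z) u" if z: "cmod z < 1" for z
  proof -
    have "U z = U (cmod z)"
    proof (cases "z = 0")
      case False
      have "circle_mean (cmod z) (\<lambda>w. u (sgn z * w)) = circle_mean (cmod z) u"
        by (rule circle_mean_rotate) (use z uc False in \<open>auto simp: norm_sgn\<close>)
      moreover have "sgn z * (of_real (cmod z) * w) = w * z" for w
        using False by (simp add: sgn_div_norm scaleR_conv_of_real)
      ultimately show ?thesis by (simp add: U_def circle_mean_def mult.commute)
    qed simp
    then show ?thesis by (simp add: U_def circle_mean_def mult.commute)
  qed
  have Uc: "continuous_on (ball 0 1) U"
    unfolding U_def
  proof (rule integral_continuous_on_param)
    show "continuous_on (ball 0 1 \<times> cbox 0 1) (\<lambda>(z, x). u (cis (2 * pi * x) * z))"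
      unfolding case_prod_unfold
      by (rule continuous_on_compose2[OF uc]) (auto intro!: continuous_intros simp: norm_mult)
  qed
  have "U (of_real r) * (n * disc_pot (of_real \<rho>) - disc_pot (of_real r)) \<le>
    (n * (disc_pot (of_real \<rho>) + 2 * ln 2) - disc_pot (of_real r)) * (\<kappa> ^ n * (U 0 + n * c))"
  proof (rule radial_walk_bound[OF Uc _ _ \<rho> \<kappa> c _ r n])
    show "0 \<le> U z" if "cmod z < 1" for z
      unfolding U_eq[OF that] by (rule circle_mean_nonneg[OF uc]) (use that in \<open>auto simp: u_def\<close>)
    show "U z \<le> U w" if "cmod z \<le> cmod w" "cmod w < 1" for z w
      using circle_mean_square_mono[OF g, of "cmod z" "cmod w"] that
      by (simp add: U_eq u_def[abs_def])
    show "circle_mean \<rho> (\<lambda>w. U (disc_aut z w)) \<le> \<kappa> * U z + c" if z: "cmod z < 1" for z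
    proof -
      let ?f = "\<lambda>x y. u (cis (2 * pi * x) * disc_aut z (of_real \<rho> * cis (2 * pi * y)))"
      have dc: "continuous_on UNIV (\<lambda>y. disc_aut z (of_real \<rho> * cis (2 * pi * y)))"
        by (rule continuous_on_circle) (use disc_aut_circle_comp_continuous[OF continuous_on_id z] \<rho>
          in \<open>auto\<close>)
      have less1: "cmod (disc_aut z (of_real \<rho> * cis (2 * pi * y))) < 1" for y
        by (rule disc_aut_less_1[OF z]) (use \<rho> in \<open>auto simp: norm_mult\<close>)
      have cont: "continuous_on A (\<lambda>p. ?f (snd p) (fst p))" for A
        by (rule continuous_on_compose2[OF uc])
           (auto intro!: continuous_intros continuous_on_compose2[OF dc] simp: norm_mult less1)
      have cont1: "continuous_on A (\<lambda>x. u (cis (2 * pi * x) * z))" for A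
        by (rule continuous_on_compose2[OF uc]) (auto intro!: continuous_intros simp: norm_mult z)
      have cont2: "continuous_on A (\<lambda>x. integral (cbox 0 1) (\<lambda>y. ?f x y))" for A
      proof (rule integral_continuous_on_param)
        show "continuous_on (A \<times> cbox 0 1) (\<lambda>(x, y). ?f x y)"
          unfolding case_prod_unfold
          by (rule continuous_on_compose2[OF uc])
           (auto intro!: continuous_intros continuous_on_compose2[OF dc] simp: norm_mult less1)
      qed
      have "circle_mean \<rho> (\<lambda>w. U (disc_aut z w)) =
          integral (cbox 0 1) (\<lambda>y. integral (cbox 0 1) (\<lambda>x. ?f x y))"
        by (simp add: circle_mean_def U_def)
      also have "\<dots> = integral (cbox 0 1) (\<lambda>x. integral (cbox 0 1) (\<lambda>y. ?f x y))"
        by (rule integral_swap_continuous) (use cont in \<open>simp add: case_prod_unfold\<close>)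
      also have "\<dots> \<le> integral (cbox 0 1) (\<lambda>x. \<kappa> * u (cis (2 * pi * x) * z) + c)"
      proof (rule integral_le)
        fix x :: real
        show "integral (cbox 0 1) (?f x) \<le> \<kappa> * u (cis (2 * pi * x) * z) + c"
          using step[of "cis (2 * pi * x)" z] z by (simp add: u_def circle_mean_def)
      qed (auto intro!: integrable_continuous_real continuous_intros cont1 cont2[unfolded cbox_interval])
      also have "\<dots> = \<kappa> * U z + c"
        unfolding U_def
        by (subst integral_add) (auto intro!: integrable_continuous_real continuous_intros cont1)
      finally show ?thesis .
    qed
  qed
  then show ?thesis using r by (simp add: U_eq u_def[abs_def] circle_mean_def)
qed

subsection \<open>The extremal variance\<close>

text \<open>Here t = ln (1 / (1 - r)), the logarithm that normalises all three quantities of the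
  theorem; it differs from \<open>disc_pot\<close> by at most 1.\<close>

definition hyp_radius :: "real \<Rightarrow> real" where "hyp_radius t = 1 - exp (- t)"

text \<open>The function V of the overview. The supremum is a genuine real one because of the growth
  bound in \<open>bloch_osc_bdd\<close>.\<close>

definition bloch_osc :: "real \<Rightarrow> real" where
  "bloch_osc t = (SUP b\<in>bloch_unit_ball. circle_mean (hyp_radius t) (\<lambda>z. (cmod (b z - b 0))\<^sup>2))"

lemma hyp_radius: "0 \<le> t \<Longrightarrow> 0 \<le> hyp_radius t" "hyp_radius t < 1"
  by (auto simp: hyp_radius_def)

lemma hyp_radius_ln: "0 \<le> r \<Longrightarrow> r < 1 \<Longrightarrow> hyp_radius (ln (1 / (1 - r))) = r"
  by (simp add: hyp_radius_def ln_div exp_minus)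

lemma disc_pot_hyp_radius: "disc_pot (of_real (hyp_radius t)) = t - ln (2 - exp (- t))" if "0 \<le> t"
proof -
  have "1 - (hyp_radius t)\<^sup>2 = exp (- t) * (2 - exp (- t))"
    by (simp add: hyp_radius_def power2_eq_square algebra_simps)
  moreover have "exp (- t) \<le> 1" using that by simp
  then have "2 - exp (- t) > 0" by linarith
  ultimately show ?thesis by (simp add: disc_pot_of_real ln_mult)
qed

lemma disc_pot_hyp_radius_bounds:
  assumes "0 \<le> t"
  shows "disc_pot (of_real (hyp_radius t)) \<le> t" "t - 1 \<le> disc_pot (of_real (hyp_radius t))"
proof -
  have "exp (- t) \<le> 1" using assms by simp
  then have "2 - exp (- t) > 0" "1 \<le> 2 - exp (- t)" by linarith+
  then have "0 \<le> ln (2 - exp (- t))" "ln (2 - exp (- t)) \<le> (2 - exp (- t)) - 1"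
    using ln_ge_zero ln_le_minus_one by blast+
  moreover have "0 < exp (- t)" by simp
  ultimately show "disc_pot (of_real (hyp_radius t)) \<le> t" "t - 1 \<le> disc_pot (of_real (hyp_radius t))"
    unfolding disc_pot_hyp_radius[OF assms] by linarith+
qed

lemma bloch_growth_hyp_radius:
  assumes b: "b \<in> bloch_unit_ball" and t: "0 \<le> t" and z: "cmod z = hyp_radius t"
  shows "cmod (b z - b 0) \<le> (t + 1) / 2"
proof -
  have e: "exp (- t) \<le> 1" "0 < exp (- t)" using t by simp_all
  have "cmod (b z - b 0) \<le> ln ((1 + cmod z) / (1 - cmod z)) / 2"
    by (rule bloch_growth_0[OF b]) (use z hyp_radius in auto)
  also have "ln ((1 + cmod z) / (1 - cmod z)) = ln (2 - exp (- t)) + t"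
  proof -
    have "2 - exp (- t) > 0" using e by linarith
    then show ?thesis by (simp add: z hyp_radius_def ln_div)
  qed
  also have "ln (2 - exp (- t)) \<le> (2 - exp (- t)) - 1"
    by (rule ln_le_minus_one) (use e in linarith)
  finally have "cmod (b z - b 0) \<le> (2 - exp (- t) - 1 + t) / 2" by simp
  also have "\<dots> \<le> (t + 1) / 2" using e by (intro divide_right_mono) linarith+
  finally show ?thesis .
qed

lemma bloch_osc_bdd:
  assumes "b \<in> bloch_unit_ball" "0 \<le> t"
  shows "circle_mean (hyp_radius t) (\<lambda>z. (cmod (b z - b 0))\<^sup>2) \<le> ((t + 1) / 2)\<^sup>2"
proof -
  have "circle_mean (hyp_radius t) (\<lambda>z. (cmod (b z - b 0))\<^sup>2) \<le> circle_mean (hyp_radius t) (\<lambda>z. ((t + 1) / 2)\<^sup>2)"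
    using assms hyp_radius
    by (intro circle_mean_mono power_mono bloch_growth_hyp_radius)
       (auto intro!: continuous_intros bloch_unit_ball_continuous[OF assms(1)])
  then show ?thesis by simp
qed

lemma bloch_osc_upper:
  assumes "b \<in> bloch_unit_ball" "0 \<le> t"
  shows "circle_mean (hyp_radius t) (\<lambda>z. (cmod (b z - b 0))\<^sup>2) \<le> bloch_osc t"
  unfolding bloch_osc_def
  using assms bloch_osc_bdd by (intro cSUP_upper) (auto intro!: bdd_aboveI2)

lemma bloch_osc_nonneg: "0 \<le> t \<Longrightarrow> 0 \<le> bloch_osc t"
  using bloch_osc_upper[OF zero_in_bloch_unit_ball, of t] by simp

lemma bloch_osc_least:
  assumes "\<And>b. b \<in> bloch_unit_ball \<Longrightarrow> circle_mean (hyp_radius t) (\<lambda>z. (cmod (b z - b 0))\<^sup>2) \<le> c"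
  shows "bloch_osc t \<le> c"
  unfolding bloch_osc_def using assms zero_in_bloch_unit_ball by (intro cSUP_least) auto

lemma bloch_osc_lower:
  assumes "c < bloch_osc t" "0 \<le> t"
  obtains b where "b \<in> bloch_unit_ball" "b 0 = 0" "c < circle_mean (hyp_radius t) (\<lambda>z. (cmod (b z))\<^sup>2)"
proof -
  obtain b where b: "b \<in> bloch_unit_ball" "c < circle_mean (hyp_radius t) (\<lambda>z. (cmod (b z - b 0))\<^sup>2)"
    using bloch_osc_least[of t c] assms by force
  show ?thesis
    by (rule that[of "\<lambda>z. b z - b 0"]) (use b in \<open>auto intro: bloch_unit_ball_minus_const\<close>)
qed

text \<open>After \<open>n\<close> steps of size \<open>T\<close> the mean potential is at least n
  (T - 1), so the hypothesis on \<open>n\<close> leaves an excess \<open>X\<close> of at least 2 K n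
  over the target. The uncertainty 2 ln 2 per step costs at most \<open>X / K\<close>, whence the
  factor 1 + 1 / K.\<close>

lemma walk_bound:
  assumes g: "g holomorphic_on ball 0 1"
    and T: "0 \<le> T" and K: "0 < K" and \<kappa>: "1 \<le> \<kappa>" and c: "0 \<le> c" and t: "0 < t"
    and step: "\<And>a z. cmod a = 1 \<Longrightarrow> cmod z < 1 \<Longrightarrow>
      circle_mean (hyp_radius T) (\<lambda>w. (cmod (g (a * disc_aut z w)))\<^sup>2) \<le> \<kappa> * (cmod (g (a * z)))\<^sup>2 + c"
    and n: "t + 2 * K * n \<le> n * (T - 1)"
  shows "circle_mean (hyp_radius t) (\<lambda>z. (cmod (g z))\<^sup>2) \<le> (1 + 1 / K) * (\<kappa> ^ n * ((cmod (g 0))\<^sup>2 + n * c))"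
proof -
  let ?M = "circle_mean (hyp_radius t) (\<lambda>z. (cmod (g z))\<^sup>2)"
  define Q where "Q = \<kappa> ^ n * ((cmod (g 0))\<^sup>2 + n * c)"
  define F where "F = disc_pot (of_real (hyp_radius T))"
  define X where "X = n * F - disc_pot (of_real (hyp_radius t))"
  have n0: "n > 0" using n t by (cases "n = 0") auto
  have "n * (T - 1) \<le> n * F"
    using disc_pot_hyp_radius_bounds[OF T] by (intro mult_left_mono) (auto simp: F_def)
  with n disc_pot_hyp_radius_bounds(1)[of t] t have X: "2 * K * n \<le> X"
    by (simp add: X_def)
  have Kn: "0 < 2 * K * n" using K n0 by simp
  have Q: "0 \<le> Q" using \<kappa> c by (simp add: Q_def)
  have "?M * X \<le> (n * (F + 2 * ln 2) - disc_pot (of_real (hyp_radius t))) * Q"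
    unfolding X_def Q_def F_def
    by (rule radial_walk_bound_circle[OF g _ _ \<kappa> c step])
      (use T t hyp_radius X Kn in \<open>auto simp: X_def F_def\<close>)
  also have "n * (F + 2 * ln 2) - disc_pot (of_real (hyp_radius t)) = X + real (2 * n) * ln 2"
    by (simp add: X_def algebra_simps)
  also have "(X + real (2 * n) * ln 2) * Q \<le> (X + X / K) * Q"
  proof (intro mult_right_mono add_left_mono Q)
    have "(2 * real n) * ln (2::real) \<le> (2 * real n) * 1" by (intro mult_left_mono) (auto simp: ln_2_less_1 less_imp_le)
    also have "\<dots> \<le> X / K" using X K by (simp add: field_simps)
    finally show "real (2 * n) * ln 2 \<le> X / K" by simp
  qed
  finally have "?M * X \<le> ((1 + 1 / K) * Q) * X" by (simp add: algebra_simps)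
  then show ?thesis using X Kn by (simp add: Q_def)
qed

text \<open>Each step adds at most \<open>bloch_osc T\<close> to the mean square: the function
  recentred at the current point is again in the unit ball, and Pythagoras splits off its value at
  the centre.\<close>

lemma bloch_osc_subadditive:
  fixes n :: nat and T K t :: real
  assumes T: "0 \<le> T" and K: "0 < K" and t: "0 < t" and n: "t + 2 * K * n \<le> n * (T - 1)"
  shows "bloch_osc t \<le> (1 + 1 / K) * n * bloch_osc T"
proof (rule bloch_osc_least)
  fix b assume b: "b \<in> bloch_unit_ball"
  define g where "g z = b z - b 0" for z
  have gb: "g \<in> bloch_unit_ball" unfolding g_def by (rule bloch_unit_ball_minus_const[OF b])
  have "circle_mean (hyp_radius t) (\<lambda>z. (cmod (g z))\<^sup>2) \<le> (1 + 1 / K) * (1 ^ n * ((cmod (g 0))\<^sup>2 + n * bloch_osc T))"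
  proof (rule walk_bound[OF _ T K _ _ t _ n])
    show "g holomorphic_on ball 0 1" by (rule bloch_unit_ball_holomorphic[OF gb])
    show "0 \<le> bloch_osc T" by (rule bloch_osc_nonneg[OF T])
    fix a z :: complex assume a: "cmod a = 1" and z: "cmod z < 1"
    have h: "(\<lambda>w. g (a * disc_aut z w)) \<in> bloch_unit_ball"
      using bloch_unit_ball_disc_aut[OF bloch_unit_ball_rotate[OF gb a] z] .
    show "circle_mean (hyp_radius T) (\<lambda>w. (cmod (g (a * disc_aut z w)))\<^sup>2) \<le> 1 * (cmod (g (a * z)))\<^sup>2 + bloch_osc T"
      using circle_mean_square_holomorphic[OF bloch_unit_ball_holomorphic[OF h] hyp_radius(1)[OF T] hyp_radius(2)]
        bloch_osc_upper[OF h T] by (simp add: disc_aut_0)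
  qed simp
  then show "circle_mean (hyp_radius t) (\<lambda>z. (cmod (b z - b 0))\<^sup>2) \<le> (1 + 1 / K) * n * bloch_osc T"
    by (simp add: g_def)
qed

text \<open>The common value in the theorem, S in the overview. The limit exists by
  \<open>bloch_osc_limit\<close>, so \<open>Lim\<close> denotes it.\<close>

definition bloch_variance :: real where
  "bloch_variance = Lim at_top (\<lambda>T. bloch_osc T / T)"

text \<open>Fekete's argument for an almost subadditive function. Taking K = sqrt T in
  \<open>bloch_osc_subadditive\<close> makes both 1 + 1 / K and \<open>d T / T\<close> tend to 1.
  Every \<open>\<Psi> T\<close> bounds the upper limit of \<open>bloch_osc t / t\<close>, while
  \<open>\<Psi> T\<close> differs from \<open>bloch_osc T / T\<close> by a factor tending to 1; so
  the limit is the infimum of \<open>\<Psi>\<close>, taken over T \<ge> 9 to keep \<open>d\<close>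
  positive.\<close>

lemma bloch_osc_limit: "\<exists>S\<ge>0. ((\<lambda>T. bloch_osc T / T) \<longlongrightarrow> S) at_top"
proof -
  define d where "d T = T - 1 - 2 * sqrt T" for T :: real
  define \<Psi> where "\<Psi> T = (1 + 1 / sqrt T) * (bloch_osc T / d T)" for T
  have d: "d T > 0" if "T \<ge> 9" for T
  proof -
    have "sqrt 9 \<le> sqrt T" using that by (intro real_sqrt_le_mono)
    moreover have "sqrt 9 = (3::real)" by (rule real_sqrt_unique) auto
    ultimately have 3: "3 \<le> sqrt T" by simp
    then have "3 * sqrt T \<le> sqrt T * sqrt T" using that by (intro mult_right_mono) auto
    moreover have "sqrt T * sqrt T = T" using that by (intro real_sqrt_mult_self[THEN trans]) auto
    ultimately have "3 * sqrt T \<le> T" "3 \<le> sqrt T" using 3 by auto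
    then show ?thesis unfolding d_def by linarith
  qed
  have \<Psi>0: "0 \<le> \<Psi> T" if "T \<ge> 9" for T
    using d[OF that] that bloch_osc_nonneg[of T] by (simp add: \<Psi>_def)
  define S where "S = (INF T\<in>{9..}. \<Psi> T)"
  have bdd: "bdd_below (\<Psi> ` {9..})" by (rule bdd_belowI2[of _ 0]) (use \<Psi>0 in auto)
  have S0: "0 \<le> S" unfolding S_def by (rule cINF_greatest) (use \<Psi>0 in auto)
  have S_le: "S \<le> \<Psi> T" if "T \<ge> 9" for T unfolding S_def by (rule cINF_lower[OF bdd]) (use that in auto)
  have up: "bloch_osc t / t \<le> \<Psi> T + (1 + 1 / sqrt T) * bloch_osc T / t" if T: "T \<ge> 9" and t: "t > 0" for t T
  proof -
    define n where "n = nat \<lceil>t / d T\<rceil>"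
    have n: "t / d T \<le> n" "n \<le> t / d T + 1"
      using d[OF T] t by (auto simp: n_def of_nat_ceiling ceiling_correct) 
    have "t \<le> n * d T" using n(1) d[OF T] by (simp add: field_simps)
    then have "bloch_osc t \<le> (1 + 1 / sqrt T) * n * bloch_osc T"
      using T t by (intro bloch_osc_subadditive) (auto simp: d_def algebra_simps)
    also have "\<dots> \<le> (1 + 1 / sqrt T) * (t / d T + 1) * bloch_osc T"
      using n(2) T bloch_osc_nonneg[of T] by (intro mult_right_mono mult_left_mono) auto
    finally have "bloch_osc t / t \<le> (1 + 1 / sqrt T) * (t / d T + 1) * bloch_osc T / t"
      using t by (intro divide_right_mono) auto
    also have "\<dots> = \<Psi> T + (1 + 1 / sqrt T) * bloch_osc T / t"
    proof -
      have alg: "c * (x / y + 1) * q / x = c * (q / y) + c * q / x" if "x \<noteq> 0" "y \<noteq> 0" for c x y q :: real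
        using that by (simp add: field_simps)
      show ?thesis unfolding \<Psi>_def by (rule alg) (use t d[OF T] in auto)
    qed
    finally show ?thesis .
  qed
  have "((\<lambda>T. bloch_osc T / T) \<longlongrightarrow> S) at_top"
  proof (rule order_tendstoI)
    fix a assume a: "a < S"
    have "((\<lambda>t. S * (d t / (t * (1 + 1 / sqrt t)))) \<longlongrightarrow> S * 1) at_top"
      unfolding d_def by (intro tendsto_mult tendsto_const) real_asymp
    then have "\<forall>\<^sub>F t in at_top. a < S * (d t / (t * (1 + 1 / sqrt t)))"
      using a by (intro order_tendstoD(1)) auto
    then show "\<forall>\<^sub>F t in at_top. a < bloch_osc t / t"
      using eventually_ge_at_top[of 9]
    proof eventually_elim
      case (elim t)
      have "S * (d t / (t * (1 + 1 / sqrt t))) \<le> \<Psi> t * (d t / (t * (1 + 1 / sqrt t)))"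
        using elim d[of t] by (intro mult_right_mono S_le) auto
      also have "\<dots> = bloch_osc t / t"
      proof -
        have "0 < 1 + 1 / sqrt t" using elim by (simp add: add_pos_pos)
        then show ?thesis using d[of t] elim unfolding \<Psi>_def by (simp add: divide_simps del: add_divide_distrib)
      qed
      finally show ?case using elim by simp
    qed
  next
    fix a assume a: "S < a"
    then obtain T where T: "T \<ge> 9" "\<Psi> T < a" unfolding S_def
      by (metis atLeast_iff bdd cINF_less_iff empty_iff order_refl)
    have "((\<lambda>t. \<Psi> T + (1 + 1 / sqrt T) * bloch_osc T / t) \<longlongrightarrow> \<Psi> T) at_top"
      by real_asymp
    then have "\<forall>\<^sub>F t in at_top. \<Psi> T + (1 + 1 / sqrt T) * bloch_osc T / t < a"
      using T by (intro order_tendstoD(2)) auto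
    then show "\<forall>\<^sub>F t in at_top. bloch_osc t / t < a"
      using eventually_gt_at_top[of 0]
      by eventually_elim (use up[OF T(1)] in force)
  qed
  with S0 show ?thesis by blast
qed

lemma bloch_variance_tendsto: "((\<lambda>T. bloch_osc T / T) \<longlongrightarrow> bloch_variance) at_top"
  and bloch_variance_nonneg: "0 \<le> bloch_variance"
proof -
  obtain S where S: "S \<ge> 0" "((\<lambda>T. bloch_osc T / T) \<longlongrightarrow> S) at_top" using bloch_osc_limit by blast
  then have "bloch_variance = S" unfolding bloch_variance_def by (intro tendsto_Lim) auto
  with S show "((\<lambda>T. bloch_osc T / T) \<longlongrightarrow> bloch_variance) at_top" "0 \<le> bloch_variance" by auto
qed

section \<open>Exponential moments, uniformly over the unit ball\<close>

lemma norm_exp_minus_one_le: "cmod (exp w - 1) \<le> cmod w * exp (cmod w)"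
proof -
  have "cmod (exp w - exp 0) \<le> exp (cmod w) * cmod (w - 0)"
  proof (rule field_differentiable_bound[where S = "cball 0 (cmod w)" and f' = exp])
    fix z :: complex assume "z \<in> cball 0 (cmod w)"
    then show "cmod (exp z) \<le> exp (cmod w)"
      using norm_exp[of z] by (meson dual_order.trans exp_le_cancel_iff mem_cball_0)
  qed (auto intro: DERIV_exp has_field_derivative_at_within)
  then show ?thesis by (simp add: mult.commute)
qed

text \<open>The walk bound for the analytic function \<open>exp (\<tau> / 2 * b z)\<close>, whose
  squared modulus is the integrand. In one step the mean is multiplied by at most 1 + k, since
  \<open>G - 1\<close> has mean 0 and its second moment is at most |\<tau> / 2|^2
  \<open>bloch_osc T\<close>, up to the factor \<open>exp (cmod \<tau> * (T + 1))\<close>, which is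
  close to 1 for small \<tau>. All of this is uniform in \<open>b\<close>.\<close>

lemma exp_moment_bound:
  assumes \<epsilon>: "0 < \<epsilon>"
  obtains \<tau>0 C where "0 < \<tau>0" "0 < C"
    "\<And>\<tau> b t. \<lbrakk>cmod \<tau> \<le> \<tau>0; b \<in> bloch_unit_ball; b 0 = 0; 0 < t\<rbrakk> \<Longrightarrow>
      circle_mean (hyp_radius t) (\<lambda>z. cmod (exp (\<tau> * b z))) \<le>
      C * exp ((cmod \<tau>)\<^sup>2 / 4 * (bloch_variance + \<epsilon>) * t)"
proof -
  define S where "S = bloch_variance + \<epsilon>"
  have S0: "0 < S" using \<epsilon> bloch_variance_nonneg by (simp add: S_def)
  \<comment> \<open>T - 3 is (T - 1) - 2 K with K = 1, the progress per step in
    \<open>walk_bound\<close>. The factor 1 + 1 / K = 2 enters once and not per step, so a fixed K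
    suffices.\<close>
  have "((\<lambda>T. bloch_osc T / T * (T / (T - 3))) \<longlongrightarrow> bloch_variance * 1) at_top"
    by (intro tendsto_mult bloch_variance_tendsto) real_asymp
  then have "\<forall>\<^sub>F T in at_top. bloch_osc T / T * (T / (T - 3)) < S"
    using \<epsilon> by (intro order_tendstoD(2)) (auto simp: S_def)
  then have "\<forall>\<^sub>F T in at_top. 3 < T \<and> bloch_osc T / T * (T / (T - 3)) < S"
    using eventually_gt_at_top[of 3] by eventually_elim auto
  then obtain T where T: "3 < T" "bloch_osc T / (T - 3) < S"
    by (auto simp: eventually_at_top_linorder)
  have "((\<lambda>x. exp (x * (T + 1)) * (bloch_osc T / (T - 3))) \<longlongrightarrow> exp (0 * (T + 1)) * (bloch_osc T / (T - 3))) (at_right 0)"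
    by (intro tendsto_intros)
  then have "\<forall>\<^sub>F x in at_right 0. exp (x * (T + 1)) * (bloch_osc T / (T - 3)) < S"
    using T by (intro order_tendstoD(2)) auto
  then obtain \<tau>1 where \<tau>1: "0 < \<tau>1" "\<And>x. 0 < x \<Longrightarrow> x < \<tau>1 \<Longrightarrow> exp (x * (T + 1)) * (bloch_osc T / (T - 3)) < S"
    unfolding eventually_at_right_field by auto
  \<comment> \<open>The cap 1 keeps the effect of rounding the number of steps up, one step at most,
    within the constant \<open>exp (S * (T - 3))\<close>.\<close>
  define \<tau>0 where "\<tau>0 = min 1 (\<tau>1 / 2)"
  have \<tau>0: "0 < \<tau>0" "\<tau>0 \<le> 1" "exp (\<tau>0 * (T + 1)) * bloch_osc T < S * (T - 3)"
    using \<tau>1(1) \<tau>1(2)[of \<tau>0] T by (auto simp: \<tau>0_def field_simps)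
  show ?thesis
  proof (rule that[of \<tau>0 "2 * exp (S * (T - 3))"])
    show "0 < \<tau>0" by (fact \<tau>0)
    fix \<tau> :: complex and b t
    assume \<tau>: "cmod \<tau> \<le> \<tau>0" and b: "b \<in> bloch_unit_ball" and b0: "b 0 = 0" and t: "0 < (t::real)"
    define k where "k = (cmod \<tau>)\<^sup>2 / 4 * (exp (cmod \<tau> * (T + 1)) * bloch_osc T)"
    have osc: "0 \<le> bloch_osc T" using T by (intro bloch_osc_nonneg) auto
    have k0: "0 \<le> k" using osc by (simp add: k_def)
    have "exp (cmod \<tau> * (T + 1)) * bloch_osc T \<le> exp (\<tau>0 * (T + 1)) * bloch_osc T"
      using \<tau> T osc by (intro mult_right_mono) (auto intro!: mult_right_mono)
    then have k: "k \<le> (cmod \<tau>)\<^sup>2 / 4 * (S * (T - 3))"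
      unfolding k_def using \<tau>0(3) by (intro mult_left_mono) auto
    define n where "n = nat \<lceil>t / (T - 3)\<rceil>"
    have n: "t / (T - 3) \<le> n" "n \<le> t / (T - 3) + 1"
      using T t by (auto simp: n_def of_nat_ceiling)
    have g: "(\<lambda>z. exp (\<tau> / 2 * b z)) holomorphic_on ball 0 1"
      by (intro holomorphic_intros bloch_unit_ball_holomorphic b)
    have sq: "(cmod (exp (\<tau> / 2 * w)))\<^sup>2 = cmod (exp (\<tau> * w))" for w
      by (simp add: norm_power[symmetric] exp_double[symmetric])
    have "circle_mean (hyp_radius t) (\<lambda>z. (cmod (exp (\<tau> / 2 * b z)))\<^sup>2) \<le>
      (1 + 1 / 1) * (exp k ^ n * ((cmod (exp (\<tau> / 2 * b 0)))\<^sup>2 + real n * 0))"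
    proof (rule walk_bound[OF g _ _ _ _ t])
      show "t + 2 * 1 * real n \<le> real n * (T - 1)" using n(1) T by (simp add: field_simps)
      fix a z :: complex assume a: "cmod a = 1" and z: "cmod z < 1"
      define h where "h w = b (a * disc_aut z w)" for w
      have hb: "h \<in> bloch_unit_ball"
        unfolding h_def using bloch_unit_ball_disc_aut[OF bloch_unit_ball_rotate[OF b a] z] .
      note hh = bloch_unit_ball_holomorphic[OF hb] and hc = bloch_unit_ball_continuous[OF hb]
      define G where "G w = exp (\<tau> / 2 * (h w - h 0))" for w
      have Gh: "G holomorphic_on ball 0 1" unfolding G_def by (intro holomorphic_intros hh)
      note Gc = holomorphic_on_imp_continuous_on[OF Gh]
      note \<rho> = hyp_radius(1)[of T] hyp_radius(2)[of T]
      have T0: "0 \<le> T" using T by simp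
      have "circle_mean (hyp_radius T) (\<lambda>w. (cmod (G w - G 0))\<^sup>2) \<le>
            circle_mean (hyp_radius T) (\<lambda>w. ((cmod \<tau>)\<^sup>2 / 4 * exp (cmod \<tau> * (T + 1))) * (cmod (h w - h 0))\<^sup>2)"
      proof (intro circle_mean_mono \<rho> T0)
        fix w :: complex assume w: "cmod w = hyp_radius T"
        have "cmod (G w - G 0) \<le> cmod (\<tau> / 2 * (h w - h 0)) * exp (cmod (\<tau> / 2 * (h w - h 0)))"
          unfolding G_def using norm_exp_minus_one_le[of "\<tau> / 2 * (h w - h 0)"] by simp
        also have "\<dots> \<le> cmod (\<tau> / 2 * (h w - h 0)) * exp (cmod \<tau> * (T + 1) / 2)"
        proof (intro mult_left_mono)
          have "cmod \<tau> * cmod (h w - h 0) \<le> cmod \<tau> * (T + 1)"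
            using bloch_growth_hyp_radius[OF hb T0 w] T0 by (intro mult_left_mono) auto
          then show "exp (cmod (\<tau> / 2 * (h w - h 0))) \<le> exp (cmod \<tau> * (T + 1) / 2)"
            by (simp add: norm_mult norm_divide)
        qed auto
        finally have "(cmod (G w - G 0))\<^sup>2 \<le> (cmod (\<tau> / 2 * (h w - h 0)) * exp (cmod \<tau> * (T + 1) / 2))\<^sup>2"
          by (intro power_mono) auto
        also have "\<dots> = ((cmod \<tau>)\<^sup>2 / 4 * exp (cmod \<tau> * (T + 1))) * (cmod (h w - h 0))\<^sup>2"
          by (simp add: power_mult_distrib norm_mult norm_divide power_divide exp_double[symmetric])
        finally show "(cmod (G w - G 0))\<^sup>2 \<le> ((cmod \<tau>)\<^sup>2 / 4 * exp (cmod \<tau> * (T + 1))) * (cmod (h w - h 0))\<^sup>2" .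
      qed (auto intro!: continuous_intros Gc hc)
      also have "\<dots> \<le> ((cmod \<tau>)\<^sup>2 / 4 * exp (cmod \<tau> * (T + 1))) * bloch_osc T"
        unfolding circle_mean_cmult by (intro mult_left_mono bloch_osc_upper hb T0) auto
      also have "\<dots> = k" by (simp add: k_def)
      finally have "circle_mean (hyp_radius T) (\<lambda>w. (cmod (G w))\<^sup>2) \<le> 1 + k"
        using circle_mean_square_holomorphic[OF Gh hyp_radius(1)[OF T0] hyp_radius(2)] by (simp add: G_def)
      also have "\<dots> \<le> exp k" by (rule exp_ge_add_one_self)
      finally have *: "circle_mean (hyp_radius T) (\<lambda>w. (cmod (G w))\<^sup>2) \<le> exp k" .
      have "(cmod (exp (\<tau> / 2 * b (a * disc_aut z w))))\<^sup>2 = (cmod (exp (\<tau> / 2 * b (a * z))))\<^sup>2 * (cmod (G w))\<^sup>2" for w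
        unfolding G_def h_def by (simp add: disc_aut_0 norm_mult[symmetric] power_mult_distrib[symmetric] exp_add[symmetric] algebra_simps)
      then have "circle_mean (hyp_radius T) (\<lambda>w. (cmod (exp (\<tau> / 2 * b (a * disc_aut z w))))\<^sup>2) =
        (cmod (exp (\<tau> / 2 * b (a * z))))\<^sup>2 * circle_mean (hyp_radius T) (\<lambda>w. (cmod (G w))\<^sup>2)"
        by (simp only: circle_mean_cmult)
      also have "\<dots> \<le> (cmod (exp (\<tau> / 2 * b (a * z))))\<^sup>2 * exp k"
        by (intro mult_left_mono *) auto
      finally show "circle_mean (hyp_radius T) (\<lambda>w. (cmod (exp (\<tau> / 2 * b (a * disc_aut z w))))\<^sup>2) \<le>
        exp k * (cmod (exp (\<tau> / 2 * b (a * z))))\<^sup>2 + 0" by (simp add: mult.commute)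
    qed (use T k0 in auto)
    also have "\<dots> = 2 * exp (n * k)" by (simp add: b0 exp_of_nat_mult)
    also have "\<dots> \<le> 2 * exp ((cmod \<tau>)\<^sup>2 / 4 * S * t + S * (T - 3))"
    proof -
      have "n * k \<le> (t / (T - 3) + 1) * ((cmod \<tau>)\<^sup>2 / 4 * (S * (T - 3)))"
        using n(2) k k0 T t by (intro mult_mono) auto
      also have "\<dots> = (cmod \<tau>)\<^sup>2 / 4 * S * t + (cmod \<tau>)\<^sup>2 / 4 * (S * (T - 3))"
        using T by (simp add: field_simps)
      also have "(cmod \<tau>)\<^sup>2 / 4 * (S * (T - 3)) \<le> 1 * (S * (T - 3))"
        using \<tau> \<tau>0 S0 T power_mono[of "cmod \<tau>" 1 2] by (intro mult_right_mono) auto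
      finally show ?thesis by simp
    qed
    finally show "circle_mean (hyp_radius t) (\<lambda>z. cmod (exp (\<tau> * b z))) \<le>
      2 * exp (S * (T - 3)) * exp ((cmod \<tau>)\<^sup>2 / 4 * (bloch_variance + \<epsilon>) * t)"
      unfolding sq by (simp add: exp_add S_def mult_ac)
  qed simp
qed

subsection \<open>Upper bounds\<close>

lemma circle_integral_eq:
  assumes "continuous_on (ball 0 1) f" "0 \<le> r" "r < 1"
  shows "circle_integral r f = 2 * pi * r * circle_mean r f"
proof -
  have "((\<lambda>x. f (of_real r * cis (2 * pi * x))) has_integral circle_mean r f) {0..1}"
    unfolding circle_mean_def by (intro integrable_integral integrable_on_circle assms)
  from has_integral_stretch_real[OF this, of "1 / (2 * pi)"]
  have "((\<lambda>x. f (of_real r * cis x)) has_integral 2 * pi * circle_mean r f) ((\<lambda>x. x * (2 * pi)) ` {0..1})"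
    by simp
  also have "(\<lambda>x. x * (2 * pi)) ` {0..1} = {0..2*pi}"
    using image_mult_atLeastAtMost[of "2 * pi" 0 1] by (simp add: mult.commute image_mult_atLeastAtMost_if)
  finally have "((\<lambda>x. f (of_real r * cis x) * r) has_integral 2 * pi * circle_mean r f * r) {0..2*pi}"
    by (rule has_integral_mult_left)
  from integral_unique[OF this] show ?thesis unfolding circle_integral_def by (simp only: mult_ac)
qed

lemma norm_circle_mean_le:
  assumes "continuous_on (ball 0 1) f" "0 \<le> r" "r < 1"
  shows "cmod (circle_mean r f) \<le> circle_mean r (\<lambda>z. cmod (f z))"
  unfolding circle_mean_def
  by (intro integral_norm_bound_integral integrable_on_circle assms continuous_intros order_refl)

lemma filterlim_hyp_radius_inverse: "filterlim (\<lambda>r. ln (1 / (1 - r))) at_top (at_left (1::real))"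
  by real_asymp

lemma eventually_at_left_1: "\<forall>\<^sub>F r in at_left (1::real). 0 < r \<and> r < 1"
  unfolding eventually_at_left_field by (rule exI[of _ 0]) auto

lemma Limsup_le_tendsto:
  fixes f g :: "real \<Rightarrow> real"
  assumes "\<forall>\<^sub>F r in F. f r \<le> g r" "(g \<longlongrightarrow> c) F" "F \<noteq> bot"
  shows "Limsup F (\<lambda>r. ereal (f r)) \<le> ereal c"
proof -
  have "Limsup F (\<lambda>r. ereal (f r)) \<le> Limsup F (\<lambda>r. ereal (g r))"
    using assms(1) by (intro Limsup_mono) auto
  also have "\<dots> = ereal c"
    using assms by (intro lim_imp_Limsup) auto
  finally show ?thesis .
qed

lemma asymptotic_variance_le:
  assumes b: "b \<in> bloch_unit_ball"
  shows "asymptotic_variance b \<le> ereal bloch_variance"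
  unfolding asymptotic_variance_def
proof (rule Limsup_le_tendsto)
  define t where "t r = ln (1 / (1 - r))" for r :: real
  have t: "filterlim t at_top (at_left 1)" unfolding t_def by (rule filterlim_hyp_radius_inverse)
  have "((\<lambda>r. r * ((cmod (b 0))\<^sup>2 / t r + bloch_osc (t r) / t r)) \<longlongrightarrow> 1 * (0 + bloch_variance)) (at_left 1)"
    by (intro tendsto_intros tendsto_divide_0[OF tendsto_const] filterlim_compose[OF bloch_variance_tendsto t]
        filterlim_at_top_imp_at_infinity t)
  then show "((\<lambda>r. r * ((cmod (b 0))\<^sup>2 / t r + bloch_osc (t r) / t r)) \<longlongrightarrow> bloch_variance) (at_left 1)" by simp
  show "\<forall>\<^sub>F r in at_left 1. 1 / (2 * pi * \<bar>ln (1 - r)\<bar>) * circle_integral r (\<lambda>z. (cmod (b z))\<^sup>2) \<le>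
      r * ((cmod (b 0))\<^sup>2 / t r + bloch_osc (t r) / t r)"
    using eventually_at_left_1
  proof eventually_elim
    case (elim r)
    have t0: "0 < t r" using elim by (simp add: t_def)
    have tr: "\<bar>ln (1 - r)\<bar> = t r" using elim by (simp add: t_def ln_div)
    have "circle_mean r (\<lambda>z. (cmod (b z))\<^sup>2) = (cmod (b 0))\<^sup>2 + circle_mean r (\<lambda>z. (cmod (b z - b 0))\<^sup>2)"
      using elim by (intro circle_mean_square_holomorphic bloch_unit_ball_holomorphic b) auto
    also have "circle_mean r (\<lambda>z. (cmod (b z - b 0))\<^sup>2) \<le> bloch_osc (t r)"
      using bloch_osc_upper[OF b, of "t r"] t0 hyp_radius_ln[of r] elim by (simp add: t_def)
    finally have "r * circle_mean r (\<lambda>z. (cmod (b z))\<^sup>2) / t r \<le> r * ((cmod (b 0))\<^sup>2 + bloch_osc (t r)) / t r"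
      using elim t0 by (intro divide_right_mono mult_left_mono) auto
    moreover have "circle_integral r (\<lambda>z. (cmod (b z))\<^sup>2) = 2 * pi * r * circle_mean r (\<lambda>z. (cmod (b z))\<^sup>2)"
      using elim by (intro circle_integral_eq continuous_intros bloch_unit_ball_continuous b) auto
    ultimately show ?case using t0 by (simp add: tr add_divide_distrib[symmetric])
  qed
qed simp

text \<open>The range of \<tau> does not depend on \<open>b\<close>, as the limit of suprema
  requires.\<close>

lemma integral_means_spectrum_upper:
  assumes \<epsilon>: "0 < \<epsilon>"
  obtains \<tau>0 where "0 < \<tau>0"
    "\<And>\<tau> b. \<lbrakk>cmod \<tau> \<le> \<tau>0; b \<in> bloch_unit_ball\<rbrakk> \<Longrightarrow>
       integral_means_spectrum b \<tau> \<le> ereal ((cmod \<tau>)\<^sup>2 / 4 * (bloch_variance + \<epsilon>))"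
proof -
  obtain \<tau>0 C where \<tau>0: "0 < \<tau>0" "0 < C"
    "\<And>\<tau> b t. \<lbrakk>cmod \<tau> \<le> \<tau>0; b \<in> bloch_unit_ball; b 0 = 0; 0 < t\<rbrakk> \<Longrightarrow>
      circle_mean (hyp_radius t) (\<lambda>z. cmod (exp (\<tau> * b z))) \<le>
      C * exp ((cmod \<tau>)\<^sup>2 / 4 * (bloch_variance + \<epsilon>) * t)"
    using exp_moment_bound[OF \<epsilon>] by metis
  have "integral_means_spectrum b \<tau> \<le> ereal ((cmod \<tau>)\<^sup>2 / 4 * (bloch_variance + \<epsilon>))"
    if \<tau>: "cmod \<tau> \<le> \<tau>0" and b: "b \<in> bloch_unit_ball" for \<tau> b
    unfolding integral_means_spectrum_def
  proof (rule Limsup_le_tendsto)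
    define t where "t r = ln (1 / (1 - r))" for r :: real
    define k where "k = (cmod \<tau>)\<^sup>2 / 4 * (bloch_variance + \<epsilon>)"
    define L where "L = ln (2 * pi * cmod (exp (\<tau> * b 0)) * C)"
    have t: "filterlim t at_top (at_left 1)" unfolding t_def by (rule filterlim_hyp_radius_inverse)
    have "((\<lambda>r. L / t r + k) \<longlongrightarrow> 0 + k) (at_left 1)"
      by (intro tendsto_intros tendsto_divide_0[OF tendsto_const] filterlim_at_top_imp_at_infinity t)
    then show "((\<lambda>r. L / t r + k) \<longlongrightarrow> (cmod \<tau>)\<^sup>2 / 4 * (bloch_variance + \<epsilon>)) (at_left 1)"
      by (simp add: k_def)
    show "\<forall>\<^sub>F r in at_left 1. 1 / \<bar>ln (1 - r)\<bar> * ln (circle_integral r (\<lambda>z. cmod (exp (\<tau> * b z)))) \<le> L / t r + k"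
      using eventually_at_left_1
    proof eventually_elim
      case (elim r)
      have t0: "0 < t r" using elim by (simp add: t_def)
      have tr: "\<bar>ln (1 - r)\<bar> = t r" using elim by (simp add: t_def ln_div)
      define g where "g z = b z - b 0" for z
      have g: "g \<in> bloch_unit_ball" "g 0 = 0" unfolding g_def using bloch_unit_ball_minus_const[OF b] by auto
      have e: "(\<lambda>z. exp (\<tau> * b z)) holomorphic_on ball 0 1"
        by (intro holomorphic_intros bloch_unit_ball_holomorphic b)
      note ec = holomorphic_on_imp_continuous_on[OF e]
      let ?m = "circle_mean r (\<lambda>z. cmod (exp (\<tau> * b z)))"
      have ci: "circle_integral r (\<lambda>z. cmod (exp (\<tau> * b z))) = 2 * pi * r * ?m"
        using elim by (intro circle_integral_eq continuous_on_norm ec) auto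
      \<comment> \<open>The mean dominates the modulus of the value at the centre; its positivity is
        what makes the logarithm monotone here.\<close>
      have "0 < cmod (exp (\<tau> * b 0))" by simp
      also have "exp (\<tau> * b 0) = circle_mean r (\<lambda>z. exp (\<tau> * b z))"
        using elim by (intro circle_mean_holomorphic[OF e, symmetric]) auto
      also have "cmod \<dots> \<le> ?m" using elim by (intro norm_circle_mean_le ec) auto
      finally have m0: "0 < ?m" .
      have "?m = circle_mean r (\<lambda>z. cmod (exp (\<tau> * b 0)) * cmod (exp (\<tau> * g z)))"
        by (simp add: g_def norm_mult[symmetric] exp_add[symmetric] algebra_simps)
      also have "\<dots> \<le> cmod (exp (\<tau> * b 0)) * (C * exp (k * t r))"
        unfolding circle_mean_cmult k_def
        using \<tau>0(3)[OF \<tau> g t0] hyp_radius_ln[of r] elim by (intro mult_left_mono) (auto simp: t_def)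
      finally have m: "?m \<le> cmod (exp (\<tau> * b 0)) * (C * exp (k * t r))" .
      have "2 * pi * r * ?m \<le> 2 * pi * 1 * (cmod (exp (\<tau> * b 0)) * (C * exp (k * t r)))"
        using elim m0 by (intro mult_mono m) auto
      then have "ln (2 * pi * r * ?m) \<le> ln (2 * pi * cmod (exp (\<tau> * b 0)) * C * exp (k * t r))"
        using elim m0 by (intro ln_mono) (auto simp: mult_ac)
      also have "\<dots> = L + k * t r" using \<tau>0(2) by (simp add: L_def ln_mult)
      finally have "ln (2 * pi * r * ?m) / t r \<le> (L + k * t r) / t r"
        using t0 by (intro divide_right_mono) auto
      then show ?case using t0 unfolding ci tr by (simp add: add_divide_distrib)
    qed
  qed simp
  with \<tau>0(1) show ?thesis by (rule that)
qed

subsection \<open>The dyadic maximal inequality\<close>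

text \<open>The union of the maximal dyadic intervals, down to depth \<open>n\<close>, on which
  \<open>u\<close> has mean at least \<open>a\<close>: halving stops at the first success. The
  finite depth keeps it a finite union of half-open intervals.\<close>

fun dyadic_stop :: "(real \<Rightarrow> real) \<Rightarrow> real \<Rightarrow> nat \<Rightarrow> real \<Rightarrow> real \<Rightarrow> real set" where
  "dyadic_stop u a 0 p l = (if a * l \<le> integral {p..p + l} u then {p..<p + l} else {})"
| "dyadic_stop u a (Suc n) p l = (if a * l \<le> integral {p..p + l} u then {p..<p + l}
     else dyadic_stop u a n p (l / 2) \<union> dyadic_stop u a n (p + l / 2) (l / 2))"

text \<open>Weak type estimate: the stopped intervals are disjoint, and on each the integral of
  \<open>u\<close> is at least \<open>a\<close> times the length.\<close>

lemma dyadic_stop_measure: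
  assumes u: "continuous_on UNIV u" "\<And>x. 0 \<le> u x" and a: "0 < a" and l: "0 \<le> l"
  shows "dyadic_stop u a n p l \<in> sets borel \<and> dyadic_stop u a n p l \<subseteq> {p..<p + l} \<and>
    a * measure lborel (dyadic_stop u a n p l) \<le> integral {p..p + l} u"
  using l
proof (induction n arbitrary: p l)
  case 0
  then show ?case using a u
    by (auto intro!: integral_nonneg integrable_continuous_real continuous_on_subset[OF u(1)])
next
  case (Suc n)
  let ?A = "dyadic_stop u a n p (l / 2)" and ?B = "dyadic_stop u a n (p + l / 2) (l / 2)"
  have A: "?A \<in> sets borel" "?A \<subseteq> {p..<p + l / 2}" "a * measure lborel ?A \<le> integral {p..p + l / 2} u"
    and B: "?B \<in> sets borel" "?B \<subseteq> {p + l / 2..<p + l}" "a * measure lborel ?B \<le> integral {p + l / 2..p + l} u"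
    using Suc.IH[of "l / 2" p] Suc.IH[of "l / 2" "p + l / 2"] Suc.prems by (auto simp: add.assoc)
  have fin: "emeasure lborel ?A < \<infinity>" "emeasure lborel ?B < \<infinity>"
    using emeasure_mono[OF A(2), of lborel] emeasure_mono[OF B(2), of lborel] Suc.prems
    by (auto intro: le_less_trans)
  have "measure lborel (?A \<union> ?B) = measure lborel ?A + measure lborel ?B"
  proof (intro measure_Union)
    show "?A \<inter> ?B = {}" using A(2) B(2) by fastforce
  qed (use A B fin in auto)
  then have "a * measure lborel (?A \<union> ?B) \<le> integral {p..p + l / 2} u + integral {p + l / 2..p + l} u"
    using A(3) B(3) by (simp add: distrib_left)
  also have "\<dots> = integral {p..p + l} u"
    using Suc.prems by (intro Henstock_Kurzweil_Integration.integral_combine integrable_continuous_real continuous_on_subset[OF u(1)]) auto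
  finally have "a * measure lborel (?A \<union> ?B) \<le> integral {p..p + l} u" .
  moreover have "?A \<union> ?B \<subseteq> {p..<p + l}" using A(2) B(2) Suc.prems by fastforce
  ultimately show ?case using A(1) B(1) Suc.prems by auto
qed

text \<open>If the recursion stopped before reaching the given dyadic interval, it did so at an
  ancestor, which is then taken as a whole.\<close>

lemma dyadic_stop_member:
  fixes k :: nat and p l a :: real
  assumes "k < 2 ^ m" "m \<le> n" "0 < l"
    and "x \<in> {p + k * (l / 2 ^ m)..<p + (k + 1) * (l / 2 ^ m)}"
    and "a * (l / 2 ^ m) \<le> integral {p + k * (l / 2 ^ m)..p + (k + 1) * (l / 2 ^ m)} u"
  shows "x \<in> dyadic_stop u a n p l"
  using assms
proof (induction m arbitrary: n p l k)
  case 0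
  then show ?case by (cases n) auto
next
  case (Suc m)
  obtain n' where n: "n = Suc n'" using Suc.prems(2) by (cases n) auto
  have x: "x \<in> {p..<p + l}"
  proof -
    have "real (k + 1) \<le> 2 ^ Suc m" using Suc.prems(1) by (metis Suc_eq_plus1 Suc_leI of_nat_le_iff of_nat_numeral of_nat_power)
    then have "(k + 1) * (l / 2 ^ Suc m) \<le> 2 ^ Suc m * (l / 2 ^ Suc m)"
      using Suc.prems(3) by (intro mult_right_mono) auto
    then have "(k + 1) * (l / 2 ^ Suc m) \<le> l" by simp
    moreover have "0 \<le> k * (l / 2 ^ Suc m)" using Suc.prems(3) by simp
    ultimately show ?thesis using Suc.prems(4) by auto
  qed
  show ?case
  proof (cases "k < 2 ^ m")
    case True
    have "x \<in> dyadic_stop u a n' p (l / 2)"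
      using Suc.prems n by (intro Suc.IH[OF True]) (auto simp: field_simps)
    with x n show ?thesis by simp
  next
    case False
    define j where "j = k - 2 ^ m"
    have k: "k = j + 2 ^ m" "j < 2 ^ m" using False Suc.prems(1) by (auto simp: j_def)
    have eq: "p + l / 2 + j * (l / 2 / 2 ^ m) = p + k * (l / 2 ^ Suc m)"
      "p + l / 2 + (j + 1) * (l / 2 / 2 ^ m) = p + (k + 1) * (l / 2 ^ Suc m)" "l / 2 / 2 ^ m = l / 2 ^ Suc m"
      unfolding k by (auto simp: field_simps)
    have "x \<in> dyadic_stop u a n' (p + l / 2) (l / 2)"
    proof (rule Suc.IH[OF k(2)])
      show "x \<in> {p + l / 2 + j * (l / 2 / 2 ^ m)..<p + l / 2 + (j + 1) * (l / 2 / 2 ^ m)}"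
        unfolding eq(1,2) by (fact Suc.prems(4))
      show "a * (l / 2 / 2 ^ m) \<le> integral {p + l / 2 + j * (l / 2 / 2 ^ m)..p + l / 2 + (j + 1) * (l / 2 / 2 ^ m)} u"
        unfolding eq(1,2) unfolding eq(3) by (fact Suc.prems(5))
    qed (use Suc.prems n in auto)
    with x n show ?thesis by simp
  qed
qed

section \<open>Values inside the disc against means over arcs\<close>

lemma norm_cis_diff_le: "cmod (cis a - cis b) \<le> \<bar>a - b\<bar>"
proof -
  have "cis a - cis b = cis b * (cis (a - b) - 1)"
    by (simp add: right_diff_distrib cis_mult)
  also have "cis (a - b) = exp (\<i> * of_real (a - b))" by (rule cis_conv_exp)
  finally have "cis a - cis b = cis b * (exp (\<i> * of_real (a - b)) - 1)" .
  then have "cmod (cis a - cis b) = 2 * \<bar>sin ((a - b) / 2)\<bar>"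
    by (simp only: norm_mult norm_cis) (simp only: dist_exp_i_1 mult_1)
  also have "\<dots> \<le> 2 * \<bar>(a - b) / 2\<bar>" by (intro mult_left_mono abs_sin_x_le_abs_x) auto
  finally show ?thesis by simp
qed

lemma bloch_arc_lipschitz:
  assumes b: "b \<in> bloch_unit_ball" and r: "0 \<le> r" "r < 1"
  shows "cmod (b (of_real r * cis (2 * pi * x)) - b (of_real r * cis (2 * pi * y))) \<le> 2 * pi * \<bar>x - y\<bar> / (1 - r)"
proof -
  have "cmod (b (of_real r * cis (2 * pi * x)) - b (of_real r * cis (2 * pi * y))) \<le>
      1 / (1 - r) * cmod (of_real r * cis (2 * pi * x) - of_real r * cis (2 * pi * y))"
  proof (rule field_differentiable_bound[where S = "cball 0 r" and f' = "deriv b"])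
    fix z :: complex assume z: "z \<in> cball 0 r"
    then have z1: "cmod z < 1" using r by simp
    show "(b has_field_derivative deriv b z) (at z within cball 0 r)"
      using bloch_unit_ballD(1)[OF b z1] by (rule has_field_derivative_at_within)
    have "1 - r \<le> 1 - (cmod z)\<^sup>2"
    proof -
      have "(cmod z)\<^sup>2 \<le> r\<^sup>2" using z by (intro power_mono) auto
      also have "r\<^sup>2 \<le> r" using r by (simp add: power2_eq_square mult_left_le)
      finally show ?thesis by simp
    qed
    then show "cmod (deriv b z) \<le> 1 / (1 - r)"
      using bloch_unit_ballD(3)[OF b z1] r by (smt (verit) frac_le)
  qed (use r in \<open>auto simp: norm_mult\<close>)
  also have "cmod (of_real r * cis (2 * pi * x) - of_real r * cis (2 * pi * y)) \<le> 1 * \<bar>2 * pi * x - 2 * pi * y\<bar>"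
  proof -
    have "cmod (cis (2 * pi * x) - cis (2 * pi * y)) \<le> \<bar>2 * pi * x - 2 * pi * y\<bar>"
      using norm_cis_diff_le by blast
    then have "r * cmod (cis (2 * pi * x) - cis (2 * pi * y)) \<le> 1 * \<bar>2 * pi * x - 2 * pi * y\<bar>"
      using r by (intro mult_mono) auto
    moreover have "cmod (of_real r * cis (2 * pi * x) - of_real r * cis (2 * pi * y)) = r * cmod (cis (2 * pi * x) - cis (2 * pi * y))"
      using r by (simp add: right_diff_distrib[symmetric] norm_mult del: right_diff_distrib)
    ultimately show ?thesis by simp
  qed
  also have "\<bar>2 * pi * x - 2 * pi * y\<bar> = 2 * pi * \<bar>x - y\<bar>"
    by (simp add: right_diff_distrib[symmetric] abs_mult del: right_diff_distrib)
  finally show ?thesis using r by (simp add: divide_right_mono)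
qed

text \<open>
  Since \<open>2 \<pi> i s \<partial>b/\<partial>s = \<partial>b/\<partial>y\<close> in polar coordinates, the \<open>s\<close>-derivative of the mean over an arc is
  the increment of \<open>b\<close> between its end points, which is integrable in \<open>s\<close> by the logarithmic growth of \<open>b\<close>.
\<close>

lemma bloch_arc_mean_derivative:
  assumes b: "b \<in> bloch_unit_ball" and s: "0 < s" "s < 1" and xy: "x0 \<le> x1"
  shows "((\<lambda>s. integral {x0..x1} (\<lambda>y. b (of_real s * cis (2 * pi * y)))) has_vector_derivative
    (b (of_real s * cis (2 * pi * x1)) - b (of_real s * cis (2 * pi * x0))) / (2 * pi * \<i> * s)) (at s)"
proof -
  have bh: "b holomorphic_on ball 0 1" by (rule bloch_unit_ball_holomorphic[OF b])
  have dc: "continuous_on (ball 0 1) (deriv b)"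
    by (intro holomorphic_on_imp_continuous_on holomorphic_deriv bh) auto
  have "((\<lambda>s. integral (cbox x0 x1) (\<lambda>y. b (of_real s * cis (2 * pi * y)))) has_vector_derivative
     integral (cbox x0 x1) (\<lambda>y. cis (2 * pi * y) * deriv b (of_real s * cis (2 * pi * y)))) (at s within {0<..<1})"
  proof (rule leibniz_rule_vector_derivative)
    fix s y :: real assume s: "s \<in> {0<..<1}"
    have "((\<lambda>s. of_real s * cis (2 * pi * y)) has_vector_derivative cis (2 * pi * y)) (at s)"
      by (rule derivative_eq_intros refl)+ simp
    moreover have "(b has_field_derivative deriv b (of_real s * cis (2 * pi * y))) (at (of_real s * cis (2 * pi * y)))"
      using s by (intro bloch_unit_ballD(1)[OF b]) (simp add: norm_mult)
    ultimately have "(b \<circ> (\<lambda>s. of_real s * cis (2 * pi * y)) has_vector_derivative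
        cis (2 * pi * y) * deriv b (of_real s * cis (2 * pi * y))) (at s)"
      by (rule field_vector_diff_chain_at)
    then show "((\<lambda>s. b (of_real s * cis (2 * pi * y))) has_vector_derivative
        cis (2 * pi * y) * deriv b (of_real s * cis (2 * pi * y))) (at s within {0<..<1})"
      by (simp add: o_def has_vector_derivative_at_within)
    show "(\<lambda>y. b (of_real s * cis (2 * pi * y))) integrable_on cbox x0 x1"
      using s integrable_on_circle[OF bloch_unit_ball_continuous[OF b], of s x0 x1] by simp
  next
    show "continuous_on ({0<..<1} \<times> cbox x0 x1) (\<lambda>(s, y). cis (2 * pi * y) * deriv b (of_real s * cis (2 * pi * y)))"
      unfolding case_prod_unfold
      by (intro continuous_intros continuous_on_compose2[OF dc]) (auto simp: norm_mult)
  qed (use s in auto)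
  then have 1: "((\<lambda>s. integral {x0..x1} (\<lambda>y. b (of_real s * cis (2 * pi * y)))) has_vector_derivative
     integral {x0..x1} (\<lambda>y. cis (2 * pi * y) * deriv b (of_real s * cis (2 * pi * y)))) (at s)"
    using s by (subst (asm) has_vector_derivative_within_open) auto
  have "((\<lambda>y. 2 * pi * \<i> * s * (cis (2 * pi * y) * deriv b (of_real s * cis (2 * pi * y)))) has_integral
      b (of_real s * cis (2 * pi * x1)) - b (of_real s * cis (2 * pi * x0))) {x0..x1}"
  proof (rule fundamental_theorem_of_calculus[OF xy])
    fix y :: real
    have "((\<lambda>y. of_real s * cis (2 * pi * y)) has_vector_derivative 2 * pi * \<i> * s * cis (2 * pi * y)) (at y)"
    proof -
      have "((\<lambda>y. \<i> * of_real (2 * pi * y)) has_vector_derivative \<i> * of_real (2 * pi)) (at y)"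
        by (rule derivative_eq_intros refl)+ simp
      from field_vector_diff_chain_at[OF this DERIV_exp]
      have "((\<lambda>y. cis (2 * pi * y)) has_vector_derivative \<i> * of_real (2 * pi) * cis (2 * pi * y)) (at y)"
        by (simp add: o_def cis_conv_exp)
      from has_vector_derivative_mult_right[OF this, of "of_real s"] show ?thesis by (simp add: mult_ac)
    qed
    moreover have "(b has_field_derivative deriv b (of_real s * cis (2 * pi * y))) (at (of_real s * cis (2 * pi * y)))"
      using s by (intro bloch_unit_ballD(1)[OF b]) (simp add: norm_mult)
    ultimately have "(b \<circ> (\<lambda>y. of_real s * cis (2 * pi * y)) has_vector_derivative
        (2 * pi * \<i> * s * cis (2 * pi * y)) * deriv b (of_real s * cis (2 * pi * y))) (at y)"
      by (rule field_vector_diff_chain_at)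
    then show "((\<lambda>y. b (of_real s * cis (2 * pi * y))) has_vector_derivative
      2 * pi * \<i> * s * (cis (2 * pi * y) * deriv b (of_real s * cis (2 * pi * y)))) (at y within {x0..x1})"
      by (simp add: o_def has_vector_derivative_at_within mult_ac)
  qed
  from integral_unique[OF has_integral_mult_right[OF this, of "1 / (2 * pi * \<i> * s)"]]
  have "integral {x0..x1} (\<lambda>y. cis (2 * pi * y) * deriv b (of_real s * cis (2 * pi * y))) =
      (b (of_real s * cis (2 * pi * x1)) - b (of_real s * cis (2 * pi * x0))) / (2 * pi * \<i> * s)"
    using s by simp
  with 1 show ?thesis by simp
qed

text \<open>Moving from radius \<open>r\<close> to \<open>R\<close> changes the arc integral by at
  most 5 h, however close \<open>R\<close> is to 1, because the derivative in
  \<open>bloch_arc_mean_derivative\<close> has only a logarithmic singularity. On radius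
  \<open>r\<close> itself \<open>b\<close> varies by at most 4 \<pi> \<le> 13 along the arc.
  Together this is 18.\<close>

lemma bloch_arc_mean:
  assumes b: "b \<in> bloch_unit_ball" and h: "1 - r \<le> h" "h \<le> 2 * (1 - r)"
    and r: "1 / 2 \<le> r" "r \<le> R" "R < 1" and x: "x \<in> {p..p + h}"
  shows "cmod (integral {p..p + h} (\<lambda>y. b (of_real R * cis (2 * pi * y))) - h * b (of_real r * cis (2 * pi * x))) \<le> 18 * h"
proof -
  define A where "A s = integral {p..p + h} (\<lambda>y. b (of_real s * cis (2 * pi * y)))" for s :: real
  define a where "a = 1 - r"
  have a: "0 < a" "a \<le> h" "h \<le> 2 * a" using h r by (auto simp: a_def)
  have h0: "0 < h" using a by simp
  have arc: "cmod (b (of_real r * cis (2 * pi * y)) - b (of_real r * cis (2 * pi * y'))) \<le> 4 * pi"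
    if "\<bar>y - y'\<bar> \<le> h" for y y'
  proof -
    have "2 * pi * \<bar>y - y'\<bar> \<le> 2 * pi * (2 * a)" using that a by (intro mult_left_mono) auto
    then have "2 * pi * \<bar>y - y'\<bar> / (1 - r) \<le> 4 * pi" using a(1) by (simp add: field_simps a_def)
    moreover have "cmod (b (of_real r * cis (2 * pi * y)) - b (of_real r * cis (2 * pi * y'))) \<le> 2 * pi * \<bar>y - y'\<bar> / (1 - r)"
      by (rule bloch_arc_lipschitz[OF b]) (use r in auto)
    ultimately show ?thesis by linarith
  qed
  \<comment> \<open>A primitive of the derivative bound: the values at the two ends of the arc are
    within 4 \<pi> at radius \<open>r\<close>, each moves by at most
    \<open>(1 - ln ((1 - s) / a)) / 2\<close> up to radius \<open>s\<close>, and 2 \<pi> s \<ge>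
    \<pi> since s \<ge> 1 / 2.\<close>
  define \<phi> where "\<phi> s = ((1 + 4 * pi) * s + ((1 - s) * ln ((1 - s) / a) - (1 - s))) / pi" for s
  have AR: "cmod (A R - A r) \<le> 5 * h"
  proof (cases "r = R")
    case False
    have "norm (A R - A r) \<le> \<phi> R - \<phi> r"
    proof (rule differentiable_bound_general)
      show "r < R" using False r by simp
      have dA: "(A has_vector_derivative
          (b (of_real s * cis (2 * pi * (p + h))) - b (of_real s * cis (2 * pi * p))) / (2 * pi * \<i> * s)) (at s)"
        if "r \<le> s" "s \<le> R" for s
        unfolding A_def[abs_def] by (rule bloch_arc_mean_derivative[OF b]) (use that r h0 in auto)
      have d\<phi>: "(\<phi> has_real_derivative (1 + 4 * pi - ln ((1 - s) / a)) / pi) (at s)" if "r \<le> s" "s \<le> R" for s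
      proof -
        have "((\<lambda>s. ln ((1 - s) / a)) has_real_derivative - 1 / (1 - s)) (at s)"
          using that r a by (auto intro!: derivative_eq_intros simp: divide_simps)
        moreover have "((\<lambda>s. 1 - s) has_real_derivative - 1) (at s)" by (auto intro!: derivative_eq_intros)
        ultimately have "((\<lambda>s. (1 - s) * ln ((1 - s) / a)) has_real_derivative
            - 1 * ln ((1 - s) / a) + - 1 / (1 - s) * (1 - s)) (at s)"
          by (intro DERIV_mult)
        moreover have "- 1 * ln ((1 - s) / a) + - 1 / (1 - s) * (1 - s) = - ln ((1 - s) / a) - 1"
          using that r by simp
        ultimately have "((\<lambda>s. (1 - s) * ln ((1 - s) / a)) has_real_derivative - ln ((1 - s) / a) - 1) (at s)"
          by simp
        moreover have "((\<lambda>s. (1 + 4 * pi) * s) has_real_derivative 1 + 4 * pi) (at s)"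
          "((\<lambda>s. 1 - s) has_real_derivative - 1) (at s)" by (auto intro!: derivative_eq_intros)
        ultimately have "((\<lambda>s. (1 + 4 * pi) * s + ((1 - s) * ln ((1 - s) / a) - (1 - s))) has_real_derivative
            (1 + 4 * pi + (- ln ((1 - s) / a) - 1 - - 1))) (at s)"
          by (intro DERIV_add DERIV_diff)
        then have "((\<lambda>s. (1 + 4 * pi) * s + ((1 - s) * ln ((1 - s) / a) - (1 - s))) has_real_derivative
            (1 + 4 * pi - ln ((1 - s) / a))) (at s)" by simp
        then show ?thesis unfolding \<phi>_def[abs_def] by (rule DERIV_cdivide)
      qed
      show "continuous_on {r..R} A" using dA
        by (intro continuous_at_imp_continuous_on ballI) (auto intro!: has_vector_derivative_continuous)
      show "continuous_on {r..R} \<phi>" using d\<phi>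
        by (intro continuous_at_imp_continuous_on ballI) (auto intro!: DERIV_isCont)
      show "(A has_vector_derivative
          (b (of_real s * cis (2 * pi * (p + h))) - b (of_real s * cis (2 * pi * p))) / (2 * pi * \<i> * s)) (at s)"
        if "r < s" "s < R" for s using that by (intro dA) auto
      show "(\<phi> has_vector_derivative (1 + 4 * pi - ln ((1 - s) / a)) / pi) (at s)" if "r < s" "s < R" for s
        using d\<phi>[of s] that by (simp add: has_real_derivative_iff_has_vector_derivative)
      show "norm ((b (of_real s * cis (2 * pi * (p + h))) - b (of_real s * cis (2 * pi * p))) / (2 * pi * \<i> * s))
          \<le> (1 + 4 * pi - ln ((1 - s) / a)) / pi" if s: "r < s" "s < R" for s
      proof -
        have rad: "cmod (b (of_real s * cis (2 * pi * y)) - b (of_real r * cis (2 * pi * y))) \<le> (1 - ln ((1 - s) / a)) / 2" for y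
        proof -
          have "cmod (b (of_real s * cis (2 * pi * y)) - b (of_real r * cis (2 * pi * y))) \<le>
            (ln ((1 + s) / (1 - s)) - ln ((1 + r) / (1 - r))) / 2"
            by (rule bloch_radial_growth[OF b]) (use s r in auto)
          also have "ln ((1 + s) / (1 - s)) - ln ((1 + r) / (1 - r)) = ln ((1 + s) / (1 + r)) - ln ((1 - s) / a)"
            using s r by (simp add: ln_div a_def)
          also have "ln ((1 + s) / (1 + r)) \<le> (1 + s) / (1 + r) - 1"
            using s r by (intro ln_le_minus_one) auto
          also have "(1 + s) / (1 + r) - 1 \<le> 1" using s r by (simp add: field_simps)
          finally show ?thesis by (simp add: divide_right_mono)
        qed
        have "cmod (b (of_real s * cis (2 * pi * (p + h))) - b (of_real s * cis (2 * pi * p))) \<le>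
           cmod (b (of_real s * cis (2 * pi * (p + h))) - b (of_real r * cis (2 * pi * (p + h)))) +
           cmod (b (of_real r * cis (2 * pi * (p + h))) - b (of_real r * cis (2 * pi * p))) +
           cmod (b (of_real s * cis (2 * pi * p)) - b (of_real r * cis (2 * pi * p)))"
          by norm
        also have "\<dots> \<le> (1 - ln ((1 - s) / a)) / 2 + 4 * pi + (1 - ln ((1 - s) / a)) / 2"
          by (intro add_mono rad arc) (use h0 in auto)
        finally have num: "cmod (b (of_real s * cis (2 * pi * (p + h))) - b (of_real s * cis (2 * pi * p))) \<le> 1 + 4 * pi - ln ((1 - s) / a)"
          by simp
        have "norm ((b (of_real s * cis (2 * pi * (p + h))) - b (of_real s * cis (2 * pi * p))) / (2 * pi * \<i> * s)) =
            cmod (b (of_real s * cis (2 * pi * (p + h))) - b (of_real s * cis (2 * pi * p))) / (2 * pi * s)"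
          using s r by (simp add: norm_divide norm_mult)
        also have "\<dots> \<le> (1 + 4 * pi - ln ((1 - s) / a)) / pi"
          using s r num order_trans[OF norm_ge_zero num] by (intro frac_le) auto
        finally show ?thesis .
      qed
    qed
    also have "\<phi> R - \<phi> r = ((1 + 4 * pi) * (R - r) + (1 - R) * ln ((1 - R) / a) + (R - r)) / pi"
      using a by (simp add: \<phi>_def a_def diff_divide_distrib[symmetric]) (simp add: algebra_simps)
    also have "\<dots> \<le> ((1 + 4 * pi) * h + 0 + h) / pi"
    proof (intro divide_right_mono add_mono mult_left_mono)
      have "ln ((1 - R) / a) \<le> 0" using r a by (simp add: a_def field_simps)
      then show "(1 - R) * ln ((1 - R) / a) \<le> 0" using r by (intro mult_nonneg_nonpos) auto
    qed (use r a in \<open>auto simp: a_def\<close>)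
    also have "\<dots> \<le> 5 * h"
    proof -
      have "2 * h + 4 * pi * h \<le> 5 * h * pi"
        using pi_gt3 h0 mult_right_mono[of 2 pi h] by (simp add: algebra_simps)
      then show ?thesis by (simp add: field_simps)
    qed
    finally show ?thesis by simp
  qed (use h0 in simp)
  have "cmod (A r - h * b (of_real r * cis (2 * pi * x))) \<le> 13 * h"
  proof -
    have int: "(\<lambda>y. b (of_real r * cis (2 * pi * y))) integrable_on {p..p + h}"
      using r by (intro integrable_on_circle bloch_unit_ball_continuous b) auto
    have "A r - h * b (of_real r * cis (2 * pi * x)) =
        integral {p..p + h} (\<lambda>y. b (of_real r * cis (2 * pi * y)) - b (of_real r * cis (2 * pi * x)))"
      unfolding A_def using h0 by (subst integral_diff[OF int]) (auto simp: scaleR_conv_of_real)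
    also have "cmod \<dots> \<le> integral {p..p + h} (\<lambda>y. 4 * pi)"
      using x by (intro integral_norm_bound_integral integrable_diff int arc) auto
    also have "\<dots> = 4 * pi * h" using h0 by simp
    also have "\<dots> \<le> 13 * h" using pi_approx h0 by (intro mult_right_mono) auto
    finally show ?thesis .
  qed
  with AR show ?thesis
    unfolding A_def[symmetric] using norm_triangle_ineq[of "A R - A r" "A r - h * b (of_real r * cis (2 * pi * x))"] by simp
qed

lemma dyadic_scale:
  fixes x :: real
  assumes "0 < x" "x \<le> 1"
  obtains m :: nat where "1 / 2 ^ Suc m < x" "x \<le> 1 / 2 ^ m"
proof -
  have ex: "\<exists>m::nat. 1 / 2 ^ Suc m < x"
  proof -
    obtain m :: nat where "(1 / 2) ^ m < x" using real_arch_pow_inv[of x "1 / 2"] assms by auto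
    moreover have "(1 / 2 :: real) ^ Suc m \<le> (1 / 2) ^ m" by simp
    ultimately show ?thesis by (intro exI[of _ m]) (simp add: power_one_over)
  qed
  define m where "m = (LEAST m. 1 / 2 ^ Suc m < x)"
  have "1 / 2 ^ Suc m < x" unfolding m_def by (rule LeastI_ex[OF ex])
  moreover have "x \<le> 1 / 2 ^ m"
  proof (cases m)
    case (Suc k)
    then have "\<not> 1 / 2 ^ Suc k < x" unfolding m_def by (intro not_less_Least) auto
    then show ?thesis using Suc by simp
  qed (use assms in simp)
  ultimately show ?thesis by (rule that)
qed

text \<open>Jensen's inequality, by integrating the tangent bound e^f \<ge> e^c (1 + f - c).\<close>

lemma exp_integral_ge:
  assumes f: "continuous_on {p..p + h} f" and h: "0 < h" and c: "h * c \<le> integral {p..p + h} f"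
  shows "exp c * h \<le> integral {p..p + h} (\<lambda>x. exp (f x :: real))"
proof -
  have "exp c * h \<le> exp c * (h + (integral {p..p + h} f - h * c))" using c by (intro mult_left_mono) auto
  also have "\<dots> = integral {p..p + h} (\<lambda>x. exp c * (1 + (f x - c)))"
  proof -
    have 1: "((\<lambda>x. d) has_integral h * d) {p..p + h}" for d :: real
      using has_integral_const_real[of d p "p + h"] h by simp
    have "(f has_integral integral {p..p + h} f) {p..p + h}"
      by (intro integrable_integral integrable_continuous_real f)
    note * = has_integral_mult_right[OF has_integral_add[OF 1[of 1] has_integral_diff[OF this 1[of c]]], of "exp c"]
    from integral_unique[OF *] show ?thesis by (simp only: mult_1_right)
  qed
  also have "\<dots> \<le> integral {p..p + h} (\<lambda>x. exp (f x))"
  proof (intro integral_le)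
    fix x
    have "exp c * (1 + (f x - c)) \<le> exp c * exp (f x - c)" by (intro mult_left_mono) auto
    then show "exp c * (1 + (f x - c)) \<le> exp (f x)" by (simp add: exp_add[symmetric])
  qed (auto intro!: integrable_continuous_real continuous_intros f)
  finally show ?thesis .
qed

text \<open>If Re (\<tau> b) exceeds \<open>y\<close> at radius \<open>r\<close> and angle
  \<open>x\<close>, then by \<open>bloch_arc_mean\<close> its mean on radius \<open>R\<close>, over
  the dyadic interval around \<open>x\<close> of length about 1 - r, is at least y - 18 |\<tau>|; by
  Jensen the exponential has mean at least \<open>a\<close> there, so \<open>x\<close> is caught by
  \<open>dyadic_stop\<close>. One set thus serves all radii up to \<open>R\<close>.\<close>

lemma bloch_maximal_inequality:
  assumes b: "b \<in> bloch_unit_ball" "b 0 = 0" and R: "1 / 2 \<le> R" "R < 1"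
  obtains E where "E \<in> sets borel" "E \<subseteq> {0..<1}"
    "measure lborel E \<le> exp (18 * cmod \<tau> - y) * circle_mean R (\<lambda>z. cmod (exp (\<tau> * b z)))"
    "\<And>x r. \<lbrakk>0 \<le> x; x < 1; 0 \<le> r; r \<le> R; y < Re (\<tau> * b (of_real r * cis (2 * pi * x)))\<rbrakk> \<Longrightarrow> x \<in> E"
proof -
  define u where "u x = cmod (exp (\<tau> * b (of_real R * cis (2 * pi * x))))" for x
  define f where "f x = Re (\<tau> * b (of_real R * cis (2 * pi * x)))" for x
  have uf: "u x = exp (f x)" for x unfolding u_def f_def by (rule norm_exp_eq_Re)
  have bc: "continuous_on A (\<lambda>x. b (of_real R * cis (2 * pi * x)))" for A
    using R by (intro continuous_on_circle bloch_unit_ball_continuous b) auto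
  have fc: "continuous_on A f" for A unfolding f_def by (intro continuous_intros bc)
  have uc: "continuous_on A u" for A unfolding u_def by (intro continuous_intros bc)
  define a where "a = exp (y - 18 * cmod \<tau>)"
  \<comment> \<open>The depth at which dyadic intervals have length about 1 - R; no radius up to
    \<open>R\<close> asks for shorter ones.\<close>
  obtain N where N: "1 / 2 ^ Suc N < 1 - R" "1 - R \<le> 1 / 2 ^ N" using dyadic_scale[of "1 - R"] R by auto
  define E where "E = dyadic_stop u a N 0 1"
  have E: "E \<in> sets borel" "E \<subseteq> {0..<1}" "a * measure lborel E \<le> integral {0..1} u"
    using dyadic_stop_measure[of u a 1 N 0] uc[of UNIV] by (auto simp: E_def a_def u_def)
  show ?thesis
  proof (rule that[of E])
    have "measure lborel E \<le> integral {0..1} u / a"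
      using E(3) by (simp add: field_simps a_def)
    also have "\<dots> = exp (18 * cmod \<tau> - y) * circle_mean R (\<lambda>z. cmod (exp (\<tau> * b z)))"
      by (simp add: a_def u_def[abs_def] circle_mean_def exp_diff)
    finally show "measure lborel E \<le> exp (18 * cmod \<tau> - y) * circle_mean R (\<lambda>z. cmod (exp (\<tau> * b z)))" .
  next
    fix x r assume x: "0 \<le> x" "x < 1" and r: "0 \<le> r" "r \<le> R"
      and y: "y < Re (\<tau> * b (of_real r * cis (2 * pi * x)))"
    let ?w = "b (of_real r * cis (2 * pi * x))"
    obtain m where m: "1 / 2 ^ Suc m < 1 - r" "1 - r \<le> 1 / 2 ^ m" using dyadic_scale[of "1 - r"] r R by auto
    define h where "h = (1 / 2 ^ m :: real)"
    have h: "0 < h" "1 - r \<le> h" "h \<le> 2 * (1 - r)" using m by (auto simp: h_def field_simps)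
    have mN: "m \<le> N"
    proof (rule ccontr)
      assume "\<not> m \<le> N"
      then have "(2::real) ^ Suc N \<le> 2 ^ m" by (intro power_increasing) auto
      then have "1 / 2 ^ m \<le> 1 / (2::real) ^ Suc N" by (intro divide_left_mono) auto
      with m(2) N(1) r show False by linarith
    qed
    define k where "k = nat \<lfloor>x * 2 ^ m\<rfloor>"
    have k: "real k \<le> x * 2 ^ m" "x * 2 ^ m < real k + 1"
      using x by (auto simp: k_def of_nat_nat floor_le_iff)
    define p where "p = k * h"
    have xin: "x \<in> {p..<p + h}" using k by (auto simp: p_def h_def field_simps)
    have k2: "k < 2 ^ m"
    proof -
      have "x * 2 ^ m < 1 * 2 ^ m" using x by (intro mult_strict_right_mono) auto
      with k(1) have "real k < 1 * 2 ^ m" by (rule order.strict_trans1)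
      then show ?thesis by (metis mult_1 of_nat_less_iff of_nat_numeral of_nat_power)
    qed
    have avg: "cmod (integral {p..p + h} (\<lambda>y. b (of_real R * cis (2 * pi * y))) - h * ?w) \<le> 18 * h"
    proof (cases "1 / 2 \<le> r")
      case True
      then show ?thesis by (intro bloch_arc_mean b(1) h) (use r R xin in auto)
    next
      \<comment> \<open>Below radius 1 / 2 the dyadic interval is the whole circle, on which
        \<open>b\<close> has mean b 0 = 0, and the value of \<open>b\<close> is at most 1 in
        modulus.\<close>
      case False
      have "m = 0"
      proof (rule ccontr)
        assume "m \<noteq> 0"
        then have "(2::real) ^ 1 \<le> 2 ^ m" by (intro power_increasing) auto
        then have "h \<le> 1 / 2" by (simp add: h_def field_simps)
        with h False show False by simp
      qed
      then have "h = 1" "p = 0" using k2 by (auto simp: h_def p_def)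
      moreover have "integral {0..1} (\<lambda>y. b (of_real R * cis (2 * pi * y))) = 0"
        using circle_mean_holomorphic[OF bloch_unit_ball_holomorphic[OF b(1)], of R] R b(2)
        by (simp add: circle_mean_def)
      moreover have "cmod ?w \<le> 18"
      proof -
        have "cmod (?w - b 0) \<le> ln ((1 + r) / (1 - r)) / 2"
          using bloch_growth_0[OF b(1), of "of_real r * cis (2 * pi * x)"] r R by (simp add: norm_mult)
        also have "ln ((1 + r) / (1 - r)) \<le> (1 + r) / (1 - r) - 1" using r R by (intro ln_le_minus_one) auto
        also have "(1 + r) / (1 - r) - 1 \<le> 3 - 1" using False r by (intro diff_right_mono) (simp add: field_simps)
        finally show ?thesis using b(2) by simp
      qed
      ultimately show ?thesis by simp
    qed
    have "h * (y - 18 * cmod \<tau>) \<le> integral {p..p + h} f"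
    proof -
      have "integral {p..p + h} f = Re (\<tau> * integral {p..p + h} (\<lambda>y. b (of_real R * cis (2 * pi * y))))"
      proof -
        have "((\<lambda>y. b (of_real R * cis (2 * pi * y))) has_integral integral {p..p + h} (\<lambda>y. b (of_real R * cis (2 * pi * y)))) {p..p + h}"
          by (intro integrable_integral integrable_continuous_real bc)
        from has_integral_linear[OF has_integral_mult_right[OF this, of \<tau>] bounded_linear_Re]
        show ?thesis unfolding f_def[abs_def] by (simp add: o_def integral_unique)
      qed
      moreover have "Re (\<tau> * (h * ?w)) - Re (\<tau> * integral {p..p + h} (\<lambda>y. b (of_real R * cis (2 * pi * y)))) \<le>
          cmod \<tau> * (18 * h)"
      proof -
        have "Re (\<tau> * (h * ?w) - \<tau> * integral {p..p + h} (\<lambda>y. b (of_real R * cis (2 * pi * y)))) \<le>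
          cmod (\<tau> * (h * ?w) - \<tau> * integral {p..p + h} (\<lambda>y. b (of_real R * cis (2 * pi * y))))"
          by (rule complex_Re_le_cmod)
        also have "\<dots> = cmod \<tau> * cmod (integral {p..p + h} (\<lambda>y. b (of_real R * cis (2 * pi * y))) - h * ?w)"
          by (simp only: right_diff_distrib[symmetric] norm_mult norm_minus_commute)
        also have "\<dots> \<le> cmod \<tau> * (18 * h)" by (intro mult_left_mono avg) auto
        finally show ?thesis by simp
      qed
      moreover have "Re (\<tau> * (h * ?w)) = h * Re (\<tau> * ?w)" by (simp add: algebra_simps)
      moreover have "h * y \<le> h * Re (\<tau> * ?w)" using y h by (intro mult_left_mono) auto
      ultimately show ?thesis by (simp add: algebra_simps)
    qed
    from exp_integral_ge[OF fc h(1) this]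
    have "a * h \<le> integral {p..p + h} u" by (simp add: a_def uf[abs_def])
    then show "x \<in> E"
      unfolding E_def
      by (intro dyadic_stop_member[OF k2 mN])
         (use xin in \<open>auto simp: p_def h_def add_divide_distrib add.commute\<close>)
  qed (use E in auto)
qed

section \<open>Upper half of the law of the iterated logarithm\<close>

lemma finite_direction_net:
  fixes c :: real assumes c: "c < 1"
  obtains A where "finite A" "A \<subseteq> sphere 0 1" "\<And>w. \<exists>\<alpha>\<in>A. c * cmod w \<le> Re (\<alpha> * w)"
proof -
  have "sphere 0 1 \<subseteq> (\<Union>\<alpha>\<in>sphere 0 1. {w. c < Re (\<alpha> * w)})"
  proof
    fix w :: complex assume w: "w \<in> sphere 0 1"
    then have "Re (cnj w * w) = 1" using complex_norm_square[of w] by (simp add: mult.commute cmod_power2 power2_eq_square[symmetric])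
    then show "w \<in> (\<Union>\<alpha>\<in>sphere 0 1. {w. c < Re (\<alpha> * w)})"
      using w c by (intro UN_I[of "cnj w"]) auto
  qed
  moreover have "open {w. c < Re (\<alpha> * w)}" for \<alpha> :: complex
    by (intro open_Collect_less continuous_intros)
  ultimately obtain A where A: "A \<subseteq> sphere 0 1" "finite A" "sphere 0 1 \<subseteq> (\<Union>\<alpha>\<in>A. {w. c < Re (\<alpha> * w)})"
    using compactE_image[of "sphere (0::complex) 1" "sphere 0 1" "\<lambda>\<alpha>. {w. c < Re (\<alpha> * w)}"] compact_sphere by metis
  show ?thesis
  proof (rule that[OF A(2,1)])
    fix w :: complex
    show "\<exists>\<alpha>\<in>A. c * cmod w \<le> Re (\<alpha> * w)"
    proof (cases "w = 0")
      case True
      have "(1::complex) \<in> sphere 0 1" by simp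
      then have "A \<noteq> {}" using A(3) by fastforce
      then show ?thesis using True by auto
    next
      case False
      then have "w / cmod w \<in> sphere 0 1" by (simp add: norm_divide)
      then obtain \<alpha> where \<alpha>: "\<alpha> \<in> A" "c < Re (\<alpha> * (w / cmod w))" using A(3) by blast
      have "\<alpha> * (w / of_real (cmod w)) = (\<alpha> * w) / of_real (cmod w)" by simp
      then have "Re (\<alpha> * (w / cmod w)) = Re (\<alpha> * w) / cmod w" by (simp only: Re_divide_of_real)
      with \<alpha>(2) False have "c * cmod w \<le> Re (\<alpha> * w)" by (simp add: field_simps)
      with \<alpha>(1) show ?thesis by blast
    qed
  qed
qed

text \<open>Chernoff bounds at the geometric times \<open>t k\<close>, with the maximal inequality
  covering all earlier radii, and |b| replaced by Re (\<alpha> b) for finitely many directions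
  \<alpha>. Of the three factors 1 + \<eta>, one pays for the net of directions, one makes the
  exponent q^2 of the tail exceed 1, and one pays for the passage from \<open>t k\<close> to
  intermediate times.\<close>

lemma bloch_LIL_upper_aux:
  assumes b: "b \<in> bloch_unit_ball" "b 0 = 0" and \<eta>: "0 < \<eta>"
  shows "AE x in lborel. x \<in> {0..<1} \<longrightarrow> (\<forall>\<^sub>F t in at_top.
    cmod (b (of_real (hyp_radius t) * cis (2 * pi * x))) \<le> (1 + \<eta>) ^ 3 * sqrt (bloch_variance + \<eta>) * sqrt (t * ln (ln t)))"
proof -
  define S where "S = bloch_variance + \<eta>"
  define q where "q = 1 + \<eta>"
  have q: "1 < q" using \<eta> by (simp add: q_def)
  have S: "0 < S" using \<eta> bloch_variance_nonneg by (simp add: S_def)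
  obtain \<tau>0 C where mom: "0 < \<tau>0" "0 < C"
    "\<And>\<tau> b t. \<lbrakk>cmod \<tau> \<le> \<tau>0; b \<in> bloch_unit_ball; b 0 = 0; 0 < t\<rbrakk> \<Longrightarrow>
      circle_mean (hyp_radius t) (\<lambda>z. cmod (exp (\<tau> * b z))) \<le> C * exp ((cmod \<tau>)\<^sup>2 / 4 * S * t)"
    using exp_moment_bound[OF \<eta>] unfolding S_def by metis
  obtain A where A: "finite A" "A \<subseteq> sphere 0 1" "\<And>w. \<exists>\<alpha>\<in>A. (1 / q) * cmod w \<le> Re (\<alpha> * w)"
    using finite_direction_net[of "1 / q"] q by auto
  define t where "t k = q ^ k" for k :: nat
  define L where "L k = ln (ln (t k))" for k
  define y where "y k = q ^ 2 * sqrt (S * t k * L k)" for k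
  \<comment> \<open>The minimiser of s^2 S t / 4 - s y / q, the exponent in the Chernoff bound; the
    minimum is -q^2 L. It tends to 0, hence is eventually an admissible parameter for the moment
    bound.\<close>
  define s where "s k = 2 * y k / (q * S * t k)" for k
  have lnt: "ln (t k) = k * ln q" for k using q by (simp add: t_def ln_realpow)
  have tq: "t k > 0" for k using q by (simp add: t_def)
  have tlim: "filterlim t at_top sequentially"
    unfolding t_def using q by (intro filterlim_at_top_mono[OF filterlim_realpow_sequentially_gt1[of q, THEN filterlim_at_infinity_imp_norm_at_top]]) auto
  have Llim: "filterlim (\<lambda>t. ln (ln t)) at_top (at_top :: real filter)" by real_asymp
  have slim: "s \<longlonglongrightarrow> 0"
  proof -
    have "((\<lambda>u. 2 * q / sqrt S * sqrt (ln (ln u) / u)) \<longlongrightarrow> 2 * q / sqrt S * sqrt 0) (at_top :: real filter)"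
      by (intro tendsto_mult tendsto_const tendsto_real_sqrt) real_asymp
    from filterlim_compose[OF this tlim]
    have lim: "(\<lambda>k. 2 * q / sqrt S * sqrt (ln (ln (t k)) / t k)) \<longlonglongrightarrow> 0" by simp
    have "s k = 2 * q / sqrt S * sqrt (ln (ln (t k)) / t k)" for k
    proof -
      have "sqrt (S * t k * L k) = sqrt S * sqrt (t k) * sqrt (L k)" by (simp add: real_sqrt_mult)
      moreover have "S = sqrt S * sqrt S" "t k = sqrt (t k) * sqrt (t k)" using S tq[of k] by auto
      ultimately show ?thesis using S tq[of k] q unfolding s_def y_def L_def
        by (simp add: real_sqrt_divide field_simps power2_eq_square)
    qed
    then have "s = (\<lambda>k. 2 * q / sqrt S * sqrt (ln (ln (t k)) / t k))" by (rule ext)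
    with lim show ?thesis by (simp only:)
  qed
  have ev: "\<forall>\<^sub>F k in sequentially. 1 \<le> t k \<and> 1 / 2 \<le> hyp_radius (t k) \<and> 0 < L k \<and> 0 < s k \<and> s k \<le> \<tau>0 \<and> s k \<le> 1"
  proof -
    have 1: "\<forall>\<^sub>F k in sequentially. 1 \<le> t k" using tlim by (simp add: filterlim_at_top)
    have 2: "\<forall>\<^sub>F k in sequentially. 0 < L k"
      using filterlim_compose[OF Llim tlim] unfolding L_def filterlim_at_top_dense by blast
    have 3: "\<forall>\<^sub>F k in sequentially. s k < min \<tau>0 1" using slim mom(1) by (intro order_tendstoD(2)) auto
    show ?thesis using 1 2 3
    proof eventually_elim
      case (elim k)
      have "exp (- t k) \<le> exp (- 1)" using elim by simp
      also have "exp (- 1) = 1 / exp (1::real)" by (simp add: exp_minus field_simps)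
      also have "\<dots> \<le> 1 / 2" using exp_ge_add_one_self[of 1] by (simp add: field_simps)
      finally have "1 / 2 \<le> hyp_radius (t k)" by (simp add: hyp_radius_def)
      moreover have "0 < s k" using elim q S tq[of k] by (auto simp: s_def y_def intro!: divide_pos_pos mult_pos_pos)
      ultimately show ?case using elim by auto
    qed
  qed
  then obtain k0 where k0: "\<And>k. k \<ge> k0 \<Longrightarrow> 1 \<le> t k \<and> 1 / 2 \<le> hyp_radius (t k) \<and> 0 < L k \<and> 0 < s k \<and> s k \<le> \<tau>0 \<and> s k \<le> 1"
    by (auto simp: eventually_sequentially)
  define M where "M = exp 18 * C"
  have ex: "\<exists>E. E \<in> sets borel \<and> E \<subseteq> {0..<1} \<and> measure lborel E \<le> M * exp (- (q\<^sup>2 * L k)) \<and>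
      (\<forall>x r. 0 \<le> x \<longrightarrow> x < 1 \<longrightarrow> 0 \<le> r \<longrightarrow> r \<le> hyp_radius (t k) \<longrightarrow> s k * y k / q < Re ((s k * \<alpha>) * b (of_real r * cis (2 * pi * x))) \<longrightarrow> x \<in> E)"
    if k: "k \<ge> k0" and \<alpha>: "\<alpha> \<in> A" for k and \<alpha> :: complex
  proof -
    have n\<alpha>: "cmod (s k * \<alpha>) = s k" using \<alpha> A(2) k0[OF k] by (auto simp: norm_mult)
    obtain E where E: "E \<in> sets borel" "E \<subseteq> {0..<1}"
      "measure lborel E \<le> exp (18 * cmod (s k * \<alpha>) - s k * y k / q) * circle_mean (hyp_radius (t k)) (\<lambda>z. cmod (exp (s k * \<alpha> * b z)))"
      "\<And>x r. \<lbrakk>0 \<le> x; x < 1; 0 \<le> r; r \<le> hyp_radius (t k); s k * y k / q < Re (s k * \<alpha> * b (of_real r * cis (2 * pi * x)))\<rbrakk> \<Longrightarrow> x \<in> E"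
      using bloch_maximal_inequality[OF b, of "hyp_radius (t k)" "s k * \<alpha>" "s k * y k / q"] k0[OF k] hyp_radius(2) by metis
    have "circle_mean (hyp_radius (t k)) (\<lambda>z. cmod (exp (s k * \<alpha> * b z))) \<le> C * exp ((s k)\<^sup>2 / 4 * S * t k)"
      using mom(3)[of "s k * \<alpha>" b "t k"] b k0[OF k] tq[of k] n\<alpha> by simp
    then have "measure lborel E \<le> exp (18 * s k - s k * y k / q) * (C * exp ((s k)\<^sup>2 / 4 * S * t k))"
      using E(3) n\<alpha> by (smt (verit) exp_gt_zero mult_left_mono)
    also have "\<dots> = C * exp (18 * s k) * exp ((s k)\<^sup>2 / 4 * S * t k - s k * y k / q)"
      by (simp add: exp_diff exp_add[symmetric] field_simps)
    also have "(s k)\<^sup>2 / 4 * S * t k - s k * y k / q = - ((y k)\<^sup>2 / (q\<^sup>2 * S * t k))"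
      using q S tq[of k] by (simp add: s_def field_simps power2_eq_square)
    also have "(y k)\<^sup>2 / (q\<^sup>2 * S * t k) = q\<^sup>2 * L k"
    proof -
      have "(y k)\<^sup>2 = q ^ 4 * (S * t k * L k)"
        using S tq[of k] k0[OF k] by (simp add: y_def power_mult_distrib)
      then show ?thesis using q S tq[of k] by (simp add: field_simps power2_eq_square power4_eq_xxxx)
    qed
    also have "C * exp (18 * s k) * exp (- (q\<^sup>2 * L k)) \<le> C * exp 18 * exp (- (q\<^sup>2 * L k))"
      using mom(2) k0[OF k] by (intro mult_right_mono mult_left_mono) auto
    finally have "measure lborel E \<le> M * exp (- (q\<^sup>2 * L k))" by (simp add: M_def mult.commute)
    with E show ?thesis by (intro exI[of _ E]) (auto simp: mult_ac)
  qed
  then obtain E :: "nat \<Rightarrow> complex \<Rightarrow> real set" where E: "\<And>k (\<alpha>::complex). k \<ge> k0 \<Longrightarrow> \<alpha> \<in> A \<Longrightarrow> E k \<alpha> \<in> sets borel \<and> E k \<alpha> \<subseteq> {0..<1} \<and>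
      measure lborel (E k \<alpha>) \<le> M * exp (- (q\<^sup>2 * L k)) \<and>
      (\<forall>x r. 0 \<le> x \<longrightarrow> x < 1 \<longrightarrow> 0 \<le> r \<longrightarrow> r \<le> hyp_radius (t k) \<longrightarrow> s k * y k / q < Re ((s k * \<alpha>) * b (of_real r * cis (2 * pi * x))) \<longrightarrow> x \<in> E k \<alpha>)"
    by metis
  have Es: "E k \<alpha> \<subseteq> {0..<1}" and Em: "E k \<alpha> \<in> sets borel" if "k \<ge> k0" "\<alpha> \<in> A" for k \<alpha>
    using E[OF that] by blast+
  have Eb: "measure lborel (E k \<alpha>) \<le> M * exp (- (q\<^sup>2 * L k))" if "k \<ge> k0" "\<alpha> \<in> A" for k \<alpha>
    using E[OF that] by blast
  define B where "B k = (if k \<ge> k0 then (\<Union>\<alpha>\<in>A. E k \<alpha>) else {})" for k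
  have "AE x in lborel. eventually (\<lambda>k. x \<in> space lborel - B k) sequentially"
  proof (rule borel_cantelli_AE1)
    show Bm: "B k \<in> sets lborel" for k unfolding B_def using Em A(1) by (auto intro!: sets.finite_UN)
    have Bs: "B k \<subseteq> {0..<1}" for k unfolding B_def using Es by (simp add: UN_least)
    show "emeasure lborel (B k) < \<infinity>" for k
      using emeasure_mono[OF Bs[of k], of lborel] by (auto intro: le_less_trans)
    show "summable (\<lambda>k. measure lborel (B k))"
    proof (rule summable_comparison_test_ev)
      show "\<forall>\<^sub>F k in sequentially. norm (measure lborel (B k)) \<le> (card A * M * (ln q) powr (- q\<^sup>2)) * (k powr (- q\<^sup>2))"
        using eventually_ge_at_top[of "max k0 1"]
      proof eventually_elim
        case (elim k)
        have "measure lborel (B k) \<le> (\<Sum>\<alpha>\<in>A. measure lborel (E k \<alpha>))"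
        proof -
          have "E k \<alpha> \<in> fmeasurable lborel" if "\<alpha> \<in> A" for \<alpha>
          proof (rule fmeasurableI)
            show "E k \<alpha> \<in> sets lborel" using Em[of k \<alpha>] that elim by simp
            have "emeasure lborel (E k \<alpha>) \<le> emeasure lborel {0..<1::real}" using Es[of k \<alpha>] that elim by (intro emeasure_mono) auto
            then show "emeasure lborel (E k \<alpha>) < \<infinity>" by (auto intro: le_less_trans)
          qed
          then show ?thesis using elim A(1) by (auto simp: B_def intro!: measure_UNION_le fmeasurableD)
        qed
        also have "\<dots> \<le> (\<Sum>\<alpha>\<in>A. M * exp (- (q\<^sup>2 * L k)))"
          using Eb elim by (intro sum_mono) auto
        \<comment> \<open>As ln (t k) = k ln q, the bound is a constant multiple of k powr (-q^2),
          and q^2 > 1.\<close>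
        also have "exp (- (q\<^sup>2 * L k)) = (ln q) powr (- q\<^sup>2) * (k powr (- q\<^sup>2))"
        proof -
          have "0 < ln q * k" using q elim by simp
          then have "exp (- (q\<^sup>2 * L k)) = (ln q * k) powr (- q\<^sup>2)"
            using q elim by (simp add: L_def lnt powr_def mult.commute)
          also have "\<dots> = (ln q) powr (- q\<^sup>2) * (k powr (- q\<^sup>2))"
            by (rule powr_mult)
          finally show ?thesis .
        qed
        finally show ?case by (simp add: mult_ac)
      qed
      have "summable (\<lambda>k. real k powr (- q\<^sup>2))"
        using q by (subst summable_real_powr_iff) (auto simp: one_less_power)
      then show "summable (\<lambda>k. (card A * M * (ln q) powr (- q\<^sup>2)) * (k powr (- q\<^sup>2)))"
        by (rule summable_mult)
    qed
  qed
  then show ?thesis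
  proof eventually_elim
    case (elim x)
    show ?case
    proof
      assume x: "x \<in> {0..<1}"
      obtain k1 where k1: "\<And>k. k \<ge> k1 \<Longrightarrow> x \<notin> B k" using elim by (auto simp: eventually_sequentially)
      have bd: "cmod (b (of_real r * cis (2 * pi * x))) \<le> y k" if k: "k \<ge> max k0 k1" and r: "0 \<le> r" "r \<le> hyp_radius (t k)" for k r
      proof (rule ccontr)
        assume neg: "\<not> ?thesis"
        obtain \<alpha> where \<alpha>: "\<alpha> \<in> A" "(1 / q) * cmod (b (of_real r * cis (2 * pi * x))) \<le> Re (\<alpha> * b (of_real r * cis (2 * pi * x)))"
          using A(3) by blast
        have sk: "0 < s k" using k0[of k] k by auto
        have "s k * y k / q = s k * (1 / q * y k)" by simp
        also have "\<dots> < s k * (1 / q * cmod (b (of_real r * cis (2 * pi * x))))"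
          using neg sk q by (intro mult_strict_left_mono) auto
        also have "\<dots> \<le> s k * Re (\<alpha> * b (of_real r * cis (2 * pi * x)))"
          using \<alpha>(2) sk by (intro mult_left_mono) auto
        also have "\<dots> = Re ((s k * \<alpha>) * b (of_real r * cis (2 * pi * x)))"
          by (simp add: algebra_simps)
        finally have "s k * y k / q < Re ((s k * \<alpha>) * b (of_real r * cis (2 * pi * x)))" .
        moreover have "k \<ge> k0" "0 \<le> x" "x < 1" using k x by auto
        ultimately have "x \<in> E k \<alpha>" using E[of k \<alpha>] \<alpha>(1) r by blast
        then have "x \<in> B k" using \<alpha>(1) k by (auto simp: B_def)
        with k1[of k] k show False by simp
      qed
      have "\<forall>\<^sub>F u in at_top. q * u > 0 \<and> u > q ^ (Suc (max k0 k1)) \<and> 0 < ln (ln u) \<and> 0 < ln (ln (q * u)) \<and> ln (ln (q * u)) \<le> q * ln (ln u)"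
      proof -
        have "((\<lambda>u. ln (ln (q * u)) / ln (ln u)) \<longlongrightarrow> 1) (at_top :: real filter)" using q by real_asymp
        then have 1: "\<forall>\<^sub>F u in at_top. ln (ln (q * u)) / ln (ln u) < q" using q by (intro order_tendstoD(2)) auto
        have 2: "\<forall>\<^sub>F u in at_top. 0 < ln (ln (u::real))" by real_asymp
        have 3: "\<forall>\<^sub>F u in at_top. 0 < ln (ln (q * u))" using q by real_asymp
        show ?thesis using 1 2 3 eventually_gt_at_top[of "q ^ (Suc (max k0 k1))"] eventually_gt_at_top[of 0]
        proof eventually_elim
          case (elim u)
          then have "ln (ln (q * u)) < q * ln (ln u)" by (simp add: divide_less_eq)
          with elim q show ?case by auto
        qed
      qed
      then show "\<forall>\<^sub>F u in at_top. cmod (b (of_real (hyp_radius u) * cis (2 * pi * x))) \<le>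
          (1 + \<eta>) ^ 3 * sqrt (bloch_variance + \<eta>) * sqrt (u * ln (ln u))"
      proof eventually_elim
        case (elim u)
        have u0: "0 < u" using elim q by (simp add: zero_less_mult_iff)
        \<comment> \<open>The first of the times that is not before \<open>u\<close>; by minimality
          it is at most q u.\<close>
        define k where "k = (LEAST k. u \<le> t k)"
        have exk: "\<exists>k. u \<le> t k" using tlim unfolding filterlim_at_top by (meson eventually_happens' sequentially_bot)
        have k: "u \<le> t k" unfolding k_def by (rule LeastI_ex[OF exk])
        have kbig: "max k0 k1 < k"
        proof (rule ccontr)
          assume "\<not> max k0 k1 < k"
          then have "t k \<le> q ^ Suc (max k0 k1)" unfolding t_def using q by (intro power_increasing) auto
          with k elim show False by simp
        qed
        then obtain j where j: "k = Suc j" by (cases k) auto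
        have "\<not> u \<le> t j" unfolding k_def[symmetric] using j k_def not_less_Least[of j "\<lambda>k. u \<le> t k"] by auto
        then have tk: "t k \<le> q * u" using j q by (simp add: t_def)
        have lnk: "0 < ln (t k)" "0 < L k"
          using k0[of k] kbig q unfolding lnt by auto
        have Lk: "L k \<le> q * ln (ln u)"
        proof -
          have "ln (t k) \<le> ln (q * u)" using tk tq[of k] by simp
          then have "ln (ln (t k)) \<le> ln (ln (q * u))" using lnk by simp
          with elim show ?thesis by (simp add: L_def)
        qed
        have "hyp_radius u \<le> hyp_radius (t k)" using k by (simp add: hyp_radius_def)
        then have "cmod (b (of_real (hyp_radius u) * cis (2 * pi * x))) \<le> y k"
          using kbig u0 by (intro bd) (auto intro: hyp_radius)
        also have "y k \<le> q\<^sup>2 * sqrt (q\<^sup>2 * (S * (u * ln (ln u))))"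
          unfolding y_def
        proof (intro mult_left_mono real_sqrt_le_mono)
          have "t k * L k \<le> (q * u) * (q * ln (ln u))"
            using tk Lk lnk tq[of k] u0 q by (intro mult_mono) auto
          then have "S * (t k * L k) \<le> S * ((q * u) * (q * ln (ln u)))" using S by (intro mult_left_mono) auto
          then show "S * t k * L k \<le> q\<^sup>2 * (S * (u * ln (ln u)))" by (simp add: power2_eq_square mult_ac)
        qed simp
        also have "\<dots> = q ^ 3 * sqrt S * sqrt (u * ln (ln u))"
          using q by (simp add: real_sqrt_mult power3_eq_cube power2_eq_square)
        finally show ?case by (simp add: q_def S_def)
      qed
    qed
  qed
qed

lemma bloch_LIL_upper:
  assumes b: "b \<in> bloch_unit_ball" "b 0 = 0" and c: "sqrt bloch_variance < c"
  shows "AE x in lborel. x \<in> {0..<1} \<longrightarrow> (\<forall>\<^sub>F t in at_top.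
    cmod (b (of_real (hyp_radius t) * cis (2 * pi * x))) \<le> c * sqrt (t * ln (ln t)))"
proof -
  have "((\<lambda>\<eta>. (1 + \<eta>) ^ 3 * sqrt (bloch_variance + \<eta>)) \<longlongrightarrow> (1 + 0) ^ 3 * sqrt (bloch_variance + 0)) (at_right 0)"
    by (intro tendsto_intros)
  then have "\<forall>\<^sub>F \<eta> in at_right 0. (1 + \<eta>) ^ 3 * sqrt (bloch_variance + \<eta>) < c"
    using c by (intro order_tendstoD(2)) auto
  then obtain \<eta>1 where \<eta>1: "0 < \<eta>1" "\<And>x. 0 < x \<Longrightarrow> x < \<eta>1 \<Longrightarrow> (1 + x) ^ 3 * sqrt (bloch_variance + x) < c"
    unfolding eventually_at_right_field by auto
  define \<eta> where "\<eta> = \<eta>1 / 2"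
  have \<eta>: "0 < \<eta>" "(1 + \<eta>) ^ 3 * sqrt (bloch_variance + \<eta>) < c" using \<eta>1 by (auto simp: \<eta>_def)
  have pos: "\<forall>\<^sub>F t in at_top. 0 < t * ln (ln (t::real))" by real_asymp
  show ?thesis
    using bloch_LIL_upper_aux[OF b \<eta>(1)]
  proof eventually_elim
    case (elim x)
    show ?case
    proof
      assume "x \<in> {0..<1}"
      with elim have "\<forall>\<^sub>F t in at_top. cmod (b (of_real (hyp_radius t) * cis (2 * pi * x))) \<le>
        (1 + \<eta>) ^ 3 * sqrt (bloch_variance + \<eta>) * sqrt (t * ln (ln t))" by blast
      then show "\<forall>\<^sub>F t in at_top. cmod (b (of_real (hyp_radius t) * cis (2 * pi * x))) \<le> c * sqrt (t * ln (ln t))"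
        using pos
      proof eventually_elim
        case (elim t)
        have "(1 + \<eta>) ^ 3 * sqrt (bloch_variance + \<eta>) * sqrt (t * ln (ln t)) \<le> c * sqrt (t * ln (ln t))"
          using \<eta>(2) elim by (intro mult_right_mono) auto
        with elim show ?case by linarith
      qed
    qed
  qed
qed

subsection \<open>Lacunary Bloch functions\<close>

text \<open>Schwarz-Pick for the map z^d. The terms \<open>j\<close> and \<open>d - 1 - j\<close> of
  the geometric sum are paired and estimated by AM-GM.\<close>

lemma power_schwarz_pick:
  fixes s :: real assumes s: "0 \<le> s" "s < 1"
  shows "(1 - s\<^sup>2) * (d * s ^ (d - 1)) \<le> 1 - s ^ (2 * d)"
proof -
  have "2 * (d * s ^ (d - 1)) = (\<Sum>j<d. 2 * s ^ (d - 1))" by simp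
  also have "\<dots> \<le> (\<Sum>j<d. s ^ (2 * j) + s ^ (2 * (d - Suc j)))"
  proof (intro sum_mono)
    fix j assume "j \<in> {..<d}"
    then have "d - 1 = j + (d - Suc j)" by auto
    then have "2 * s ^ (d - 1) = 2 * s ^ j * s ^ (d - Suc j)" by (simp add: power_add)
    also have "\<dots> \<le> (s ^ j)\<^sup>2 + (s ^ (d - Suc j))\<^sup>2" by (rule sum_squares_bound)
    finally show "2 * s ^ (d - 1) \<le> s ^ (2 * j) + s ^ (2 * (d - Suc j))"
      by (simp add: power_mult[symmetric] mult.commute)
  qed
  also have "\<dots> = 2 * (\<Sum>j<d. s ^ (2 * j))"
    by (simp add: sum.distrib sum.nat_diff_reindex[of "\<lambda>j. s ^ (2 * j)"])
  finally have "d * s ^ (d - 1) \<le> (\<Sum>j<d. (s\<^sup>2) ^ j)" by (simp add: power_mult)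
  moreover have "0 \<le> 1 - s\<^sup>2" using s by (simp add: power_le_one)
  ultimately have "(1 - s\<^sup>2) * (d * s ^ (d - 1)) \<le> (1 - s\<^sup>2) * (\<Sum>j<d. (s\<^sup>2) ^ j)"
    by (intro mult_left_mono)
  also have "\<dots> = 1 - s ^ (2 * d)" by (simp add: one_diff_power_eq[symmetric] power_mult)
  finally show ?thesis .
qed

text \<open>At a distance of many multiples of 1 / d from the circle the derivative of z^d is small,
  here at a quadratic rate. With u = sqrt s the power splits into two equal factors, each absorbing
  one factor d (1 - s^2) at the cost of 4.\<close>

lemma power_decay:
  fixes s :: real assumes s: "0 \<le> s" "s < 1" and d: "1 \<le> d"
  shows "(d * (1 - s\<^sup>2))\<^sup>2 * s ^ (d - 1) \<le> 16"
proof -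
  define u where "u = sqrt s"
  have u: "0 \<le> u" "u < 1" "s = u\<^sup>2" using s by (auto simp: u_def)
  have "d * u ^ (d - 1) \<le> (\<Sum>j<d. u ^ j)"
  proof -
    have "(\<Sum>j<d. u ^ (d - 1)) \<le> (\<Sum>j<d. u ^ j)"
      using u by (intro sum_mono power_decreasing) auto
    then show ?thesis by simp
  qed
  then have "(1 - u) * (d * u ^ (d - 1)) \<le> (1 - u) * (\<Sum>j<d. u ^ j)" using u by (intro mult_left_mono) auto
  also have "\<dots> = 1 - u ^ d" by (simp add: one_diff_power_eq)
  also have "\<dots> \<le> 1" using u by simp
  finally have 1: "(1 - u) * (d * u ^ (d - 1)) \<le> 1" .
  have "1 - s\<^sup>2 = (1 - u) * ((1 + u) * (1 + u\<^sup>2))" by (simp add: u(3) algebra_simps power2_eq_square)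
  also have "\<dots> \<le> (1 - u) * (2 * 2)"
    using u by (intro mult_left_mono mult_mono) (auto simp: power_le_one add_nonneg_nonneg intro: add_mono[of 1 1, simplified])
  finally have 2: "1 - s\<^sup>2 \<le> 4 * (1 - u)" by simp
  have "d * (1 - s\<^sup>2) * u ^ (d - 1) \<le> d * (4 * (1 - u)) * u ^ (d - 1)"
    using 2 u by (intro mult_right_mono mult_left_mono) auto
  also have "\<dots> = 4 * ((1 - u) * (d * u ^ (d - 1)))" by simp
  also have "\<dots> \<le> 4" using 1 by simp
  finally have "d * (1 - s\<^sup>2) * u ^ (d - 1) \<le> 4" .
  moreover have "0 \<le> d * (1 - s\<^sup>2) * u ^ (d - 1)" using s u by (auto simp: power_le_one)
  ultimately have "(d * (1 - s\<^sup>2) * u ^ (d - 1))\<^sup>2 \<le> 4\<^sup>2" by (intro power_mono)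
  then show ?thesis by (simp add: power_mult_distrib u(3) power_mult[symmetric] mult.commute)
qed

text \<open>Bernoulli gives 1 + d x \<le> (1 + x)^d, and (1 - x) (1 + x) \<le> 1.\<close>

lemma power_le_inverse_linear:
  fixes x :: real assumes "0 \<le> x" "x \<le> 1"
  shows "(1 - x) ^ d * (1 + d * x) \<le> 1"
proof -
  have "1 + d * x \<le> (1 + x) ^ d" using Bernoulli_inequality[of x d] assms by simp
  then have "(1 - x) ^ d * (1 + d * x) \<le> (1 - x) ^ d * (1 + x) ^ d" using assms by (intro mult_left_mono) auto
  also have "\<dots> = (1 - x\<^sup>2) ^ d" by (simp add: power_mult_distrib[symmetric] algebra_simps power2_eq_square)
  also have "\<dots> \<le> 1" using assms by (intro power_le_one) (auto simp: power_le_one)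
  finally show ?thesis .
qed

text \<open>The dilated function is smooth up to the circle, with derivative at most 1 / (1 -
  \<rho>) = exp T, and inside it keeps the Bloch bound. Both kinds of estimate are needed, near the
  circle and away from it.\<close>

lemma bloch_dilate:
  assumes b: "b \<in> bloch_unit_ball" "b 0 = 0" and T: "0 \<le> T" and \<rho>: "\<rho> = hyp_radius T"
  shows "\<And>w. cmod w \<le> 1 \<Longrightarrow> ((\<lambda>w. b (of_real \<rho> * w)) has_field_derivative \<rho> * deriv b (of_real \<rho> * w)) (at w)"
    and "\<And>w. cmod w \<le> 1 \<Longrightarrow> cmod (\<rho> * deriv b (of_real \<rho> * w)) \<le> exp T"
    and "\<And>w. cmod w < 1 \<Longrightarrow> cmod (\<rho> * deriv b (of_real \<rho> * w)) \<le> 1 / (1 - (cmod w)\<^sup>2)"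
    and "\<And>w. cmod w < 1 \<Longrightarrow> cmod (b (of_real \<rho> * w)) \<le> cmod w / (1 - (cmod w)\<^sup>2)"
    and "\<And>w v. cmod w \<le> 1 \<Longrightarrow> cmod v \<le> 1 \<Longrightarrow> cmod (b (of_real \<rho> * w) - b (of_real \<rho> * v)) \<le> exp T * cmod (w - v)"
proof -
  have r: "0 \<le> \<rho>" "\<rho> < 1" using hyp_radius T by (auto simp: \<rho>)
  have in1: "cmod (of_real \<rho> * w) \<le> \<rho>" if "cmod w \<le> 1" for w
    using that r by (simp add: norm_mult mult_left_le)
  show d: "((\<lambda>w. b (of_real \<rho> * w)) has_field_derivative \<rho> * deriv b (of_real \<rho> * w)) (at w)" if "cmod w \<le> 1" for w
  proof -
    have "(b has_field_derivative deriv b (of_real \<rho> * w)) (at (of_real \<rho> * w))"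
      using in1[OF that] r by (intro bloch_unit_ballD(1)[OF b(1)]) auto
    moreover have "((\<lambda>w. of_real \<rho> * w) has_field_derivative of_real \<rho>) (at w)"
      by (auto intro!: derivative_eq_intros)
    ultimately have "((\<lambda>w. b (of_real \<rho> * w)) has_field_derivative deriv b (of_real \<rho> * w) * of_real \<rho>) (at w)"
      by (rule DERIV_chain2)
    then show ?thesis by (simp add: mult.commute)
  qed
  have key: "cmod (\<rho> * deriv b (of_real \<rho> * w)) \<le> 1 / (1 - c)" if "cmod w \<le> 1" "(\<rho> * cmod w)\<^sup>2 \<le> c" "c < 1" for w c
  proof -
    have "cmod (deriv b (of_real \<rho> * w)) \<le> 1 / (1 - (cmod (of_real \<rho> * w))\<^sup>2)"
      using in1[OF that(1)] r by (intro bloch_unit_ballD(3)[OF b(1)]) auto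
    also have "\<dots> \<le> 1 / (1 - c)" using that r by (intro divide_left_mono) (auto simp: norm_mult)
    finally have "\<rho> * cmod (deriv b (of_real \<rho> * w)) \<le> 1 * (1 / (1 - c))" using r by (intro mult_mono) auto
    then show ?thesis using r by (simp add: norm_mult)
  qed
  show dT: "cmod (\<rho> * deriv b (of_real \<rho> * w)) \<le> exp T" if "cmod w \<le> 1" for w
  proof -
    have "(\<rho> * cmod w)\<^sup>2 \<le> \<rho>\<^sup>2" using that r by (intro power_mono) (auto simp: mult_left_le)
    also have "\<dots> \<le> \<rho>" using r by (simp add: power2_eq_square mult_left_le)
    finally have "cmod (\<rho> * deriv b (of_real \<rho> * w)) \<le> 1 / (1 - \<rho>)" using r that by (intro key) auto
    also have "1 / (1 - \<rho>) = exp T" by (simp add: \<rho> hyp_radius_def exp_minus field_simps)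
    finally show ?thesis .
  qed
  show d1: "cmod (\<rho> * deriv b (of_real \<rho> * w)) \<le> 1 / (1 - (cmod w)\<^sup>2)" if "cmod w < 1" for w
    using that r by (intro key) (auto simp: abs_square_less_1 power_mult_distrib mult_left_le_one_le power_le_one)
  show "cmod (b (of_real \<rho> * w)) \<le> cmod w / (1 - (cmod w)\<^sup>2)" if w: "cmod w < 1" for w
  proof -
    have "cmod (b (of_real \<rho> * w) - b (of_real \<rho> * 0)) \<le> 1 / (1 - (cmod w)\<^sup>2) * cmod (w - 0)"
    proof (rule field_differentiable_bound[where S = "cball 0 (cmod w)" and f' = "\<lambda>w. \<rho> * deriv b (of_real \<rho> * w)"])
      fix v :: complex assume v: "v \<in> cball 0 (cmod w)"
      then show "((\<lambda>w. b (of_real \<rho> * w)) has_field_derivative \<rho> * deriv b (of_real \<rho> * v)) (at v within cball 0 (cmod w))"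
        using w by (intro has_field_derivative_at_within[OF d]) auto
      have "cmod (\<rho> * deriv b (of_real \<rho> * v)) \<le> 1 / (1 - (cmod v)\<^sup>2)" using v w by (intro d1) auto
      also have "\<dots> \<le> 1 / (1 - (cmod w)\<^sup>2)"
      proof -
        have "(cmod v)\<^sup>2 \<le> (cmod w)\<^sup>2" "(cmod w)\<^sup>2 < 1" using v w by (auto intro!: power_mono simp: abs_square_less_1)
        then show ?thesis by (intro divide_left_mono mult_pos_pos) linarith+
      qed
      finally show "cmod (\<rho> * deriv b (of_real \<rho> * v)) \<le> 1 / (1 - (cmod w)\<^sup>2)" .
    qed auto
    then show ?thesis using b(2) by simp
  qed
  show "cmod (b (of_real \<rho> * w) - b (of_real \<rho> * v)) \<le> exp T * cmod (w - v)" if "cmod w \<le> 1" "cmod v \<le> 1" for w v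
    by (rule field_differentiable_bound[where S = "cball 0 1" and f' = "\<lambda>w. \<rho> * deriv b (of_real \<rho> * w)"])
       (use that d dT in \<open>auto intro: has_field_derivative_at_within\<close>)
qed

text \<open>Up to a factor, \<open>a\<close> is the distance to the circle in units of 1 / d. The
  bound 1 is Schwarz-Pick for z^d; the bound \<open>a * exp T\<close>, useful near the circle, comes
  from the dilation; the bound \<open>32 / a\<close>, useful far from it, from the smallness of z^(d
  - 1).\<close>

lemma bloch_dilate_power_deriv:
  assumes b: "b \<in> bloch_unit_ball" "b 0 = 0" and T: "0 \<le> T" and \<rho>: "\<rho> = hyp_radius T"
    and z: "cmod z < 1" and d: "1 \<le> d"
  defines "D \<equiv> \<rho> * deriv b (of_real \<rho> * z ^ d) * (d * z ^ (d - 1))"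
    and "a \<equiv> d * (1 - (cmod z)\<^sup>2)"
  shows "((\<lambda>z. b (of_real \<rho> * z ^ d)) has_field_derivative D) (at z)"
    and "(1 - (cmod z)\<^sup>2) * cmod D \<le> 1" and "(1 - (cmod z)\<^sup>2) * cmod D \<le> a * exp T"
    and "(1 - (cmod z)\<^sup>2) * cmod D \<le> 32 / a"
proof -
  define s where "s = cmod z"
  have s: "0 \<le> s" "s < 1" using z by (auto simp: s_def)
  note f = bloch_dilate[OF b T \<rho>]
  have zd: "cmod (z ^ d) < 1" using z d by (simp add: norm_power power_less_one_iff)
  have sd: "(s ^ d)\<^sup>2 < 1" using zd by (simp add: abs_square_less_1 norm_power s_def)
  have a0: "0 < a" using s d unfolding a_def s_def[symmetric] by (auto simp: abs_square_less_1)
  have s2: "0 < 1 - s\<^sup>2" using s by (simp add: abs_square_less_1)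
  show "((\<lambda>z. b (of_real \<rho> * z ^ d)) has_field_derivative D) (at z)"
    unfolding D_def
    by (rule DERIV_chain2[where f = "\<lambda>w. b (of_real \<rho> * w)" and g = "\<lambda>z. z ^ d", OF f(1)])
       (use zd in \<open>auto intro!: derivative_eq_intros\<close>)
  have nD: "cmod D = cmod (\<rho> * deriv b (of_real \<rho> * z ^ d)) * (d * s ^ (d - 1))"
    by (simp add: D_def norm_mult norm_power s_def)
  have D1: "cmod D \<le> 1 / (1 - (s ^ d)\<^sup>2) * (d * s ^ (d - 1))"
    unfolding nD using f(3)[OF zd] s by (intro mult_right_mono) (auto simp: norm_power s_def)
  have "(1 - s\<^sup>2) * cmod D \<le> (1 - s\<^sup>2) * (1 / (1 - (s ^ d)\<^sup>2) * (d * s ^ (d - 1)))"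
    using s2 by (intro mult_left_mono D1) auto
  also have "\<dots> = ((1 - s\<^sup>2) * (d * s ^ (d - 1))) / (1 - (s ^ d)\<^sup>2)" by simp
  also have "\<dots> \<le> (1 - s ^ (2 * d)) / (1 - (s ^ d)\<^sup>2)"
    using power_schwarz_pick[OF s, of d] sd by (intro divide_right_mono) auto
  also have "\<dots> = 1" using sd by (simp add: power_mult[symmetric] mult.commute)
  finally show one: "(1 - (cmod z)\<^sup>2) * cmod D \<le> 1" by (simp add: s_def)
  have "cmod D \<le> exp T * (d * 1)"
    unfolding nD using f(2)[of "z ^ d"] zd s by (intro mult_mono) (auto intro!: mult_left_le power_le_one)
  then have "(1 - s\<^sup>2) * cmod D \<le> (1 - s\<^sup>2) * (exp T * (d * 1))" using s2 by (intro mult_left_mono) auto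
  then show "(1 - (cmod z)\<^sup>2) * cmod D \<le> a * exp T" by (simp add: s_def a_def mult_ac)
  show "(1 - (cmod z)\<^sup>2) * cmod D \<le> 32 / a"
  \<comment> \<open>In the first case the denominator of the Schwarz-Pick bound is at least 1 / 2
    and \<open>power_decay\<close> applies; in the second a < 1, so that 32 / a exceeds the bound
    1.\<close>
  proof (cases "(s ^ d)\<^sup>2 \<le> 1 / 2")
    case True
    have "(1 - s\<^sup>2) * cmod D \<le> (1 - s\<^sup>2) * (1 / (1 - (s ^ d)\<^sup>2) * (d * s ^ (d - 1)))"
      using s2 by (intro mult_left_mono D1) auto
    also have "\<dots> \<le> (1 - s\<^sup>2) * (2 * (d * s ^ (d - 1)))"
      using True s2 s by (intro mult_left_mono mult_right_mono) (auto simp: field_simps)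
    also have "\<dots> = 2 * ((d * (1 - s\<^sup>2))\<^sup>2 * s ^ (d - 1)) / a"
    proof -
      have "2 * (a\<^sup>2 * s ^ (d - 1)) / a = 2 * (a * s ^ (d - 1))" using a0 by (simp add: power2_eq_square)
      then show ?thesis by (simp add: a_def s_def[symmetric] mult_ac)
    qed
    also have "\<dots> \<le> 2 * 16 / a" using power_decay[OF s d] a0 by (intro divide_right_mono mult_left_mono) auto
    finally show ?thesis by (simp add: s_def)
  next
    case False
    have "(1 - (1 - s\<^sup>2)) ^ d * (1 + d * (1 - s\<^sup>2)) \<le> 1"
      using s s2 by (intro power_le_inverse_linear) auto
    then have "(s ^ d)\<^sup>2 * (1 + a) \<le> 1" by (simp add: a_def s_def[symmetric] power_mult[symmetric] mult.commute)
    moreover have "1 / 2 * (1 + a) < (s ^ d)\<^sup>2 * (1 + a)" using False a0 by (intro mult_strict_right_mono) auto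
    ultimately have "a < 1" by simp
    then have "1 \<le> 32 / a" using a0 by (simp add: field_simps)
    with one show ?thesis by linarith
  qed
qed

text \<open>Let \<open>K\<close> be the first index with \<open>\<eta> \<le> a K * e K\<close>.
  Earlier terms are dominated by a geometrically increasing sequence and sum to at most 2 \<eta>.
  Later ones are at most 32 / a k, and the part 64 / \<eta>^2 of the lower bound on
  \<open>D K\<close> gives \<open>a (Suc K) \<ge> 64 / \<eta>\<close>, so they sum to at most
  \<eta>. Only the term \<open>K\<close> can be of size 1.\<close>

lemma lacunary_sum_bound:
  fixes a e x D :: "nat \<Rightarrow> real"
  assumes \<eta>: "0 < \<eta>" and a: "\<And>k. 0 < a k" "\<And>k. a (Suc k) = a k * D k" and e: "\<And>k. 1 \<le> e k"
    and D: "\<And>k. (2 + 64 / \<eta>\<^sup>2) * e k \<le> D k"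
    and x: "\<And>k. x k \<le> 1" "\<And>k. x k \<le> a k * e k" "\<And>k. x k \<le> 32 / a k"
  shows "(\<Sum>k<n. x k) \<le> 1 + 3 * \<eta>"
    and "(\<Sum>k<Suc m. a k * e k) \<le> 2 * (a m * e m)"
proof -
  have D2: "2 * e k \<le> D k" "64 / \<eta>\<^sup>2 * e k \<le> D k" for k
    using D[of k] e[of k] \<eta> by (auto simp: distrib_right intro: order_trans[rotated])
  have a2: "2 * a k \<le> a (Suc k)" for k
  proof -
    have "2 \<le> D k" using D2(1)[of k] e[of k] by simp
    then show ?thesis using a(1)[of k] by (simp add: a(2) mult.commute)
  qed
  have ae: "2 * (a k * e k) \<le> a (Suc k) * e (Suc k)" for k
  proof -
    have "2 * (a k * e k) = a k * (2 * e k) * 1" by simp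
    also have "\<dots> \<le> a k * D k * e (Suc k)"
      using D2(1)[of k] a(1)[of k] e[of k] e[of "Suc k"] by (intro mult_mono) auto
    finally show ?thesis by (simp add: a(2))
  qed
  show low: "(\<Sum>k<Suc m. a k * e k) \<le> 2 * (a m * e m)" for m
  proof (induction m)
    case 0
    then show ?case using a(1)[of 0] e[of 0] by simp
  next
    case (Suc m)
    then show ?case using ae[of m] by simp
  qed
  have high: "(\<Sum>k = p..<p + m. 1 / a k) \<le> 2 / a p - 2 / a (p + m)" for p m
  proof (induction m)
    case (Suc m)
    have "2 / a (Suc (p + m)) \<le> 2 / (2 * a (p + m))"
      using a2[of "p + m"] a(1) by (intro divide_left_mono) auto
    then have "2 / a (Suc (p + m)) \<le> 1 / a (p + m)" by simp
    with Suc show ?case by simp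
  qed simp
  show "(\<Sum>k<n. x k) \<le> 1 + 3 * \<eta>"
  proof (cases "\<forall>k<n. a k * e k < \<eta>")
    case True
    show ?thesis
    proof (cases n)
      case (Suc m)
      have "(\<Sum>k<n. x k) \<le> (\<Sum>k<Suc m. a k * e k)" unfolding Suc by (intro sum_mono x)
      also have "\<dots> \<le> 2 * (a m * e m)" by (rule low)
      also have "\<dots> \<le> 2 * \<eta>" using True Suc by (intro mult_left_mono) (auto intro: less_imp_le)
      finally show ?thesis using \<eta> by simp
    qed (use \<eta> in simp)
  next
    case False
    define K where "K = (LEAST k. \<eta> \<le> a k * e k)"
    obtain k' where k': "k' < n" "\<eta> \<le> a k' * e k'" using False by (auto simp: not_less)
    have K: "\<eta> \<le> a K * e K" unfolding K_def using k'(2) by (rule LeastI)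
    have Kn: "K < n" using k' Least_le[of "\<lambda>k. \<eta> \<le> a k * e k" k'] unfolding K_def by linarith
    have less: "a k * e k < \<eta>" if "k < K" for k using not_less_Least[of k "\<lambda>k. \<eta> \<le> a k * e k"] that unfolding K_def by auto
    have "(\<Sum>k<K. x k) \<le> 2 * \<eta>"
    proof (cases K)
      case (Suc m)
      have "(\<Sum>k<K. x k) \<le> (\<Sum>k<Suc m. a k * e k)" unfolding Suc by (intro sum_mono x)
      also have "\<dots> \<le> 2 * (a m * e m)" by (rule low)
      also have "\<dots> \<le> 2 * \<eta>" using less[of m] Suc by (intro mult_left_mono) (auto intro: less_imp_le)
      finally show ?thesis .
    qed (use \<eta> in simp)
    moreover have "(\<Sum>k = Suc K..<n. x k) \<le> \<eta>"
    proof -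
      have "(\<Sum>k = Suc K..<n. x k) \<le> (\<Sum>k = Suc K..<Suc K + (n - Suc K). 32 * (1 / a k))"
        using Kn x(3) by (intro sum_mono2 order_trans[OF sum_mono[of _ x "\<lambda>k. 32 * (1 / a k)"]]) auto
      also have "\<dots> = 32 * (\<Sum>k = Suc K..<Suc K + (n - Suc K). 1 / a k)" by (simp only: sum_distrib_left)
      also have "\<dots> \<le> 32 * (2 / a (Suc K) - 2 / a (Suc K + (n - Suc K)))" by (intro mult_left_mono high) auto
      also have "\<dots> \<le> 32 * (2 / a (Suc K))" using a(1)[of "Suc K + (n - Suc K)"] by simp
      also have "\<dots> \<le> \<eta>"
      proof -
        have "\<eta> * (64 / \<eta>\<^sup>2) \<le> (a K * e K) * (64 / \<eta>\<^sup>2)" using K \<eta> by (intro mult_right_mono) auto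
        also have "\<dots> = a K * (64 / \<eta>\<^sup>2 * e K)" by simp
        also have "\<dots> \<le> a (Suc K)" unfolding a(2) using a(1)[of K] by (intro mult_left_mono D2) auto
        finally have "64 / \<eta> \<le> a (Suc K)" using \<eta> by (simp add: power2_eq_square)
        then show ?thesis using \<eta> a(1)[of "Suc K"] by (simp add: field_simps)
      qed
      finally show ?thesis .
    qed
    moreover have "(\<Sum>k<n. x k) = (\<Sum>k<K. x k) + x K + (\<Sum>k = Suc K..<n. x k)"
    proof -
      have "{..<n} = {..<K} \<union> {K} \<union> {Suc K..<n}" using Kn by auto
      then have "(\<Sum>k<n. x k) = sum x ({..<K} \<union> {K} \<union> {Suc K..<n})" by simp
      also have "\<dots> = (\<Sum>k<K. x k) + x K + (\<Sum>k = Suc K..<n. x k)"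
        by (subst sum.union_disjoint; (subst sum.union_disjoint)?) auto
      finally show ?thesis .
    qed
    ultimately show ?thesis using x(1)[of K] by linarith
  qed
qed

text \<open>
  The \<open>k\<close>-th term is close to its extremal Bloch size only at distance between roughly \<open>1 / d k\<close>
  and \<open>exp (- T k) / d k\<close> from the circle. These ranges are well separated, so that at every point
  a single term dominates.
\<close>

lemma lacunary_bloch:
  fixes T :: "nat \<Rightarrow> real" and b :: "nat \<Rightarrow> complex \<Rightarrow> complex" and D d :: "nat \<Rightarrow> nat"
  assumes \<eta>: "0 < \<eta>" and T: "\<And>k. 0 \<le> T k" and b: "\<And>k. b k \<in> bloch_unit_ball" "\<And>k. b k 0 = 0"
    and D: "\<And>k. (2 + 64 / \<eta>\<^sup>2) * exp (T k) \<le> D k" and d: "\<And>n. d n = (\<Prod>k<n. D k)"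
  obtains B where "B \<in> bloch_unit_ball" "B 0 = 0"
    "\<And>n u. 1 \<le> n \<Longrightarrow> cmod u = 1 \<Longrightarrow>
      cmod (of_real (1 + 3 * \<eta>) * B (of_real (1 - 1 / real (d n)) * u) - (\<Sum>k<n. b k (of_real (hyp_radius (T k)) * u ^ d k))) \<le> 3"
proof -
  define \<rho> where "\<rho> k = hyp_radius (T k)" for k
  define G where "G k z = b k (of_real (\<rho> k) * z ^ d k)" for k and z :: complex
  define G' where "G' k z = \<rho> k * deriv (b k) (of_real (\<rho> k) * z ^ d k) * (d k * z ^ (d k - 1))" for k and z :: complex
  have expT: "1 \<le> exp (T k)" for k using T by simp
  have D2: "2 \<le> D k" for k
  proof -
    have "2 * 1 \<le> (2 + 64 / \<eta>\<^sup>2) * exp (T k)" using expT by (intro mult_mono) auto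
    with D[of k] have "2 \<le> real (D k)" by linarith
    then show ?thesis by linarith
  qed
  have dSuc: "d (Suc n) = d n * D n" for n by (simp add: d)
  have d2: "2 ^ j * d n \<le> d (n + j)" for n j
  proof (induction j)
    case (Suc j)
    have "2 ^ Suc j * d n = (2 ^ j * d n) * 2" by simp
    also have "\<dots> \<le> d (n + j) * D (n + j)" by (intro mult_mono Suc D2) auto
    finally show ?case by (simp add: dSuc)
  qed simp
  have d0: "d 0 = 1" by (simp add: d)
  have dk: "k < d k" for k using order.strict_trans2[OF less_exp, of k "d k"] d2[of k 0] d0 by simp
  have d1: "1 \<le> d k" for k using dk[of k] by simp
  have Gd: "(G k has_field_derivative G' k z) (at z)" "(1 - (cmod z)\<^sup>2) * cmod (G' k z) \<le> 1"
    "(1 - (cmod z)\<^sup>2) * cmod (G' k z) \<le> d k * (1 - (cmod z)\<^sup>2) * exp (T k)"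
    "(1 - (cmod z)\<^sup>2) * cmod (G' k z) \<le> 32 / (d k * (1 - (cmod z)\<^sup>2))" if "cmod z < 1" for k z
    unfolding G_def[abs_def] G'_def
    using bloch_dilate_power_deriv[OF b(1)[of k] b(2)[of k] T[of k] \<rho>_def[of k] that d1[of k]] by blast+
  \<comment> \<open>Locally uniform convergence: k < d k gives |z^(d k)| \<le> s^k on |z| \<le> s,
    and the terms vanish with that power because b k vanishes at 0.\<close>
  have Gbound: "cmod (G k z) \<le> s ^ k / (1 - s)" if "cmod z \<le> s" "s < 1" for k z s
  proof -
    have s0: "0 \<le> s" using that norm_ge_zero order_trans by blast
    have z: "cmod (z ^ d k) \<le> s ^ k" "cmod (z ^ d k) \<le> s"
    proof -
      have "cmod (z ^ d k) \<le> s ^ d k" using that by (simp add: norm_power power_mono)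
      moreover have "s ^ d k \<le> s ^ k" "s ^ d k \<le> s ^ 1"
        using that s0 dk[of k] d1[of k] power_decreasing[of k "d k" s] power_decreasing[of 1 "d k" s] by auto
      ultimately show "cmod (z ^ d k) \<le> s ^ k" "cmod (z ^ d k) \<le> s" by auto
    qed
    have "cmod (G k z) \<le> cmod (z ^ d k) / (1 - (cmod (z ^ d k))\<^sup>2)"
      unfolding G_def using z that by (intro bloch_dilate(4)[OF b T \<rho>_def]) auto
    also have "\<dots> \<le> s ^ k / (1 - s)"
    proof (rule frac_le)
      have "(cmod (z ^ d k))\<^sup>2 \<le> s\<^sup>2" using z by (intro power_mono) auto
      also have "s\<^sup>2 \<le> s" using that s0 by (simp add: power2_eq_square mult_left_le)
      finally show "1 - s \<le> 1 - (cmod (z ^ d k))\<^sup>2" by simp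
    qed (use z that s0 in auto)
    finally show ?thesis .
  qed
  have "\<exists>B B'. \<forall>z\<in>ball 0 1. (\<lambda>k. G k z) sums B z \<and> (\<lambda>k. G' k z) sums B' z \<and> (B has_field_derivative B' z) (at z)"
  proof (rule series_and_derivative_comparison_local)
    show "open (ball 0 1 :: complex set)" by simp
    show "\<And>n x. x \<in> ball 0 1 \<Longrightarrow> (G n has_field_derivative G' n x) (at x)" using Gd(1) by auto
    fix x :: complex assume x: "x \<in> ball 0 1"
    define s where "s = (1 + cmod x) / 2"
    have s: "0 \<le> s" "s < 1" "cmod x < s" using x by (auto simp: s_def)
    show "\<exists>\<delta> h. 0 < \<delta> \<and> summable h \<and> (\<forall>\<^sub>F n in sequentially. \<forall>y\<in>ball x \<delta> \<inter> ball 0 1. norm (G n y) \<le> h n)"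
    proof (intro exI[of _ "s - cmod x"] exI[of _ "\<lambda>k. s ^ k / (1 - s)"] conjI always_eventually allI ballI)
      show "summable (\<lambda>k. s ^ k / (1 - s))" using s by (intro summable_divide summable_geometric) auto
      fix n y assume "y \<in> ball x (s - cmod x) \<inter> ball 0 1"
      then have "cmod y \<le> s" using norm_triangle_ineq2[of y x] by (auto simp: dist_norm norm_minus_commute)
      then show "norm (G n y) \<le> s ^ n / (1 - s)" using s by (intro Gbound) auto
    qed (use s in auto)
  qed
  then obtain B B' where "\<forall>z\<in>ball 0 1. (\<lambda>k. G k z) sums B z \<and> (\<lambda>k. G' k z) sums B' z \<and> (B has_field_derivative B' z) (at z)"
    by blast
  then have B: "\<And>z. cmod z < 1 \<Longrightarrow> (\<lambda>k. G k z) sums B z" "\<And>z. cmod z < 1 \<Longrightarrow> (\<lambda>k. G' k z) sums B' z"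
    "\<And>z. cmod z < 1 \<Longrightarrow> (B has_field_derivative B' z) (at z)" by auto
  have B'_bound: "(1 - (cmod z)\<^sup>2) * cmod (B' z) \<le> 1 + 3 * \<eta>" if z: "cmod z < 1" for z
  proof -
    have s2: "0 < 1 - (cmod z)\<^sup>2" using z by (simp add: abs_square_less_1)
    have part: "cmod (\<Sum>k<n. G' k z) \<le> (1 + 3 * \<eta>) / (1 - (cmod z)\<^sup>2)" for n
    proof -
      have "(\<Sum>k<n. (1 - (cmod z)\<^sup>2) * cmod (G' k z)) \<le> 1 + 3 * \<eta>"
        by (rule lacunary_sum_bound(1)[OF \<eta>, where a = "\<lambda>k. d k * (1 - (cmod z)\<^sup>2)" and e = "\<lambda>k. exp (T k)" and D = D])
           (use s2 d1 Gd[OF z] expT D in \<open>auto simp: dSuc mult_ac Suc_le_eq\<close>)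
      then have "(1 - (cmod z)\<^sup>2) * (\<Sum>k<n. cmod (G' k z)) \<le> 1 + 3 * \<eta>" by (simp add: sum_distrib_left)
      then have "(\<Sum>k<n. cmod (G' k z)) \<le> (1 + 3 * \<eta>) / (1 - (cmod z)\<^sup>2)" using s2 by (simp add: field_simps)
      then show ?thesis using norm_sum[of "\<lambda>k. G' k z" "{..<n}"] by linarith
    qed
    have "(\<lambda>n. cmod (\<Sum>k<n. G' k z)) \<longlonglongrightarrow> cmod (B' z)"
      using B(2)[OF z] unfolding sums_def by (rule tendsto_norm)
    then have "cmod (B' z) \<le> (1 + 3 * \<eta>) / (1 - (cmod z)\<^sup>2)"
      by (rule LIMSEQ_le_const2) (use part in auto)
    then show ?thesis using s2 by (simp add: field_simps)
  qed
  define E where "E z = B z / (1 + 3 * \<eta>)" for z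
  show ?thesis
  proof (rule that[of E])
    show "E \<in> bloch_unit_ball"
    proof (rule bloch_unit_ballI[where b' = "\<lambda>z. B' z / (1 + 3 * \<eta>)"])
      fix z :: complex assume z: "cmod z < 1"
      show "(E has_field_derivative B' z / (1 + 3 * \<eta>)) (at z)"
        unfolding E_def[abs_def] by (rule DERIV_cdivide[OF B(3)[OF z]])
      have "cmod (1 + 3 * \<eta> :: complex) = 1 + 3 * \<eta>"
        using \<eta> norm_of_real[of "1 + 3 * \<eta>", where 'a = complex] by simp
      then show "(1 - (cmod z)\<^sup>2) * cmod (B' z / (1 + 3 * \<eta>)) \<le> 1"
        using B'_bound[OF z] \<eta> by (simp add: norm_divide field_simps)
    qed
    have "G k 0 = 0" for k using d1[of k] b(2)[of k] by (simp add: G_def zero_power)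
    then have "(\<lambda>k. 0) sums B 0" using B(1)[of 0] by simp
    then have "B 0 = 0" using sums_unique2 sums_zero by blast
    then show "E 0 = 0" by (simp add: E_def)
    fix n :: nat and u :: complex assume n: "1 \<le> n" and u: "cmod u = 1"
    \<comment> \<open>At this radius the terms before \<open>n\<close> have reached their boundary
      values up to a total error of 1, whereas |z|^(d n) \<le> 1 / 2 makes the terms from
      \<open>n\<close> on decay geometrically, with total at most 2.\<close>
    define r where "r = 1 - 1 / real (d n)"
    have dn2: "2 \<le> d n" using d2[of n 0] d0 n power_increasing[of 1 n "2::nat"] by simp
    have r: "0 \<le> r" "r < 1" using dn2 by (auto simp: r_def)
    have ru: "cmod (of_real r * u) = r" using r u by (simp add: norm_mult)
    have r1: "r ^ d n \<le> 1 / 2"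
      using power_le_inverse_linear[of "1 / d n" "d n"] dn2 by (simp add: r_def)
    define c where "c k = b k (of_real (\<rho> k) * u ^ d k)" for k
    have lo: "cmod (\<Sum>k<n. G k (of_real r * u) - c k) \<le> 1"
    proof -
      define A where "A k = real (d k) / real (d n)" for k
      have "cmod (\<Sum>k<n. G k (of_real r * u) - c k) \<le> (\<Sum>k<n. cmod (G k (of_real r * u) - c k))" by (rule norm_sum)
      also have "\<dots> \<le> (\<Sum>k<n. A k * exp (T k))"
      proof (intro sum_mono)
        fix k
        have "cmod (G k (of_real r * u) - c k) \<le> exp (T k) * cmod ((of_real r * u) ^ d k - u ^ d k)"
          unfolding G_def c_def using ru r u by (intro bloch_dilate(5)[OF b T \<rho>_def]) (auto simp: norm_power power_le_one)
        also have "(of_real r * u) ^ d k - u ^ d k = of_real (r ^ d k - 1) * u ^ d k"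
          by (simp add: power_mult_distrib left_diff_distrib)
        also have "cmod \<dots> = 1 - r ^ d k" using u r by (simp add: norm_mult norm_power power_le_one del: of_real_diff)
        also have "1 - r ^ d k \<le> A k"
          using Bernoulli_inequality[of "- 1 / d n" "d k"] dn2 by (simp add: r_def A_def field_simps)
        finally show "cmod (G k (of_real r * u) - c k) \<le> A k * exp (T k)" by (simp add: mult.commute)
      qed
      also have "(\<Sum>k<n. A k * exp (T k)) \<le> 1"
      proof -
        obtain m where m: "n = Suc m" using n by (cases n) auto
        have "(\<Sum>k<Suc m. A k * exp (T k)) \<le> 2 * (A m * exp (T m))"
          by (rule lacunary_sum_bound(2)[OF \<eta>, where x = "\<lambda>_. 0" and D = D])
             (use dn2 d1 expT D in \<open>auto simp: A_def dSuc Suc_le_eq\<close>)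
        also have "\<dots> = 2 * exp (T m) / D m" using d1[of m] D2[of m] by (simp add: A_def m dSuc)
        also have "\<dots> \<le> 1"
        proof -
          have "2 * exp (T m) \<le> (2 + 64 / \<eta>\<^sup>2) * exp (T m)" by (intro mult_right_mono) auto
          with D[of m] have "2 * exp (T m) \<le> D m" by linarith
          then show ?thesis using D2[of m] by (simp add: field_simps)
        qed
        finally show ?thesis by (simp add: m)
      qed
      finally show ?thesis .
    qed
    have hi: "cmod (G k (of_real r * u)) \<le> 2 * (1 / 2) ^ (k - n) / 2" if k: "n \<le> k" for k
    proof -
      define w where "w = (of_real r * u) ^ d k"
      have nw: "cmod w = r ^ d k" using ru by (simp add: w_def norm_power del: norm_mult)
      have "r ^ d k \<le> (1 / 2) ^ (k - n) / 2"
      proof -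
        have "2 ^ (k - n) * d n \<le> d k" using d2[of "k - n" n] k by simp
        then have "r ^ d k \<le> r ^ (d n * 2 ^ (k - n))" using r by (intro power_decreasing) (auto simp: mult.commute)
        also have "\<dots> = (r ^ d n) ^ (2 ^ (k - n))" by (rule power_mult)
        also have "\<dots> \<le> (1 / 2) ^ (2 ^ (k - n))" using r1 r by (intro power_mono) auto
        also have "\<dots> \<le> (1 / 2) ^ (Suc (k - n))"
          by (intro power_decreasing) (auto simp: Suc_le_eq less_exp)
        finally show ?thesis by simp
      qed
      moreover have "(1 / 2 :: real) ^ (k - n) \<le> 1" by (simp add: power_le_one)
      ultimately have w: "cmod w \<le> 1 / 2" "cmod w \<le> (1 / 2) ^ (k - n) / 2" by (auto simp: nw)
      have "cmod (G k (of_real r * u)) \<le> cmod w / (1 - (cmod w)\<^sup>2)"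
        unfolding G_def w_def[symmetric] using w by (intro bloch_dilate(4)[OF b T \<rho>_def]) auto
      also have "\<dots> \<le> cmod w / (1 / 2)"
      proof (intro divide_left_mono)
        have "(cmod w)\<^sup>2 \<le> (1 / 2)\<^sup>2" using w by (intro power_mono) auto
        then show "1 / 2 \<le> 1 - (cmod w)\<^sup>2" "0 < (1 - (cmod w)\<^sup>2) * (1 / 2)" by (auto simp: power2_eq_square)
      qed auto
      also have "\<dots> \<le> 2 * (1 / 2) ^ (k - n) / 2" using w by simp
      finally show ?thesis .
    qed
    have hisum: "cmod (\<Sum>k = n..<n + j. G k (of_real r * u)) \<le> 2" for j
    proof -
      have "cmod (\<Sum>k = n..<n + j. G k (of_real r * u)) \<le> (\<Sum>k = n..<n + j. 2 * (1 / 2) ^ (k - n) / 2)"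
        by (intro sum_norm_le hi) auto
      also have "\<dots> = (\<Sum>i<j. (1 / 2) ^ i)"
        using sum.shift_bounds_nat_ivl[of "\<lambda>k. 2 * (1 / 2 :: real) ^ (k - n) / 2" 0 n j]
        by (simp add: add.commute atLeast0LessThan)
      also have "\<dots> \<le> 2" by (simp add: sum_gp_strict power_le_one)
      finally show ?thesis .
    qed
    have "cmod (B (of_real r * u) - (\<Sum>k<n. c k)) \<le> 3"
    proof -
      have "(\<lambda>m. (\<Sum>k<m. G k (of_real r * u))) \<longlonglongrightarrow> B (of_real r * u)"
        using B(1)[of "of_real r * u"] ru r unfolding sums_def by simp
      then have "(\<lambda>m. cmod ((\<Sum>k<m. G k (of_real r * u)) - (\<Sum>k<n. c k))) \<longlonglongrightarrow> cmod (B (of_real r * u) - (\<Sum>k<n. c k))"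
        by (intro tendsto_intros)
      then show ?thesis
      proof (rule LIMSEQ_le_const2, intro exI[of _ n] allI impI)
        fix m assume "n \<le> m"
        then obtain j where m: "m = n + j" using le_Suc_ex by blast
        have "(\<Sum>k<m. G k (of_real r * u)) = (\<Sum>k<n. G k (of_real r * u)) + (\<Sum>k = n..<n + j. G k (of_real r * u))"
          unfolding m lessThan_atLeast0 by (rule sum.atLeastLessThan_concat[symmetric]) auto
        then have "(\<Sum>k<m. G k (of_real r * u)) - (\<Sum>k<n. c k) =
            (\<Sum>k<n. G k (of_real r * u) - c k) + (\<Sum>k = n..<n + j. G k (of_real r * u))"
          by (simp add: sum_subtractf)
        then show "cmod ((\<Sum>k<m. G k (of_real r * u)) - (\<Sum>k<n. c k)) \<le> 3"
          using lo hisum[of j] norm_triangle_ineq[of "\<Sum>k<n. G k (of_real r * u) - c k" "\<Sum>k = n..<n + j. G k (of_real r * u)"]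
          by simp
      qed
    qed
    moreover have "(1 + 3 * \<eta>) * E (of_real r * u) = B (of_real r * u)"
    proof -
      have "(1 + 3 * complex_of_real \<eta>) \<noteq> 0"
        using \<eta> of_real_eq_0_iff[of "1 + 3 * \<eta>", where 'a = complex] by auto
      then show ?thesis by (simp add: E_def)
    qed
    ultimately show "cmod (of_real (1 + 3 * \<eta>) * E (of_real (1 - 1 / real (d n)) * u) - (\<Sum>k<n. b k (of_real (hyp_radius (T k)) * u ^ d k))) \<le> 3"
      by (simp add: r_def c_def \<rho>_def)
  qed
qed

subsection \<open>Digit processes\<close>

text \<open>The angle in turns as a uniform random variable; the interval is half-open so that equal
  cells tile it exactly.\<close>

definition U01 :: "real measure" where "U01 = restrict_space lborel {0..<1}"

lemma space_U01 [simp]: "space U01 = {0..<1}" by (simp add: U01_def space_restrict_space)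

lemma borel_measurable_U01: "f \<in> borel_measurable borel \<Longrightarrow> f \<in> borel_measurable U01"
  unfolding U01_def by (rule measurable_restrict_space1) simp

interpretation U01: prob_space U01
proof (rule prob_spaceI)
  have "emeasure U01 {0..<1} = emeasure lborel {0..<1::real}"
    unfolding U01_def by (rule emeasure_restrict_space) auto
  then show "emeasure U01 (space U01) = 1" by simp
qed

lemma integrable_U01:
  fixes f :: "real \<Rightarrow> real"
  assumes "f \<in> borel_measurable borel" "\<And>x. \<bar>f x\<bar> \<le> B"
  shows "integrable U01 f"
  by (rule U01.integrable_const_bound[where B = B]) (use assms in \<open>auto intro: borel_measurable_U01\<close>)

lemma integral_U01: "(\<integral>x. f x \<partial>U01) = (\<integral>x. indicator {0..<1} x * f x \<partial>lborel)" for f :: "real \<Rightarrow> real"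
  by (simp add: U01_def integral_restrict_space)

lemma integral_U01_continuous:
  fixes f :: "real \<Rightarrow> real"
  assumes f: "continuous_on UNIV f"
  shows "(\<integral>x. f x \<partial>U01) = integral {0..1} f"
proof -
  have [measurable]: "f \<in> borel_measurable borel" by (rule borel_measurable_continuous_onI[OF f])
  have i: "set_integrable lborel {0..1} f"
    by (rule borel_integrable_atLeastAtMost') (rule continuous_on_subset[OF f], simp)
  have "(\<integral>x. f x \<partial>U01) = (\<integral>x. indicator {0..<1} x * f x \<partial>lborel)" by (rule integral_U01)
  also have "\<dots> = (\<integral>x. indicator {0..1} x * f x \<partial>lborel)"
  proof (rule integral_cong_AE)
    show "AE x in lborel. indicator {0..<1} x * f x = indicator {0..1} x * f x"
      using AE_lborel_singleton[of "1::real"] by eventually_elim (auto simp: indicator_def)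
  qed measurable
  also have "\<dots> = integral {0..1} f"
    using set_borel_integral_eq_integral(2)[OF i] by (simp add: set_lebesgue_integral_def)
  finally show ?thesis .
qed

definition cell_int :: "nat \<Rightarrow> nat \<Rightarrow> (real \<Rightarrow> real) \<Rightarrow> real" where
  "cell_int d j f = (\<integral>x. indicator {real j / real d..<(real j + 1) / real d} x * f x \<partial>lborel)"

lemma integrable_cell:
  fixes f :: "real \<Rightarrow> real" assumes [measurable]: "f \<in> borel_measurable borel" and B: "\<And>x. \<bar>f x\<bar> \<le> B"
  shows "integrable lborel (\<lambda>x. indicator {a..<b} x * f x)"
proof (rule Bochner_Integration.integrable_bound)
  show "integrable lborel (\<lambda>x. indicator {a..b} x * B)"
    by (intro integrable_mult_left) (auto simp: integrable_indicator_iff emeasure_lborel_Icc_eq)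
  have "0 \<le> B" using B[of 0] by linarith
  then show "AE x in lborel. norm (indicator {a..<b} x * f x) \<le> norm (indicator {a..b} x * B)"
    using B by (auto simp: indicator_def)
qed simp

lemma integral_U01_cells:
  fixes d :: nat and f :: "real \<Rightarrow> real"
  assumes d: "1 \<le> d" and f: "f \<in> borel_measurable borel" "\<And>x. \<bar>f x\<bar> \<le> B"
  shows "(\<integral>x. f x \<partial>U01) = (\<Sum>j<d. cell_int d j f)"
proof -
  have ind: "indicator {0..<1::real} x = (\<Sum>j<d. indicator {real j / d..<(real j + 1) / d} x :: real)" for x
  proof (cases "x \<in> {0..<1}")
    case True
    define i where "i = nat \<lfloor>real d * x\<rfloor>"
    have "real i = of_int \<lfloor>real d * x\<rfloor>" using True by (simp add: i_def)
    then have i: "real i \<le> real d * x" "real d * x < real i + 1" by linarith+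
    have "real d * x < real d * 1" using True d by (intro mult_strict_left_mono) auto
    then have id: "i < d" using i(1) by simp
    have iff: "x \<in> {real j / d..<(real j + 1) / d} \<longleftrightarrow> j = i" for j
      using i d by (auto simp: field_simps)
    have "(\<Sum>j<d. indicator {real j / d..<(real j + 1) / d} x :: real) = (\<Sum>j<d. if j = i then 1 else 0)"
      by (intro sum.cong) (auto simp: indicator_def iff simp del: atLeastLessThan_iff)
    then show ?thesis using True id by simp
  next
    case False
    have "x \<notin> {real j / d..<(real j + 1) / d}" if "j < d" for j
    proof
      assume "x \<in> {real j / d..<(real j + 1) / d}"
      moreover have "0 \<le> real j / d" "(real j + 1) / d \<le> 1" using that d by (auto simp: field_simps)
      ultimately show False using False unfolding atLeastLessThan_iff by linarith
    qed
    then have "(\<Sum>j<d. indicator {real j / d..<(real j + 1) / d} x :: real) = 0"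
      by (intro sum.neutral) (auto simp del: atLeastLessThan_iff)
    moreover have "indicator {0..<1} x = (0::real)" using False by (rule indicator_simps(2))
    ultimately show ?thesis by simp
  qed
  have "(\<integral>x. f x \<partial>U01) = (\<integral>x. (\<Sum>j<d. indicator {real j / d..<(real j + 1) / d} x * f x) \<partial>lborel)"
    by (simp add: integral_U01 ind sum_distrib_right)
  also have "\<dots> = (\<Sum>j<d. cell_int d j f)"
    unfolding cell_int_def by (intro Bochner_Integration.integral_sum integrable_cell[OF f])
  finally show ?thesis .
qed

lemma cell_int_periodic:
  fixes d j :: nat and f :: "real \<Rightarrow> real"
  assumes d: "1 \<le> d" and f: "\<And>x. f (x + 1 / real d) = f x"
  shows "cell_int d j f = cell_int d 0 f"
proof -
  have per: "f (x + real j / real d) = f x" for j :: nat and x :: real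
  proof (induction j)
    case (Suc j)
    have "f (x + real (Suc j) / real d) = f ((x + real j / real d) + 1 / real d)" by (simp add: add_divide_distrib algebra_simps)
    then show ?case using f Suc by simp
  qed simp
  have "cell_int d j f = (\<integral>x. indicator {real j / real d..<(real j + 1) / real d} (real j / real d + 1 * x) * f (real j / real d + 1 * x) \<partial>lborel)"
    unfolding cell_int_def by (subst lborel_integral_real_affine[where c = 1 and t = "real j / real d"]) auto
  also have "\<dots> = cell_int d 0 f"
    unfolding cell_int_def
    by (intro Bochner_Integration.integral_cong)
       (auto simp: indicator_def per add.commute[of "real j / real d"] add_divide_distrib)
  finally show ?thesis .
qed

text \<open>On a cell of length 1 / d the factor \<open>G\<close> is constant while \<open>K\<close>
  runs through a full period, so the integral over each cell factorises, with the same second factor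
  for all cells. This is the independence of coarse and fine digits of \<open>x\<close>.\<close>

lemma integral_U01_independent:
  fixes d :: nat and G K :: "real \<Rightarrow> real"
  assumes d: "1 \<le> d"
    and G: "G \<in> borel_measurable borel" "\<And>x. \<bar>G x\<bar> \<le> B" "\<And>x y. \<lfloor>real d * x\<rfloor> = \<lfloor>real d * y\<rfloor> \<Longrightarrow> G x = G y"
    and K: "K \<in> borel_measurable borel" "\<And>x. \<bar>K x\<bar> \<le> C" "\<And>x. K (x + 1 / real d) = K x"
  shows "(\<integral>x. G x * K x \<partial>U01) = (\<integral>x. G x \<partial>U01) * (\<integral>x. K x \<partial>U01)"
proof -
  have cell: "indicator {real j / real d..<(real j + 1) / real d} x * G x = indicator {real j / real d..<(real j + 1) / real d} x * G (real j / real d)" for j :: nat and x :: real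
  proof (cases "x \<in> {real j / real d..<(real j + 1) / real d}")
    case True
    then have "\<lfloor>real d * x\<rfloor> = int j" using d by (intro floor_unique) (auto simp: field_simps)
    moreover have "\<lfloor>real d * (real j / real d)\<rfloor> = int j" using d by simp
    ultimately show ?thesis using G(3)[of x "real j / real d"] by simp
  qed simp
  have GK: "\<bar>G x * K x\<bar> \<le> B * C" for x
    unfolding abs_mult using G(2)[of x] K(2)[of x] by (intro mult_mono) auto
  have 1: "cell_int d j (\<lambda>x. G x * K x) = G (real j / real d) * cell_int d 0 K" for j
  proof -
    have "cell_int d j (\<lambda>x. G x * K x) = (\<integral>x. G (real j / real d) * (indicator {real j / real d..<(real j + 1) / real d} x * K x) \<partial>lborel)"
      unfolding cell_int_def mult.assoc[symmetric] cell by (simp add: mult_ac)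
    also have "\<dots> = G (real j / real d) * cell_int d j K" unfolding cell_int_def by (rule integral_mult_right_zero)
    finally show ?thesis using cell_int_periodic[OF d, of K j] K(3) by simp
  qed
  have 2: "cell_int d j G = G (real j / real d) / d" for j
  proof -
    have "cell_int d j G = (\<integral>x. indicator {real j / real d..<(real j + 1) / real d} x * G (real j / real d) \<partial>lborel)"
      unfolding cell_int_def cell ..
    also have "\<dots> = measure lborel {real j / real d..<(real j + 1) / real d} * G (real j / real d)" by simp
    also have "measure lborel {real j / real d..<(real j + 1) / real d} = 1 / d"
    proof -
      have "real j / real d \<le> (real j + 1) / real d" by (intro divide_right_mono) auto
      from measure_lborel_Ico[OF this] show ?thesis unfolding add_divide_distrib by linarith
    qed
    finally show ?thesis by simp
  qed
  have "(\<integral>x. G x * K x \<partial>U01) = (\<Sum>j<d. G (real j / real d)) * cell_int d 0 K"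
    using borel_measurable_times[OF G(1) K(1)]
    by (subst integral_U01_cells[OF d _ GK]) (simp_all add: 1 sum_distrib_right)
  moreover have "(\<integral>x. G x \<partial>U01) = (\<Sum>j<d. G (real j / real d)) / d"
    by (subst integral_U01_cells[OF d G(1,2)]) (simp add: 2 sum_divide_distrib)
  moreover have "(\<integral>x. K x \<partial>U01) = d * cell_int d 0 K"
  proof -
    have "(\<Sum>j<d. cell_int d j K) = (\<Sum>j<d. cell_int d 0 K)"
      by (intro sum.cong refl cell_int_periodic[OF d] K(3))
    then show ?thesis using integral_U01_cells[OF d K(1,2)] by simp
  qed
  ultimately show ?thesis using d by simp
qed

lemma integral_U01_scale:
  fixes d :: nat and H :: "real \<Rightarrow> real"
  assumes d: "1 \<le> d" and H: "H \<in> borel_measurable borel" "\<And>x. \<bar>H x\<bar> \<le> C" "\<And>x. H (x + 1) = H x"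
  shows "(\<integral>x. H (real d * x) \<partial>U01) = (\<integral>x. H x \<partial>U01)"
proof -
  have "(\<integral>x. H (real d * x) \<partial>U01) = (\<Sum>j<d. cell_int d j (\<lambda>x. H (real d * x)))"
    by (rule integral_U01_cells[OF d]) (use H in auto)
  also have "\<dots> = d * cell_int d 0 (\<lambda>x. H (real d * x))"
  proof -
    have "(\<Sum>j<d. cell_int d j (\<lambda>x. H (real d * x))) = (\<Sum>j<d. cell_int d 0 (\<lambda>x. H (real d * x)))"
      by (intro sum.cong refl cell_int_periodic[OF d]) (use d H(3) in \<open>simp add: distrib_left\<close>)
    then show ?thesis by simp
  qed
  also have "\<dots> = (\<integral>x. H x \<partial>U01)"
  proof -
    have "(\<integral>x. H x \<partial>U01) = \<bar>real d\<bar> * (\<integral>x. indicator {0..<1} (0 + real d * x) * H (0 + real d * x) \<partial>lborel)"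
      unfolding integral_U01 using d by (subst lborel_integral_real_affine[where c = "real d" and t = 0]) auto
    also have "(\<lambda>x. indicator {0..<1} (0 + real d * x) * H (0 + real d * x)) = (\<lambda>x. indicator {real 0 / d..<(real 0 + 1) / d} x * H (real d * x))"
      using d by (auto simp: indicator_def field_simps zero_le_mult_iff)
    finally show ?thesis by (simp add: cell_int_def)
  qed
  finally show ?thesis .
qed

lemma floor_mult_dvd:
  fixes a b :: nat and x y :: real
  assumes ab: "a dvd b" "1 \<le> b" and xy: "\<lfloor>real b * x\<rfloor> = \<lfloor>real b * y\<rfloor>"
  shows "\<lfloor>real a * x\<rfloor> = \<lfloor>real a * y\<rfloor>"
proof -
  obtain c where c: "b = a * c" using ab by auto
  with ab have c0: "0 < c" by (cases c) auto
  have "\<lfloor>real a * x\<rfloor> = \<lfloor>real b * x\<rfloor> div int c" for x :: real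
  proof -
    have "real a * x = (real b * x) / real_of_int (int c)" using c0 by (simp add: c)
    then show ?thesis by (simp only:) (subst floor_divide_real_eq_div, auto)
  qed
  then show ?thesis using xy by simp
qed

text \<open>In the mixed radix expansion of \<open>x\<close> with denominators \<open>d k\<close>,
  the function \<open>Y k\<close> sees only the digits between \<open>d k\<close> and
  \<open>d (Suc k)\<close>: periodicity hides the coarser ones, constancy on cells the finer ones.
  Like Rademacher functions, the \<open>Y k\<close> are therefore independent and centred.\<close>

locale digit_process =
  fixes d :: "nat \<Rightarrow> nat" and Y :: "nat \<Rightarrow> real \<Rightarrow> real" and A :: "nat \<Rightarrow> real"
  assumes d1: "\<And>k. 1 \<le> d k" and d_dvd: "\<And>k. d k dvd d (Suc k)"
    and Y_meas [measurable]: "\<And>k. Y k \<in> borel_measurable borel"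
    and Y_bound: "\<And>k x. \<bar>Y k x\<bar> \<le> A k"
    and Y_periodic: "\<And>k x. Y k (x + 1 / real (d k)) = Y k x"
    and Y_cell: "\<And>k x y. \<lfloor>real (d (Suc k)) * x\<rfloor> = \<lfloor>real (d (Suc k)) * y\<rfloor> \<Longrightarrow> Y k x = Y k y"
    and Y_mean: "\<And>k. (\<integral>x. Y k x \<partial>U01) = 0"
begin

definition block :: "nat \<Rightarrow> nat \<Rightarrow> real \<Rightarrow> real" where "block m n x = (\<Sum>k = m..<n. Y k x)"

definition var :: "nat \<Rightarrow> real" where "var k = (\<integral>x. (Y k x)\<^sup>2 \<partial>U01)"

lemma d_dvd': "m \<le> n \<Longrightarrow> d m dvd d n"
  by (induction n rule: dec_induct) (auto intro: dvd_trans d_dvd)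

lemma block_meas [measurable]: "block m n \<in> borel_measurable borel"
  unfolding block_def by measurable

lemma block_bound: "\<bar>block m n x\<bar> \<le> (\<Sum>k = m..<n. A k)"
  unfolding block_def by (intro order_trans[OF sum_abs] sum_mono Y_bound)

lemma block_cell: "\<lfloor>real (d n) * x\<rfloor> = \<lfloor>real (d n) * y\<rfloor> \<Longrightarrow> block m n x = block m n y"
  unfolding block_def
proof (rule sum.cong[OF refl])
  fix k assume xy: "\<lfloor>real (d n) * x\<rfloor> = \<lfloor>real (d n) * y\<rfloor>" and "k \<in> {m..<n}"
  then have "d (Suc k) dvd d n" by (intro d_dvd') auto
  from floor_mult_dvd[OF this d1 xy] show "Y k x = Y k y" by (rule Y_cell)
qed

lemma Y_periodic': "m \<le> k \<Longrightarrow> Y k (x + 1 / real (d m)) = Y k x"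
proof -
  assume "m \<le> k"
  then obtain c where c: "d k = d m * c" using d_dvd'[of m k] by auto
  have "Y k (x + real j / real (d k)) = Y k x" for j :: nat
  proof (induction j)
    case (Suc j)
    have "Y k (x + real (Suc j) / real (d k)) = Y k ((x + real j / real (d k)) + 1 / real (d k))" by (simp add: add_divide_distrib algebra_simps)
    then show ?case using Suc Y_periodic by simp
  qed simp
  from this[of c] show ?thesis using c d1[of k] by simp
qed

lemma block_periodic: "block m n (x + 1 / real (d m)) = block m n x"
  unfolding block_def by (intro sum.cong refl Y_periodic') auto

lemma block_Suc: "m \<le> n \<Longrightarrow> block m (Suc n) x = block m n x + Y n x"
  by (simp add: block_def)

lemma var_nonneg: "0 \<le> var k" unfolding var_def by simp

lemma integrable_block_sq: "integrable U01 (\<lambda>x. (block m n x)\<^sup>2)"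
proof (rule integrable_U01[where B = "(\<Sum>k = m..<n. A k)\<^sup>2"])
  fix x
  have "\<bar>block m n x\<bar>\<^sup>2 \<le> (\<Sum>k = m..<n. A k)\<^sup>2" by (intro power_mono block_bound) auto
  then show "\<bar>(block m n x)\<^sup>2\<bar> \<le> (\<Sum>k = m..<n. A k)\<^sup>2" by simp
qed simp

text \<open>The mixed term factorises by independence and vanishes because \<open>Y n\<close> has
  mean 0.\<close>

lemma integral_block_sq: "m \<le> n \<Longrightarrow> (\<integral>x. (block m n x)\<^sup>2 \<partial>U01) = (\<Sum>k = m..<n. var k)"
proof (induction n rule: dec_induct)
  case base
  show ?case by (simp add: block_def)
next
  case (step n)
  have ind: "(\<integral>x. block m n x * Y n x \<partial>U01) = (\<integral>x. block m n x \<partial>U01) * (\<integral>x. Y n x \<partial>U01)"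
    by (rule integral_U01_independent[where G = "block m n" and K = "Y n", OF d1 _ block_bound _ _ Y_bound])
       (auto simp: Y_periodic intro: block_cell)
  have i1: "integrable U01 (\<lambda>x. (Y n x)\<^sup>2)"
    using integrable_block_sq[of n "Suc n"] by (simp add: block_def)
  have bd: "\<bar>block m n x * Y n x\<bar> \<le> (\<Sum>k = m..<n. A k) * A n" for x
    unfolding abs_mult using block_bound[of m n x] Y_bound[of n x] by (intro mult_mono) auto
  have i2: "integrable U01 (\<lambda>x. block m n x * Y n x)"
    by (rule integrable_U01[OF _ bd]) simp
  have "(\<integral>x. (block m (Suc n) x)\<^sup>2 \<partial>U01) = (\<integral>x. (block m n x)\<^sup>2 + (2 * (block m n x * Y n x) + (Y n x)\<^sup>2) \<partial>U01)"
    using step by (simp add: block_Suc power2_sum algebra_simps)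
  also have "\<dots> = (\<integral>x. (block m n x)\<^sup>2 \<partial>U01) + (2 * (\<integral>x. block m n x * Y n x \<partial>U01) + var n)"
    unfolding var_def using i1 i2 integrable_block_sq[of m n]
    by (subst Bochner_Integration.integral_add, simp_all)
  also have "\<dots> = (\<Sum>k = m..<Suc n. var k)"
    using step ind Y_mean by simp
  finally show ?case .
qed

lemma integrable_exp_block: "integrable U01 (\<lambda>x. exp (l * block m n x))"
proof (rule integrable_U01[where B = "exp (\<bar>l\<bar> * (\<Sum>k = m..<n. A k))"])
  fix x
  have "l * block m n x \<le> \<bar>l\<bar> * \<bar>block m n x\<bar>" by (metis abs_ge_self abs_mult)
  also have "\<dots> \<le> \<bar>l\<bar> * (\<Sum>k = m..<n. A k)" by (intro mult_left_mono block_bound) auto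
  finally show "\<bar>exp (l * block m n x)\<bar> \<le> exp (\<bar>l\<bar> * (\<Sum>k = m..<n. A k))" by simp
qed simp

lemma integral_exp_block:
  "m \<le> n \<Longrightarrow> (\<integral>x. exp (l * block m n x) \<partial>U01) = (\<Prod>k = m..<n. (\<integral>x. exp (l * Y k x) \<partial>U01))"
proof (induction n rule: dec_induct)
  case base
  show ?case using U01.prob_space by (simp add: block_def)
next
  case (step n)
  have bd: "\<bar>exp (l * block i j x)\<bar> \<le> exp (\<bar>l\<bar> * (\<Sum>k = i..<j. A k))" for i j x
  proof -
    have "l * block i j x \<le> \<bar>l\<bar> * \<bar>block i j x\<bar>" by (metis abs_ge_self abs_mult)
    also have "\<dots> \<le> \<bar>l\<bar> * (\<Sum>k = i..<j. A k)" by (intro mult_left_mono block_bound) auto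
    finally show ?thesis by simp
  qed
  have bY: "block n (Suc n) x = Y n x" for x by (simp add: block_def)
  have "(\<integral>x. exp (l * block m n x) * exp (l * Y n x) \<partial>U01) = (\<integral>x. exp (l * block m n x) \<partial>U01) * (\<integral>x. exp (l * Y n x) \<partial>U01)"
    by (rule integral_U01_independent[where G = "\<lambda>x. exp (l * block m n x)" and K = "\<lambda>x. exp (l * Y n x)",
          OF d1[of n] _ bd[of m n] _ _ bd[of n "Suc n", unfolded bY]])
       (auto simp: Y_periodic dest: block_cell[of n _ _ m])
  then show ?case using step by (simp add: block_Suc distrib_left exp_add)
qed

text \<open>Second order Taylor expansion of the exponential, with \<open>l * Y k\<close> bounded by
  \<open>a\<close>. The cubic remainder is at most |u|^3 / 2 since e \<le> 3; the linear term
  integrates to 0. For the lower bound, ln (1 + w) \<ge> w - w^2 turns 1 + w back into an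
  exponential.\<close>

lemma exp_moment_single:
  assumes l: "0 \<le> l" and a: "l * A k \<le> a" "a \<le> 1"
  shows "exp (l\<^sup>2 * var k / 2 * (1 - 2 * a)) \<le> (\<integral>x. exp (l * Y k x) \<partial>U01)"
    and "(\<integral>x. exp (l * Y k x) \<partial>U01) \<le> exp (l\<^sup>2 * var k / 2 * (1 + a))"
proof -
  have la: "\<bar>l * Y k x\<bar> \<le> a" for x
    using mult_left_mono[OF Y_bound[of k x] l] a(1) l by (simp add: abs_mult)
  have a0: "0 \<le> a" using la[of 0] by linarith
  have iY: "integrable U01 (Y k)" by (rule integrable_U01[OF _ Y_bound]) simp
  have iY2: "integrable U01 (\<lambda>x. (Y k x)\<^sup>2)"
    using integrable_block_sq[of k "Suc k"] by (simp add: block_def)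
  have ie: "integrable U01 (\<lambda>x. exp (l * Y k x))"
    using integrable_exp_block[of l k "Suc k"] by (simp add: block_def)
  have int: "(\<integral>x. 1 + l * Y k x + c * (Y k x)\<^sup>2 \<partial>U01) = 1 + c * var k" for c
    using iY iY2 Y_mean[of k] U01.prob_space by (simp add: var_def)
  have taylor: "\<bar>exp u - (1 + u + u\<^sup>2 / 2)\<bar> \<le> u\<^sup>2 / 2 * a" if u: "\<bar>u\<bar> \<le> a" for u :: real
  proof -
    obtain t where t: "\<bar>t\<bar> \<le> \<bar>u\<bar>" "exp u = (\<Sum>m<3. u ^ m / fact m) + (exp t / fact 3) * u ^ 3"
      using Maclaurin_exp_le[of u 3] by auto
    have "exp t \<le> 3" 
    proof -
      have "exp t \<le> exp 1" using t(1) u a(2) by simp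
      also have "\<dots> \<le> 3" using e_less_272 by simp
      finally show ?thesis .
    qed
    have "exp u - (1 + u + u\<^sup>2 / 2) = (exp t / 6) * u ^ 3"
      using t(2) by (simp add: eval_nat_numeral)
    then have "\<bar>exp u - (1 + u + u\<^sup>2 / 2)\<bar> = \<bar>(exp t / 6) * u ^ 3\<bar>" by (simp only:)
    also have "\<dots> = (exp t / 6) * (u\<^sup>2 * \<bar>u\<bar>)"
      by (simp add: abs_mult power_abs power3_eq_cube power2_eq_square)
    also have "\<dots> \<le> (3 / 6) * (u\<^sup>2 * a)"
      using \<open>exp t \<le> 3\<close> u by (intro mult_mono) auto
    finally show ?thesis by simp
  qed
  have up: "exp (l * Y k x) \<le> 1 + l * Y k x + (l\<^sup>2 / 2 * (1 + a)) * (Y k x)\<^sup>2" for x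
    using taylor[OF la[of x]] by (simp add: power_mult_distrib field_simps)
  have lo: "1 + l * Y k x + (l\<^sup>2 / 2 * (1 - a)) * (Y k x)\<^sup>2 \<le> exp (l * Y k x)" for x
    using taylor[OF la[of x]] by (simp add: power_mult_distrib field_simps)
  have "(\<integral>x. exp (l * Y k x) \<partial>U01) \<le> (\<integral>x. 1 + l * Y k x + (l\<^sup>2 / 2 * (1 + a)) * (Y k x)\<^sup>2 \<partial>U01)"
    using ie iY iY2 up by (intro integral_mono) auto
  also have "\<dots> = 1 + l\<^sup>2 * var k / 2 * (1 + a)" unfolding int by simp
  also have "\<dots> \<le> exp (l\<^sup>2 * var k / 2 * (1 + a))" by (rule exp_ge_add_one_self)
  finally show "(\<integral>x. exp (l * Y k x) \<partial>U01) \<le> exp (l\<^sup>2 * var k / 2 * (1 + a))" .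
  define y where "y = l\<^sup>2 * var k / 2"
  have y0: "0 \<le> y" using var_nonneg by (simp add: y_def)
  have ya: "y \<le> a / 2"
  proof -
    have "l\<^sup>2 * var k = (\<integral>x. (l * Y k x)\<^sup>2 \<partial>U01)" by (simp add: var_def power_mult_distrib)
    also have "\<dots> \<le> (\<integral>x. a \<partial>U01)"
    proof (rule integral_mono)
      fix x
      have "(l * Y k x)\<^sup>2 \<le> a\<^sup>2" using la[of x] by (simp add: abs_le_square_iff[symmetric] a0)
      also have "\<dots> \<le> a" using a0 a(2) by (simp add: power2_eq_square mult_left_le)
      finally show "(l * Y k x)\<^sup>2 \<le> a" .
    qed (use iY2 in \<open>auto simp: power_mult_distrib\<close>)
    finally show ?thesis using U01.prob_space by (simp add: y_def)
  qed
  have "exp (y * (1 - 2 * a)) \<le> 1 + y * (1 - a)"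
  proof -
    define w where "w = y * (1 - a)"
    have w: "0 \<le> w" "w \<le> y" using y0 a a0 by (auto simp: w_def mult_left_le)
    have "w - w\<^sup>2 \<le> ln (1 + w)" using w ya a by (intro ln_one_plus_pos_lower_bound) auto
    moreover have "y * (1 - 2 * a) \<le> w - w\<^sup>2"
    proof -
      have "w\<^sup>2 \<le> y * (a / 2)" unfolding power2_eq_square using w ya y0 by (intro mult_mono) auto
      also have "\<dots> \<le> y * a" using y0 a0 by (intro mult_left_mono) auto
      finally show ?thesis by (simp add: w_def algebra_simps)
    qed
    ultimately have "y * (1 - 2 * a) \<le> ln (1 + w)" by linarith
    then have "exp (y * (1 - 2 * a)) \<le> exp (ln (1 + w))" by simp
    also have "\<dots> = 1 + w" using w by simp
    finally show ?thesis by (simp add: w_def)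
  qed
  also have "\<dots> = (\<integral>x. 1 + l * Y k x + (l\<^sup>2 / 2 * (1 - a)) * (Y k x)\<^sup>2 \<partial>U01)"
    unfolding int by (simp add: y_def)
  also have "\<dots> \<le> (\<integral>x. exp (l * Y k x) \<partial>U01)"
    using ie iY iY2 lo by (intro integral_mono) auto
  finally show "exp (l\<^sup>2 * var k / 2 * (1 - 2 * a)) \<le> (\<integral>x. exp (l * Y k x) \<partial>U01)" by (simp add: y_def)
qed

lemma exp_moment_block:
  assumes mn: "m \<le> n" and l: "0 \<le> l" and a: "\<And>k. m \<le> k \<Longrightarrow> k < n \<Longrightarrow> l * A k \<le> a" "a \<le> 1"
  defines "v \<equiv> \<Sum>k = m..<n. var k"
  shows "exp (l\<^sup>2 * v / 2 * (1 - 2 * a)) \<le> (\<integral>x. exp (l * block m n x) \<partial>U01)"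
    and "(\<integral>x. exp (l * block m n x) \<partial>U01) \<le> exp (l\<^sup>2 * v / 2 * (1 + a))"
proof -
  have s: "(\<Sum>k = m..<n. l\<^sup>2 * var k / 2 * c) = l\<^sup>2 * v / 2 * c" for c
    unfolding v_def sum_distrib_left sum_distrib_right sum_divide_distrib ..
  have "exp (l\<^sup>2 * v / 2 * (1 - 2 * a)) = (\<Prod>k = m..<n. exp (l\<^sup>2 * var k / 2 * (1 - 2 * a)))"
    by (simp only: exp_sum[symmetric] finite_atLeastLessThan s)
  also have "\<dots> \<le> (\<Prod>k = m..<n. (\<integral>x. exp (l * Y k x) \<partial>U01))"
    using exp_moment_single(1)[OF l a(1) a(2)] by (intro prod_mono) auto
  finally show "exp (l\<^sup>2 * v / 2 * (1 - 2 * a)) \<le> (\<integral>x. exp (l * block m n x) \<partial>U01)"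
    by (simp add: integral_exp_block[OF mn])
  have "(\<integral>x. exp (l * block m n x) \<partial>U01) = (\<Prod>k = m..<n. (\<integral>x. exp (l * Y k x) \<partial>U01))"
    by (rule integral_exp_block[OF mn])
  also have "\<dots> \<le> (\<Prod>k = m..<n. exp (l\<^sup>2 * var k / 2 * (1 + a)))"
    using exp_moment_single(2)[OF l a(1) a(2)] by (intro prod_mono) auto
  also have "\<dots> = exp (l\<^sup>2 * v / 2 * (1 + a))"
    by (simp only: exp_sum[symmetric] finite_atLeastLessThan s)
  finally show "(\<integral>x. exp (l * block m n x) \<partial>U01) \<le> exp (l\<^sup>2 * v / 2 * (1 + a))" .
qed

end

section \<open>Large deviations of blocks and the second Borel-Cantelli lemma\<close>

context digit_process
begin

text \<open>
  Cramer's lower bound: under the exponential tilt with parameter \<open>l\<close> the block sum concentrates in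
  \<open>[(1 - \<eta>) l v, (1 + \<eta>) l v]\<close>, which is checked by comparing with the tilts \<open>(1 \<plusminus> \<eta>) l\<close>.
\<close>

lemma block_tail_lower:
  assumes mn: "m \<le> n" and \<eta>: "0 < \<eta>" "\<eta> \<le> 1 / 2" and l: "0 < l"
    and a: "\<And>k. m \<le> k \<Longrightarrow> k < n \<Longrightarrow> 2 * l * A k \<le> \<eta>\<^sup>2 / 20"
  defines "v \<equiv> \<Sum>k = m..<n. var k"
  assumes Q: "ln 4 \<le> l\<^sup>2 * v / 2 * (3 / 5 * \<eta>\<^sup>2)"
  shows "exp (- (l\<^sup>2 * v / 2 * (1 + 3 * \<eta>))) / 2 \<le> measure U01 {x \<in> space U01. (1 - \<eta>) * l * v \<le> block m n x}"
proof -
  define q where "q = l\<^sup>2 * v / 2"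
  define W where "W = block m n"
  define E where "E c = (\<integral>x. exp (c * W x) \<partial>U01)" for c
  have q0: "0 < q"
  proof -
    have "0 < ln (4::real)" by simp
    also have "\<dots> \<le> q * (3 / 5 * \<eta>\<^sup>2)" using Q by (simp add: q_def)
    finally show ?thesis using \<eta> by (simp add: zero_less_mult_iff)
  qed
  have eta2: "\<eta>\<^sup>2 \<le> 1" using \<eta> by (simp add: power_le_one)
  have A0: "0 \<le> A k" for k using Y_bound[of k 0] by linarith
  have int: "integrable U01 (\<lambda>x. exp (c * W x))" for c unfolding W_def by (rule integrable_exp_block)
  have bounds: "exp ((c * l)\<^sup>2 * v / 2 * (1 - 2 * (\<eta>\<^sup>2 / 20))) \<le> E (c * l)" "E (c * l) \<le> exp ((c * l)\<^sup>2 * v / 2 * (1 + \<eta>\<^sup>2 / 20))"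
    if c: "0 \<le> c" "c \<le> 2" for c
  proof -
    have "c * l * A k \<le> \<eta>\<^sup>2 / 20" if "m \<le> k" "k < n" for k
    proof -
      have "c * l * A k \<le> 2 * l * A k" using c l A0 by (intro mult_right_mono) auto
      with a[OF that] show ?thesis by linarith
    qed
    then show "exp ((c * l)\<^sup>2 * v / 2 * (1 - 2 * (\<eta>\<^sup>2 / 20))) \<le> E (c * l)" "E (c * l) \<le> exp ((c * l)\<^sup>2 * v / 2 * (1 + \<eta>\<^sup>2 / 20))"
      using exp_moment_block[OF mn, of "c * l" "\<eta>\<^sup>2 / 20"] c l eta2 by (auto simp: E_def W_def v_def)
  qed
  have sc: "(c * l)\<^sup>2 * v / 2 = c\<^sup>2 * q" for c by (simp add: q_def power_mult_distrib)
  have main: "exp (q * (1 - \<eta>\<^sup>2 / 10)) \<le> E l" using bounds(1)[of 1] by (simp add: q_def)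
  \<comment> \<open>The left side dominates the part of \<open>E l\<close> that comes from W > (1 +
    \<eta>) l v, where -\<eta> l W \<le> -\<eta> (1 + \<eta>) l^2 v and l^2 v = 2 q. Its exponent is
    below the one in \<open>main\<close> by at least 3 / 5 \<eta>^2 q, which is at least ln 4 by
    hypothesis \<open>Q\<close>.\<close>
  have up: "exp (- (\<eta> * (1 + \<eta>) * (2 * q))) * E ((1 + \<eta>) * l) \<le> E l / 4"
  proof -
    have "exp (- (\<eta> * (1 + \<eta>) * (2 * q))) * E ((1 + \<eta>) * l) \<le>
        exp (- (\<eta> * (1 + \<eta>) * (2 * q))) * exp ((1 + \<eta>)\<^sup>2 * q * (1 + \<eta>\<^sup>2 / 20))"
      using bounds(2)[of "1 + \<eta>"] \<eta> by (intro mult_left_mono) (auto simp: sc)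
    also have "\<dots> = exp (q * (1 - \<eta>\<^sup>2 + (1 + \<eta>)\<^sup>2 * (\<eta>\<^sup>2 / 20)))"
      by (simp add: exp_add[symmetric] algebra_simps power2_eq_square)
    also have "\<dots> \<le> exp (q * (1 - \<eta>\<^sup>2 / 10) - ln 4)"
    proof -
      have "(1 + \<eta>)\<^sup>2 \<le> 9 / 4" using power_mono[of "1 + \<eta>" "3 / 2" 2] \<eta> by (simp add: power_divide)
      then have "(1 + \<eta>)\<^sup>2 * (\<eta>\<^sup>2 / 20) \<le> 9 / 4 * (\<eta>\<^sup>2 / 20)" by (intro mult_right_mono) auto
      then have "1 - \<eta>\<^sup>2 + (1 + \<eta>)\<^sup>2 * (\<eta>\<^sup>2 / 20) \<le> (1 - \<eta>\<^sup>2 / 10) - 3 / 5 * \<eta>\<^sup>2"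
        using zero_le_power2[of \<eta>] by linarith
      then have "q * (1 - \<eta>\<^sup>2 + (1 + \<eta>)\<^sup>2 * (\<eta>\<^sup>2 / 20)) \<le> q * ((1 - \<eta>\<^sup>2 / 10) - 3 / 5 * \<eta>\<^sup>2)"
        using q0 by (intro mult_left_mono) auto
      then show ?thesis using Q by (simp add: q_def algebra_simps)
    qed
    also have "\<dots> = exp (q * (1 - \<eta>\<^sup>2 / 10)) / 4" by (simp add: exp_diff)
    finally show ?thesis using main by simp
  qed
  \<comment> \<open>The same for the part from W < (1 - \<eta>) l v, with the tilt lowered instead
    of raised.\<close>
  have lo: "exp (\<eta> * (1 - \<eta>) * (2 * q)) * E ((1 - \<eta>) * l) \<le> E l / 4"
  proof -
    have "exp (\<eta> * (1 - \<eta>) * (2 * q)) * E ((1 - \<eta>) * l) \<le>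
        exp (\<eta> * (1 - \<eta>) * (2 * q)) * exp ((1 - \<eta>)\<^sup>2 * q * (1 + \<eta>\<^sup>2 / 20))"
      using bounds(2)[of "1 - \<eta>"] \<eta> by (intro mult_left_mono) (auto simp: sc)
    also have "\<dots> = exp (q * (1 - \<eta>\<^sup>2 + (1 - \<eta>)\<^sup>2 * (\<eta>\<^sup>2 / 20)))"
      by (simp add: exp_add[symmetric] algebra_simps power2_eq_square)
    also have "\<dots> \<le> exp (q * (1 - \<eta>\<^sup>2 / 10) - ln 4)"
    proof -
      have "(1 - \<eta>)\<^sup>2 \<le> 1" using \<eta> by (intro power_le_one) auto
      then have "(1 - \<eta>)\<^sup>2 * (\<eta>\<^sup>2 / 20) \<le> 1 * (\<eta>\<^sup>2 / 20)" by (intro mult_right_mono) auto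
      then have "1 - \<eta>\<^sup>2 + (1 - \<eta>)\<^sup>2 * (\<eta>\<^sup>2 / 20) \<le> (1 - \<eta>\<^sup>2 / 10) - 3 / 5 * \<eta>\<^sup>2"
        using zero_le_power2[of \<eta>] by linarith
      then have "q * (1 - \<eta>\<^sup>2 + (1 - \<eta>)\<^sup>2 * (\<eta>\<^sup>2 / 20)) \<le> q * ((1 - \<eta>\<^sup>2 / 10) - 3 / 5 * \<eta>\<^sup>2)"
        using q0 by (intro mult_left_mono) auto
      then show ?thesis using Q by (simp add: q_def algebra_simps)
    qed
    also have "\<dots> = exp (q * (1 - \<eta>\<^sup>2 / 10)) / 4" by (simp add: exp_diff)
    finally show ?thesis using main by simp
  qed
  define S where "S = {x \<in> space U01. (1 - \<eta>) * l * v \<le> W x}"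
  have Wm: "W \<in> borel_measurable U01" unfolding W_def by (intro borel_measurable_U01 block_meas)
  have Sm: "S \<in> sets U01" unfolding S_def using Wm by measurable
  have "E l \<le> (\<integral>x. exp ((1 + \<eta>) * (2 * q)) * indicator S x +
      (exp (- (\<eta> * (1 + \<eta>) * (2 * q))) * exp ((1 + \<eta>) * l * W x) + exp (\<eta> * (1 - \<eta>) * (2 * q)) * exp ((1 - \<eta>) * l * W x)) \<partial>U01)"
    unfolding E_def
  proof (rule integral_mono)
    fix x assume x: "x \<in> space U01"
    have lq: "l * (l * v) = 2 * q" by (simp add: q_def power2_eq_square)
    consider "W x < (1 - \<eta>) * l * v" | "(1 + \<eta>) * l * v < W x" | "(1 - \<eta>) * l * v \<le> W x" "W x \<le> (1 + \<eta>) * l * v" by linarith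
    then show "exp (l * W x) \<le> exp ((1 + \<eta>) * (2 * q)) * indicator S x +
      (exp (- (\<eta> * (1 + \<eta>) * (2 * q))) * exp ((1 + \<eta>) * l * W x) + exp (\<eta> * (1 - \<eta>) * (2 * q)) * exp ((1 - \<eta>) * l * W x))"
    proof cases
      case 1
      have "\<eta> * l * W x \<le> \<eta> * l * ((1 - \<eta>) * l * v)" using 1 \<eta> l by (intro mult_left_mono) auto
      also have "\<dots> = \<eta> * (1 - \<eta>) * (2 * q)" unfolding lq[symmetric] by simp
      finally have "exp (l * W x) \<le> exp (\<eta> * (1 - \<eta>) * (2 * q)) * exp ((1 - \<eta>) * l * W x)"
        by (simp add: exp_add[symmetric] algebra_simps)
      then show ?thesis by (simp add: add_nonneg_nonneg add_increasing)
    next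
      case 2
      have "\<eta> * l * ((1 + \<eta>) * l * v) \<le> \<eta> * l * W x" using 2 \<eta> l by (intro mult_left_mono) auto
      moreover have "\<eta> * l * ((1 + \<eta>) * l * v) = \<eta> * (1 + \<eta>) * (2 * q)" unfolding lq[symmetric] by simp
      ultimately have "exp (l * W x) \<le> exp (- (\<eta> * (1 + \<eta>) * (2 * q))) * exp ((1 + \<eta>) * l * W x)"
        by (simp add: exp_add[symmetric] algebra_simps)
      then show ?thesis by (simp add: add_increasing add_increasing2)
    next
      case 3
      have "l * W x \<le> l * ((1 + \<eta>) * l * v)" using 3 l by (intro mult_left_mono) auto
      also have "\<dots> = (1 + \<eta>) * (2 * q)" unfolding lq[symmetric] by simp
      finally have "exp (l * W x) \<le> exp ((1 + \<eta>) * (2 * q)) * indicator S x"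
        using 3 x by (simp add: S_def)
      then show ?thesis by (simp add: add_increasing2)
    qed
  qed (use int Sm in \<open>auto intro!: Bochner_Integration.integrable_add integrable_mult_right simp: U01.emeasure_eq_measure\<close>)
  also have "\<dots> = exp ((1 + \<eta>) * (2 * q)) * measure U01 S +
      (exp (- (\<eta> * (1 + \<eta>) * (2 * q))) * E ((1 + \<eta>) * l) + exp (\<eta> * (1 - \<eta>) * (2 * q)) * E ((1 - \<eta>) * l))"
  proof -
    have i1: "integrable U01 (\<lambda>x. c * indicator S x :: real)" for c
      using Sm by (intro integrable_mult_right) (simp add: U01.emeasure_eq_measure)
    have i2: "integrable U01 (\<lambda>x. c * exp (c' * W x) :: real)" for c c'
      by (intro integrable_mult_right int)
    have "S \<inter> space U01 = S" using sets.sets_into_space[OF Sm] by blast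
    then show ?thesis
      unfolding E_def Bochner_Integration.integral_add[OF i1 Bochner_Integration.integrable_add[OF i2 i2]]
        Bochner_Integration.integral_add[OF i2 i2] by (simp del: space_U01)
  qed
  also have "\<dots> \<le> exp ((1 + \<eta>) * (2 * q)) * measure U01 S + (E l / 4 + E l / 4)"
    by (intro add_mono up lo order_refl)
  \<comment> \<open>The two tails take at most half of \<open>E l\<close>; the other half lies in
    the middle range, where the density of the tilt is at most exp ((1 + \<eta>) 2 q), and this
    bounds the measure of \<open>S\<close> from below.\<close>
  finally have "E l / 2 \<le> exp ((1 + \<eta>) * (2 * q)) * measure U01 S" by simp
  with main have "exp (q * (1 - \<eta>\<^sup>2 / 10)) / 2 \<le> exp ((1 + \<eta>) * (2 * q)) * measure U01 S" by simp
  then have "exp (- ((1 + \<eta>) * (2 * q))) * (exp (q * (1 - \<eta>\<^sup>2 / 10)) / 2) \<le>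
      exp (- ((1 + \<eta>) * (2 * q))) * (exp ((1 + \<eta>) * (2 * q)) * measure U01 S)"
    by (intro mult_left_mono) auto
  also have "\<dots> = measure U01 S" by (simp add: mult.assoc[symmetric] exp_add[symmetric])
  finally have "exp (- ((1 + \<eta>) * (2 * q))) * exp (q * (1 - \<eta>\<^sup>2 / 10)) / 2 \<le> measure U01 S" by simp
  then have "exp (- ((1 + \<eta>) * (2 * q)) + q * (1 - \<eta>\<^sup>2 / 10)) / 2 \<le> measure U01 S" unfolding exp_add .
  moreover have "exp (- (q * (1 + 3 * \<eta>))) \<le> exp (- ((1 + \<eta>) * (2 * q)) + q * (1 - \<eta>\<^sup>2 / 10))"
  proof -
    have "\<eta>\<^sup>2 \<le> 1 * \<eta>" unfolding power2_eq_square using \<eta> by (intro mult_right_mono) auto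
    then have "\<eta>\<^sup>2 / 10 \<le> \<eta>" using \<eta> by simp
    then have "q * (\<eta>\<^sup>2 / 10) \<le> q * \<eta>" using q0 by (intro mult_left_mono) auto
    then show ?thesis by (simp add: algebra_simps)
  qed
  ultimately have "exp (- (q * (1 + 3 * \<eta>))) / 2 \<le> measure U01 S" by linarith
  then show ?thesis by (simp only: q_def S_def W_def)
qed

text \<open>The second Borel-Cantelli lemma: consecutive blocks use disjoint sets of digits, so the
  probability that none of several consecutive events occurs is the product of the 1 - p j, at most
  the exponential of minus a sum that diverges.\<close>

lemma block_borel_cantelli:
  fixes n :: "nat \<Rightarrow> nat" and y :: "nat \<Rightarrow> real"
  assumes n: "\<And>j. n j \<le> n (Suc j)"
  defines "p \<equiv> \<lambda>j. measure U01 {x \<in> space U01. y j \<le> block (n j) (n (Suc j)) x}"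
  assumes p: "\<not> summable p"
  shows "AE x in U01. \<exists>\<^sub>F j in sequentially. y j \<le> block (n j) (n (Suc j)) x"
proof -
  define I where "I j x = (if y j \<le> block (n j) (n (Suc j)) x then 1 else 0 :: real)" for j x
  have Im [measurable]: "I j \<in> borel_measurable borel" for j unfolding I_def by measurable
  have pI: "p j = (\<integral>x. I j x \<partial>U01)" for j
  proof -
    have "(\<integral>x. I j x \<partial>U01) = (\<integral>x. indicator {x \<in> space U01. y j \<le> block (n j) (n (Suc j)) x} x \<partial>U01)"
      by (intro Bochner_Integration.integral_cong) (auto simp: I_def)
    moreover have "{x \<in> space U01. y j \<le> block (n j) (n (Suc j)) x} \<in> sets U01"
      using borel_measurable_U01[OF block_meas] by measurable
    moreover have "(\<integral>x. indicator S x \<partial>U01) = measure U01 S" if "S \<in> sets U01" for S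
      using that sets.sets_into_space[OF that] by (simp add: Int_absorb2)
    ultimately show ?thesis by (simp add: p_def)
  qed
  have p0: "0 \<le> p j" for j by (simp add: p_def)
  have mono: "n i \<le> n j" if "i \<le> j" for i j by (rule lift_Suc_mono_le[of n, OF n that])
  have prod: "(\<integral>x. (\<Prod>j = i..<i + k. 1 - I j x) \<partial>U01) = (\<Prod>j = i..<i + k. 1 - p j)" for i k
  proof (induction k)
    case 0
    show ?case using U01.prob_space by simp
  next
    case (Suc k)
    have "(\<integral>x. (\<Prod>j = i..<i + k. 1 - I j x) * (1 - I (i + k) x) \<partial>U01) =
      (\<integral>x. (\<Prod>j = i..<i + k. 1 - I j x) \<partial>U01) * (\<integral>x. 1 - I (i + k) x \<partial>U01)"
    proof (rule integral_U01_independent[OF d1[of "n (i + k)"], where B = 1 and C = 1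
          and G = "\<lambda>x. \<Prod>j = i..<i + k. 1 - I j x" and K = "\<lambda>x. 1 - I (i + k) x"])
      show "\<bar>\<Prod>j = i..<i + k. 1 - I j x\<bar> \<le> 1" for x
        unfolding abs_prod by (intro prod_le_1) (auto simp: I_def)
      show "(\<Prod>j = i..<i + k. 1 - I j x) = (\<Prod>j = i..<i + k. 1 - I j z)"
        if "\<lfloor>real (d (n (i + k))) * x\<rfloor> = \<lfloor>real (d (n (i + k))) * z\<rfloor>" for x z
      proof (rule prod.cong[OF refl])
        fix j assume "j \<in> {i..<i + k}"
        then have "d (n (Suc j)) dvd d (n (i + k))" by (intro d_dvd' mono) auto
        from block_cell[OF floor_mult_dvd[OF this d1 that]] show "1 - I j x = 1 - I j z" by (simp add: I_def)
      qed
      show "\<bar>1 - I (i + k) x\<bar> \<le> 1" for x by (simp add: I_def)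
      show "1 - I (i + k) (x + 1 / real (d (n (i + k)))) = 1 - I (i + k) x" for x
        by (simp add: I_def block_periodic)
    qed measurable
    moreover have "(\<integral>x. 1 - I (i + k) x \<partial>U01) = 1 - p (i + k)"
    proof -
      have "integrable U01 (I (i + k))" by (rule integrable_U01[where B = 1]) (auto simp: I_def)
      then show ?thesis using U01.prob_space by (simp add: pI)
    qed
    ultimately show ?case using Suc by simp
  qed
  define N where "N i = {x \<in> space U01. \<forall>j\<ge>i. \<not> y j \<le> block (n j) (n (Suc j)) x}" for i
  have Nm: "N i \<in> sets U01" for i unfolding N_def using borel_measurable_U01[OF block_meas] by measurable
  have Nle: "measure U01 (N i) \<le> exp (- (\<Sum>j = i..<i + k. p j))" for i k
  proof -
    have "measure U01 (N i) = (\<integral>x. indicator (N i) x \<partial>U01)"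
      using sets.sets_into_space[OF Nm] by (simp add: Int_absorb2)
    also have "\<dots> \<le> (\<integral>x. (\<Prod>j = i..<i + k. 1 - I j x) \<partial>U01)"
    proof (rule integral_mono)
      show "integrable U01 (\<lambda>x. \<Prod>j = i..<i + k. 1 - I j x)"
      proof (rule integrable_U01[where B = 1])
        show "\<bar>\<Prod>j = i..<i + k. 1 - I j x\<bar> \<le> 1" for x
          unfolding abs_prod by (intro prod_le_1) (auto simp: I_def)
      qed measurable
      fix x
      show "indicator (N i) x \<le> (\<Prod>j = i..<i + k. 1 - I j x)"
      proof (cases "x \<in> N i")
        case True
        then have "(\<Prod>j = i..<i + k. 1 - I j x) = 1" by (intro prod.neutral) (auto simp: N_def I_def)
        then show ?thesis using True by simp
      next
        case False
        have "0 \<le> (\<Prod>j = i..<i + k. 1 - I j x)" by (intro prod_nonneg) (auto simp: I_def)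
        then show ?thesis using False by simp
      qed
    qed (use Nm in \<open>simp add: U01.emeasure_eq_measure\<close>)
    also have "\<dots> = (\<Prod>j = i..<i + k. 1 - p j)" by (rule prod)
    also have "\<dots> \<le> (\<Prod>j = i..<i + k. exp (- p j))"
    proof (intro prod_mono conjI)
      fix j
      show "0 \<le> 1 - p j" by (simp add: p_def)
      show "1 - p j \<le> exp (- p j)" using exp_ge_add_one_self[of "- p j"] by simp
    qed
    also have "\<dots> = exp (- (\<Sum>j = i..<i + k. p j))" by (simp add: exp_sum[symmetric] sum_negf)
    finally show ?thesis .
  qed
  have N0: "measure U01 (N i) = 0" for i
  proof (rule ccontr)
    assume "measure U01 (N i) \<noteq> 0"
    then have pos: "0 < measure U01 (N i)" using measure_nonneg[of U01 "N i"] by linarith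
    have le: "(\<Sum>j = i..<i + k. p j) \<le> - ln (measure U01 (N i))" for k
    proof -
      have "ln (measure U01 (N i)) \<le> ln (exp (- (\<Sum>j = i..<i + k. p j)))"
        using Nle[of i k] pos by (intro ln_mono) auto
      then show ?thesis by simp
    qed
    have "summable p"
    proof (rule summableI_nonneg_bounded)
      show "0 \<le> p j" for j by (rule p0)
      show "(\<Sum>j<k. p j) \<le> (\<Sum>j<i. p j) + - ln (measure U01 (N i))" for k
      proof -
        have "(\<Sum>j<k. p j) \<le> (\<Sum>j<i + k. p j)" using p0 by (intro sum_mono2) auto
        also have "\<dots> = (\<Sum>j<i. p j) + (\<Sum>j = i..<i + k. p j)"
          unfolding lessThan_atLeast0 by (rule sum.atLeastLessThan_concat[symmetric]) auto
        finally show ?thesis using le[of k] by linarith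
      qed
    qed
    with p show False by contradiction
  qed
  have "AE x in U01. \<forall>i. x \<notin> N i"
    using N0 Nm by (subst AE_all_countable) (auto intro!: AE_not_in simp: null_sets_def U01.emeasure_eq_measure)
  then show ?thesis
    using AE_space
  proof eventually_elim
    case (elim x)
    then show ?case by (auto simp: N_def frequently_sequentially)
  qed
qed

end

subsection \<open>Lower bounds\<close>

text \<open>(Re b)^2 = (|b|^2 + Re b^2) / 2, and the analytic function b^2 has mean b(0)^2 = 0. This
  is the origin of the factor 1 / 2 between mean squares of \<open>b\<close> and variances of digit
  functions.\<close>

lemma bloch_circle_Re:
  fixes b :: "complex \<Rightarrow> complex"
  assumes b: "b \<in> bloch_unit_ball" "b 0 = 0" and r: "0 \<le> r" "r < 1"
  shows "circle_mean r (\<lambda>z. Re (b z)) = 0"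
    and "circle_mean r (\<lambda>z. (Re (b z))\<^sup>2) = circle_mean r (\<lambda>z. (cmod (b z))\<^sup>2) / 2"
proof -
  note h = bloch_unit_ball_holomorphic[OF b(1)] and c = bloch_unit_ball_continuous[OF b(1)]
  show "circle_mean r (\<lambda>z. Re (b z)) = 0"
    using circle_mean_Re[OF c r] circle_mean_holomorphic[OF h r] b(2) by simp
  have h2: "(\<lambda>z. (b z)\<^sup>2) holomorphic_on ball 0 1" by (intro holomorphic_intros h)
  note c2 = holomorphic_on_imp_continuous_on[OF h2]
  have "(Re w)\<^sup>2 = 1 / 2 * ((cmod w)\<^sup>2 + Re (w\<^sup>2))" for w
    unfolding cmod_power2 by (simp add: power2_eq_square)
  then have "circle_mean r (\<lambda>z. (Re (b z))\<^sup>2) = circle_mean r (\<lambda>z. 1 / 2 * ((cmod (b z))\<^sup>2 + Re ((b z)\<^sup>2)))"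
    by (simp only:)
  also have "\<dots> = 1 / 2 * (circle_mean r (\<lambda>z. (cmod (b z))\<^sup>2) + circle_mean r (\<lambda>z. Re ((b z)\<^sup>2)))"
    unfolding circle_mean_cmult using r by (subst circle_mean_add) (auto intro!: continuous_intros c c2)
  also have "circle_mean r (\<lambda>z. Re ((b z)\<^sup>2)) = 0"
    using circle_mean_Re[OF c2 r] circle_mean_holomorphic[OF h2 r] b(2) by simp
  finally show "circle_mean r (\<lambda>z. (Re (b z))\<^sup>2) = circle_mean r (\<lambda>z. (cmod (b z))\<^sup>2) / 2" by simp
qed

text \<open>\<open>Y k\<close> is the real part of the k-th lacunary term on the circle, rounded to
  cells of length 1 / d (k + 1) and recentred. The Lipschitz constant 2 \<pi> exp (T k) of the
  unscaled function and the mesh 1 / D k make rounding cost \<delta> k / 2; recentring costs another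
  \<delta> k / 2.\<close>

lemma digit_process_bloch:
  fixes T :: "nat \<Rightarrow> real" and b :: "nat \<Rightarrow> complex \<Rightarrow> complex" and D d :: "nat \<Rightarrow> nat"
  assumes \<eta>: "0 < \<eta>" and T: "\<And>k. 0 \<le> T k" and b: "\<And>k. b k \<in> bloch_unit_ball" "\<And>k. b k 0 = 0"
    and D: "\<And>k. (2 + 64 / \<eta>\<^sup>2) * exp (T k) \<le> D k" and d: "\<And>n. d n = (\<Prod>k<n. D k)"
  defines "\<delta> \<equiv> \<lambda>k. 4 * pi * exp (T k) / D k"
  obtains B Y where "B \<in> bloch_unit_ball" "B 0 = 0" "digit_process d Y (\<lambda>k. T k + 1)"
    "\<And>k. circle_mean (hyp_radius (T k)) (\<lambda>z. (cmod (b k z))\<^sup>2) / 2 - (T k + 1) * \<delta> k \<le> (\<integral>x. (Y k x)\<^sup>2 \<partial>U01)"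
    "\<And>n x. 1 \<le> n \<Longrightarrow> \<bar>(1 + 3 * \<eta>) * Re (B (of_real (1 - 1 / real (d n)) * cis (2 * pi * x))) - (\<Sum>k<n. Y k x)\<bar>
       \<le> 3 + (\<Sum>k<n. \<delta> k)"
proof -
  obtain B where B: "B \<in> bloch_unit_ball" "B 0 = 0"
    "\<And>n u. 1 \<le> n \<Longrightarrow> cmod u = 1 \<Longrightarrow>
      cmod (of_real (1 + 3 * \<eta>) * B (of_real (1 - 1 / real (d n)) * u) - (\<Sum>k<n. b k (of_real (hyp_radius (T k)) * u ^ d k))) \<le> 3"
    by (rule lacunary_bloch[where b = b and T = T and D = D and d = d, OF \<eta> T b D d]) blast
  define h where "h k x = Re (b k (of_real (hyp_radius (T k)) * cis (2 * pi * x)))" for k and x :: real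
  note \<rho> = hyp_radius(1)[OF T] hyp_radius(2)
  have D1: "1 \<le> D k" for k
  proof -
    have "1 * 1 \<le> (2 + 64 / \<eta>\<^sup>2) * exp (T k)" using T[of k] by (intro mult_mono) (auto simp: add_increasing2)
    with D[of k] have "1 \<le> real (D k)" by linarith
    then show ?thesis by simp
  qed
  have dSuc: "d (Suc k) = d k * D k" for k by (simp add: d)
  have d1: "1 \<le> d k" for k unfolding d using D1 by (simp add: prod_pos Suc_le_eq)
  have hc: "continuous_on UNIV (h k)" for k
    unfolding h_def by (intro continuous_intros continuous_on_circle bloch_unit_ball_continuous b \<rho>)
  have hm [measurable]: "h k \<in> borel_measurable borel" for k by (rule borel_measurable_continuous_onI[OF hc])
  have hp: "h k (x + of_int i) = h k x" for k x i unfolding h_def by (simp only: cis_2pi_periodic)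
  have hb: "\<bar>h k x\<bar> \<le> (T k + 1) / 2" for k x
  proof -
    have "\<bar>h k x\<bar> \<le> cmod (b k (of_real (hyp_radius (T k)) * cis (2 * pi * x)) - b k 0)"
      unfolding h_def b(2) by (simp add: abs_Re_le_cmod)
    also have "\<dots> \<le> (T k + 1) / 2"
      by (rule bloch_growth_hyp_radius[OF b(1) T]) (use \<rho> in \<open>simp add: norm_mult\<close>)
    finally show ?thesis .
  qed
  have hl: "\<bar>h k x - h k y\<bar> \<le> 2 * pi * exp (T k) * \<bar>x - y\<bar>" for k x y
  proof -
    have "\<bar>h k x - h k y\<bar> \<le> cmod (b k (of_real (hyp_radius (T k)) * cis (2 * pi * x)) - b k (of_real (hyp_radius (T k)) * cis (2 * pi * y)))"
      unfolding h_def minus_complex.sel(1)[symmetric] by (rule abs_Re_le_cmod)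
    also have "\<dots> \<le> 2 * pi * \<bar>x - y\<bar> / (1 - hyp_radius (T k))" by (rule bloch_arc_lipschitz[OF b(1) \<rho>])
    also have "\<dots> = 2 * pi * exp (T k) * \<bar>x - y\<bar>" by (simp add: hyp_radius_def exp_minus field_simps)
    finally show ?thesis .
  qed
  have h0: "(\<integral>x. h k x \<partial>U01) = 0" for k
    unfolding integral_U01_continuous[OF hc]
    using bloch_circle_Re(1)[OF b(1)[of k] b(2)[of k] hyp_radius(1)[OF T[of k]] hyp_radius(2)]
    by (simp add: h_def[abs_def] circle_mean_def)
  have h2: "(\<integral>x. (h k x)\<^sup>2 \<partial>U01) = circle_mean (hyp_radius (T k)) (\<lambda>z. (cmod (b k z))\<^sup>2) / 2" for k
  proof -
    have "continuous_on UNIV (\<lambda>x. (h k x)\<^sup>2)" by (intro continuous_intros hc)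
    from integral_U01_continuous[OF this] show ?thesis
      using bloch_circle_Re(2)[OF b(1)[of k] b(2)[of k] hyp_radius(1)[OF T[of k]] hyp_radius(2)]
      by (simp add: h_def[abs_def] circle_mean_def)
  qed
  have sc: "(\<integral>x. h k (real (d k) * x) \<partial>U01) = 0" "(\<integral>x. (h k (real (d k) * x))\<^sup>2 \<partial>U01) = (\<integral>x. (h k x)\<^sup>2 \<partial>U01)" for k
  proof -
    show "(\<integral>x. h k (real (d k) * x) \<partial>U01) = 0"
      using integral_U01_scale[where H = "h k", OF d1[of k] hm hb] hp[of k _ 1] h0 by simp
    have "\<bar>(h k x)\<^sup>2\<bar> \<le> ((T k + 1) / 2)\<^sup>2" for x
      using power_mono[OF hb[of k x] abs_ge_zero, of 2] by simp
    from integral_U01_scale[where H = "\<lambda>x. (h k x)\<^sup>2", OF d1[of k] _ this]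
    show "(\<integral>x. (h k (real (d k) * x))\<^sup>2 \<partial>U01) = (\<integral>x. (h k x)\<^sup>2 \<partial>U01)"
      using hp[of k _ 1] by simp
  qed
  \<comment> \<open>The argument d k x is rounded down to a multiple of 1 / D k. The period 1 / d k
    survives, because a shift by it moves the rounded argument by exactly 1, a period of
    \<open>h k\<close>.\<close>
  define Z where "Z k x = h k (of_int \<lfloor>real (d (Suc k)) * x\<rfloor> / D k)" for k x
  have Zm [measurable]: "Z k \<in> borel_measurable borel" for k unfolding Z_def by measurable
  have Zh: "\<bar>Z k x - h k (real (d k) * x)\<bar> \<le> \<delta> k / 2" for k x
  proof -
    have D0: "0 < real (D k)" using D1[of k] by simp
    have "\<bar>of_int \<lfloor>real (d (Suc k)) * x\<rfloor> - real (d (Suc k)) * x\<bar> \<le> 1" by linarith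
    then have "\<bar>of_int \<lfloor>real (d (Suc k)) * x\<rfloor> - real (d (Suc k)) * x\<bar> / D k \<le> 1 / D k"
      using D0 by (intro divide_right_mono) auto
    also have "\<bar>of_int \<lfloor>real (d (Suc k)) * x\<rfloor> - real (d (Suc k)) * x\<bar> / D k =
        \<bar>of_int \<lfloor>real (d (Suc k)) * x\<rfloor> / D k - real (d k) * x\<bar>"
    proof -
      have "of_int \<lfloor>real (d (Suc k)) * x\<rfloor> / D k - real (d k) * x = (of_int \<lfloor>real (d (Suc k)) * x\<rfloor> - real (d (Suc k)) * x) / D k"
        using D0 by (simp add: dSuc field_simps)
      then show ?thesis using D0 by simp
    qed
    finally have le: "\<bar>of_int \<lfloor>real (d (Suc k)) * x\<rfloor> / D k - real (d k) * x\<bar> \<le> 1 / D k" .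
    have "\<bar>Z k x - h k (real (d k) * x)\<bar> \<le> 2 * pi * exp (T k) * \<bar>of_int \<lfloor>real (d (Suc k)) * x\<rfloor> / D k - real (d k) * x\<bar>"
      unfolding Z_def by (rule hl)
    also have "\<dots> \<le> 2 * pi * exp (T k) * (1 / D k)" by (intro mult_left_mono le) auto
    finally show ?thesis by (simp add: \<delta>_def)
  qed
  have iZ: "integrable U01 (Z k)" for k
    by (rule integrable_U01[OF Zm, of _ "(T k + 1) / 2"]) (unfold Z_def, rule hb)
  have ih: "integrable U01 (\<lambda>x. h k (real (d k) * x))" for k
    by (rule integrable_U01[where B = "(T k + 1) / 2"]) (use hb in auto)
  define m where "m k = (\<integral>x. Z k x \<partial>U01)" for k
  have mb: "\<bar>m k\<bar> \<le> \<delta> k / 2" "\<bar>m k\<bar> \<le> (T k + 1) / 2" for k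
  proof -
    have const: "\<bar>\<integral>x. f x \<partial>U01\<bar> \<le> c" if "integrable U01 f" "\<And>x. \<bar>f x\<bar> \<le> c" for f :: "real \<Rightarrow> real" and c
    proof -
      have "\<bar>\<integral>x. f x \<partial>U01\<bar> \<le> (\<integral>x. \<bar>f x\<bar> \<partial>U01)" using integral_abs_bound by blast
      also have "\<dots> \<le> (\<integral>x. c \<partial>U01)" using that by (intro integral_mono) auto
      finally show ?thesis using U01.prob_space by simp
    qed
    show "\<bar>m k\<bar> \<le> (T k + 1) / 2" unfolding m_def by (intro const iZ) (unfold Z_def, rule hb)
    have "m k = (\<integral>x. Z k x - h k (real (d k) * x) \<partial>U01)" using iZ ih sc by (simp add: m_def)
    also have "\<bar>\<dots>\<bar> \<le> \<delta> k / 2" by (rule const) (use iZ ih Zh in auto)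
    finally show "\<bar>m k\<bar> \<le> \<delta> k / 2" .
  qed
  define Y where "Y k x = Z k x - m k" for k x
  have Yb: "\<bar>Y k x\<bar> \<le> T k + 1" for k x
  proof -
    have "\<bar>a - c\<bar> \<le> e" if "\<bar>a\<bar> \<le> e / 2" "\<bar>c\<bar> \<le> e / 2" for a c e :: real using that by linarith
    then show ?thesis unfolding Y_def Z_def using mb(2) hb by blast
  qed
  have Yh: "\<bar>Y k x - h k (real (d k) * x)\<bar> \<le> \<delta> k" for k x
    using mb(1)[of k] Zh[of k x] unfolding Y_def by linarith
  have Ym: "Y k \<in> borel_measurable borel" for k unfolding Y_def by measurable
  show ?thesis
  proof (rule that[of B Y])
    show "digit_process d Y (\<lambda>k. T k + 1)"
    proof
      fix k
      show "1 \<le> d k" by (rule d1)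
      show "d k dvd d (Suc k)" by (simp add: dSuc)
      show "Y k \<in> borel_measurable borel" by (rule Ym)
      show "(\<integral>x. Y k x \<partial>U01) = 0" using iZ[of k] U01.prob_space by (simp add: Y_def m_def)
      fix x y :: real
      show "\<bar>Y k x\<bar> \<le> T k + 1" by (rule Yb)
      show "Y k (x + 1 / real (d k)) = Y k x"
      proof -
        have "real (d (Suc k)) * (x + 1 / real (d k)) = real (d (Suc k)) * x + of_int (int (D k))"
          using d1[of k] by (simp add: dSuc distrib_left)
        then have "of_int \<lfloor>real (d (Suc k)) * (x + 1 / real (d k))\<rfloor> / real (D k) = of_int \<lfloor>real (d (Suc k)) * x\<rfloor> / real (D k) + of_int 1"
          using D1[of k] by (simp only: floor_add_int[symmetric] of_int_add) (simp add: add_divide_distrib)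
        then show ?thesis unfolding Y_def Z_def by (simp only: hp)
      qed
      show "Y k x = Y k y" if "\<lfloor>real (d (Suc k)) * x\<rfloor> = \<lfloor>real (d (Suc k)) * y\<rfloor>"
        unfolding Y_def Z_def that ..
    qed
    fix k
    show "circle_mean (hyp_radius (T k)) (\<lambda>z. (cmod (b k z))\<^sup>2) / 2 - (T k + 1) * \<delta> k \<le> (\<integral>x. (Y k x)\<^sup>2 \<partial>U01)"
    proof -
      have \<delta>0: "0 \<le> \<delta> k" by (simp add: \<delta>_def)
      have i1: "integrable U01 (\<lambda>x. (Y k x)\<^sup>2)"
      proof (rule integrable_U01[where B = "(T k + 1)\<^sup>2"])
        show "\<bar>(Y k x)\<^sup>2\<bar> \<le> (T k + 1)\<^sup>2" for x using power_mono[OF Yb[of k x] abs_ge_zero, of 2] by simp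
      qed (use Ym in measurable)
      have i2: "integrable U01 (\<lambda>x. (h k (real (d k) * x))\<^sup>2)"
      proof (rule integrable_U01[where B = "((T k + 1) / 2)\<^sup>2"])
        show "\<bar>(h k (real (d k) * x))\<^sup>2\<bar> \<le> ((T k + 1) / 2)\<^sup>2" for x
          using power_mono[OF hb[of k "real (d k) * x"] abs_ge_zero, of 2] by simp
      qed measurable
      have "circle_mean (hyp_radius (T k)) (\<lambda>z. (cmod (b k z))\<^sup>2) / 2 - (T k + 1) * \<delta> k = (\<integral>x. (h k (real (d k) * x))\<^sup>2 - (T k + 1) * \<delta> k \<partial>U01)"
        using i2 U01.prob_space by (simp add: sc h2)
      also have "\<dots> \<le> (\<integral>x. (Y k x)\<^sup>2 \<partial>U01)"
      proof (rule integral_mono)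
        fix x
        \<comment> \<open>Only the cross term can lower the second moment; as 2 |a| \<le> T k + 1,
          it does so by at most \<open>(T k + 1) * \<delta> k\<close>.\<close>
        define a where "a = h k (real (d k) * x)"
        have "2 * (- a) * (Y k x - a) \<le> \<bar>2 * (- a) * (Y k x - a)\<bar>" by (rule abs_ge_self)
        also have "\<dots> = (2 * \<bar>a\<bar>) * \<bar>Y k x - a\<bar>" by (simp add: abs_mult)
        also have "\<dots> \<le> (T k + 1) * \<delta> k"
          using hb[of k "real (d k) * x"] Yh[of k x] T[of k] by (intro mult_mono) (auto simp: a_def)
        finally have "2 * (- a) * (Y k x - a) \<le> (T k + 1) * \<delta> k" .
        moreover have "(Y k x)\<^sup>2 = a\<^sup>2 + 2 * a * (Y k x - a) + (Y k x - a)\<^sup>2" by (simp add: power2_eq_square algebra_simps)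
        ultimately show "(h k (real (d k) * x))\<^sup>2 - (T k + 1) * \<delta> k \<le> (Y k x)\<^sup>2"
          using zero_le_power2[of "Y k x - a"] unfolding a_def[symmetric] mult_minus_left mult_minus_right by linarith
      qed (use i1 i2 in auto)
      finally show ?thesis .
    qed
  next
    fix n :: nat and x :: real assume n: "1 \<le> n"
    define u where "u = cis (2 * pi * x)"
    have "Re (b k (of_real (hyp_radius (T k)) * u ^ d k)) = h k (real (d k) * x)" for k
      by (simp add: h_def u_def Complex.DeMoivre mult_ac)
    then have "(1 + 3 * \<eta>) * Re (B (of_real (1 - 1 / real (d n)) * u)) - (\<Sum>k<n. h k (real (d k) * x)) =
      Re (of_real (1 + 3 * \<eta>) * B (of_real (1 - 1 / real (d n)) * u) - (\<Sum>k<n. b k (of_real (hyp_radius (T k)) * u ^ d k)))"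
      by (simp only: minus_complex.sel Re_sum Re_complex_of_real times_complex.sel Im_complex_of_real)
    also have "\<bar>\<dots>\<bar> \<le> 3"
      using abs_Re_le_cmod B(3)[OF n, of u] by (smt (verit) norm_cis u_def)
    finally have "\<bar>(1 + 3 * \<eta>) * Re (B (of_real (1 - 1 / real (d n)) * u)) - (\<Sum>k<n. h k (real (d k) * x))\<bar> \<le> 3" .
    moreover have "\<bar>(\<Sum>k<n. h k (real (d k) * x)) - (\<Sum>k<n. Y k x)\<bar> \<le> (\<Sum>k<n. \<delta> k)"
      unfolding sum_subtractf[symmetric] using Yh
      by (intro order_trans[OF sum_abs] sum_mono) (simp add: abs_minus_commute)
    ultimately show "\<bar>(1 + 3 * \<eta>) * Re (B (of_real (1 - 1 / real (d n)) * cis (2 * pi * x))) - (\<Sum>k<n. Y k x)\<bar> \<le> 3 + (\<Sum>k<n. \<delta> k)"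
      unfolding u_def by linarith
  qed (use B in auto)
qed

lemma Limsup_ge_along_sequence:
  fixes f :: "real \<Rightarrow> real"
  assumes r: "filterlim r F sequentially" and le: "\<forall>\<^sub>F n in sequentially. g n \<le> f (r n)" and g: "g \<longlonglongrightarrow> c"
  shows "ereal c \<le> Limsup F (\<lambda>x. ereal (f x))"
proof (rule ccontr)
  assume "\<not> ereal c \<le> Limsup F (\<lambda>x. ereal (f x))"
  then have "Limsup F (\<lambda>x. ereal (f x)) < ereal c" by (simp add: not_le)
  from dense[OF this] obtain y where y: "Limsup F (\<lambda>x. ereal (f x)) < y" "y < ereal c" by blast
  have "\<forall>\<^sub>F n in sequentially. ereal (f (r n)) < y"
    using eventually_compose_filterlim[OF Limsup_lessD[OF y(1)] r] .
  moreover have "\<forall>\<^sub>F n in sequentially. y < ereal (g n)"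
    using y(2) g by (intro order_tendstoD(1)[where y = "ereal c"]) auto
  ultimately have "\<forall>\<^sub>F n in sequentially. False"
    using le
  proof eventually_elim
    case (elim n)
    then have "ereal (g n) \<le> ereal (f (r n))" by simp
    with elim show ?case by (meson leD less_trans order_less_le_trans)
  qed
  then show False by simp
qed

lemma filterlim_radii:
  fixes d :: "nat \<Rightarrow> nat"
  assumes d: "\<And>n. n < d n"
  shows "filterlim (\<lambda>n. 1 - 1 / real (d n)) (at_left 1) sequentially"
proof -
  have "filterlim (\<lambda>n. real (d n)) at_top sequentially"
    by (rule filterlim_at_top_mono[OF filterlim_real_sequentially]) (use d in \<open>auto intro!: always_eventually less_imp_le\<close>)
  then have "(\<lambda>n. 1 - 1 / real (d n)) \<longlonglongrightarrow> 1 - 0"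
    by (intro tendsto_diff tendsto_const tendsto_divide_0[OF tendsto_const] filterlim_at_top_imp_at_infinity)
  moreover have "0 < d n" for n using d[of n] by simp
  ultimately show ?thesis by (auto simp: filterlim_at)
qed

text \<open>The test function may depend on \<tau>, since the supremum is taken before the limit.
  Its blocks have constant size 1 / sqrt \<theta> with \<theta> = |\<tau>| / (1 + 3 \<eta>): as
  \<tau> tends to 0 this size tends to infinity, so that \<open>bloch_osc t / t\<close> exceeds
  \<open>c1\<close>, while its product with \<theta> tends to 0, so that the quadratic expansion of
  exponential moments applies.\<close>

lemma integral_means_spectrum_lower:
  assumes c: "0 < c" "c < bloch_variance"
  obtains \<tau>0 where "0 < \<tau>0"
    "\<And>\<tau>. \<lbrakk>\<tau> \<noteq> 0; cmod \<tau> < \<tau>0\<rbrakk> \<Longrightarrow> \<exists>b\<in>bloch_unit_ball. ereal ((cmod \<tau>)\<^sup>2 / 4 * c) \<le> integral_means_spectrum b \<tau>"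
proof -
  define c1 where "c1 = (c + bloch_variance) / 2"
  have c1: "c < c1" "c1 < bloch_variance" "0 < c1" using c by (auto simp: c1_def)
  have "((\<lambda>\<eta>. (1 + 3 * \<eta>)\<^sup>2 * c) \<longlongrightarrow> (1 + 3 * 0)\<^sup>2 * c) (at_right 0)" by (intro tendsto_intros)
  then have "\<forall>\<^sub>F \<eta> in at_right 0. (1 + 3 * \<eta>)\<^sup>2 * c < c1" using c1 by (intro order_tendstoD(2)) auto
  then obtain \<eta>1 where \<eta>1: "0 < \<eta>1" "\<And>x. 0 < x \<Longrightarrow> x < \<eta>1 \<Longrightarrow> (1 + 3 * x)\<^sup>2 * c < c1"
    unfolding eventually_at_right_field by auto
  define \<eta> where "\<eta> = \<eta>1 / 2"
  have \<eta>: "0 < \<eta>" "(1 + 3 * \<eta>)\<^sup>2 * c < c1" using \<eta>1(1) \<eta>1(2)[of "\<eta>1 / 2"] by (auto simp: \<eta>_def)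
  define M where "M = 2 + 64 / \<eta>\<^sup>2"
  have M: "2 \<le> M" by (simp add: M_def)
  \<comment> \<open>The lower bound obtained below for the spectrum, divided by \<theta>^2: the
    exponent gained per block over a bound for ln D, with t = 1 / sqrt \<theta>, with
    \<open>w\<close> bounding the block variance and 4 \<pi> accounting for the rounding. As ln (1 /
    \<theta>) is negligible against t, the limit is c1 / 4.\<close>
  define f where "f \<theta> = ((c1 * (1 / sqrt \<theta>) / 2 - (1 / sqrt \<theta> + 1) * (4 * pi * \<theta>)) / 2 * (1 - 2 * (\<theta> * (1 / sqrt \<theta> + 1))) - 4 * pi)
     / (1 / sqrt \<theta> + ln (2 * M / \<theta>))" for \<theta> :: real
  have "(f \<longlongrightarrow> c1 / 4) (at_right 0)" unfolding f_def using M c1 by real_asymp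
  then have 1: "\<forall>\<^sub>F \<theta> in at_right 0. (1 + 3 * \<eta>)\<^sup>2 * c / 4 < f \<theta>" using \<eta> by (intro order_tendstoD(1)) auto
  have T: "filterlim (\<lambda>\<theta>. 1 / sqrt \<theta>) at_top (at_right (0::real))" by real_asymp
  have 2: "\<forall>\<^sub>F \<theta> in at_right 0. c1 < bloch_osc (1 / sqrt \<theta>) / (1 / sqrt \<theta>)"
    by (rule eventually_compose_filterlim[OF order_tendstoD(1)[OF bloch_variance_tendsto c1(2)] T])
  have "((\<lambda>\<theta>. \<theta> * (1 / sqrt \<theta> + 1)) \<longlongrightarrow> 0) (at_right (0::real))" by real_asymp
  then have 3: "\<forall>\<^sub>F \<theta> in at_right (0::real). \<theta> * (1 / sqrt \<theta> + 1) < 1 / 2" by (intro order_tendstoD(2)) auto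
  have 4: "\<forall>\<^sub>F \<theta> in at_right (0::real). \<theta> < 1" unfolding eventually_at_right_field by (auto intro: exI[of _ 1])
  from 1 2 3 4 have "\<forall>\<^sub>F \<theta> in at_right 0. (1 + 3 * \<eta>)\<^sup>2 * c / 4 < f \<theta> \<and> c1 < bloch_osc (1 / sqrt \<theta>) / (1 / sqrt \<theta>) \<and>
      \<theta> * (1 / sqrt \<theta> + 1) < 1 / 2 \<and> \<theta> < 1" by eventually_elim auto
  then obtain \<theta>0 where \<theta>0: "0 < \<theta>0" "\<And>\<theta>. 0 < \<theta> \<Longrightarrow> \<theta> < \<theta>0 \<Longrightarrow> (1 + 3 * \<eta>)\<^sup>2 * c / 4 < f \<theta> \<and>
      c1 < bloch_osc (1 / sqrt \<theta>) / (1 / sqrt \<theta>) \<and> \<theta> * (1 / sqrt \<theta> + 1) < 1 / 2 \<and> \<theta> < 1"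
    unfolding eventually_at_right_field by auto
  show ?thesis
  proof (rule that[of "\<theta>0 * (1 + 3 * \<eta>)"])
    show "0 < \<theta>0 * (1 + 3 * \<eta>)" using \<theta>0 \<eta> by simp
    fix \<tau> :: complex assume \<tau>: "\<tau> \<noteq> 0" "cmod \<tau> < \<theta>0 * (1 + 3 * \<eta>)"
    define \<theta> where "\<theta> = cmod \<tau> / (1 + 3 * \<eta>)"
    have \<theta>: "0 < \<theta>" "\<theta> < \<theta>0" "cmod \<tau> = \<theta> * (1 + 3 * \<eta>)" using \<tau> \<eta> by (auto simp: \<theta>_def field_simps)
    define t where "t = 1 / sqrt \<theta>"
    have t0: "0 < t" using \<theta> by (simp add: t_def)
    have hyp: "(1 + 3 * \<eta>)\<^sup>2 * c / 4 < f \<theta>" "c1 * t < bloch_osc t" "\<theta> * (t + 1) < 1 / 2" "\<theta> < 1"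
      using \<theta>0(2)[OF \<theta>(1,2)] t0 unfolding t_def[symmetric] by (auto simp: field_simps)
    obtain \<beta> where \<beta>: "\<beta> \<in> bloch_unit_ball" "\<beta> 0 = 0" "c1 * t < circle_mean (hyp_radius t) (\<lambda>z. (cmod (\<beta> z))\<^sup>2)"
      using bloch_osc_lower[OF hyp(2)] t0 by auto
    \<comment> \<open>The factor 1 / \<theta> lowers the rounding error per block to 4 \<pi>
      \<theta>, so its effect on the exponent is of order \<theta>^2, small against the gain of
      order \<theta>^2 t; the price in ln D is only ln (1 / \<theta>).\<close>
    define D where "D = nat \<lceil>M / \<theta> * exp t\<rceil>"
    have Mt: "2 \<le> M / \<theta> * exp t"
    proof -
      have "2 * 1 \<le> M / \<theta> * exp t"
      proof (intro mult_mono)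
        have "M * 1 \<le> M / \<theta>" using M \<theta> hyp(4) by (simp add: field_simps)
        with M show "2 \<le> M / \<theta>" by simp
      qed (use t0 M \<theta> in auto)
      then show ?thesis by simp
    qed
    have D: "M / \<theta> * exp t \<le> D" "D \<le> M / \<theta> * exp t + 1" using Mt by (auto simp: D_def of_nat_ceiling)
    have D2: "2 \<le> real D" using D(1) Mt by linarith
    have MD: "M * exp t \<le> D"
    proof -
      have "M * exp t \<le> M / \<theta> * exp t" using M \<theta> hyp(4) by (intro mult_right_mono) (auto simp: field_simps)
      with D(1) show ?thesis by linarith
    qed
    define d where "d n = (\<Prod>k<n. D)" for n :: nat
    have dD: "d n = D ^ n" for n by (simp add: d_def)
    define \<delta> where "\<delta> = 4 * pi * exp t / D"
    have \<delta>: "0 \<le> \<delta>" "\<delta> \<le> 4 * pi * \<theta>"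
    proof -
      have "1 * exp t \<le> M * exp t" using M by (intro mult_right_mono) auto
      also have "\<dots> \<le> \<theta> * D" using D(1) \<theta>(1) by (simp add: field_simps)
      finally have "exp t \<le> \<theta> * D" by simp
      then have "4 * pi * exp t \<le> 4 * pi * (\<theta> * D)" by (intro mult_left_mono) auto
      then show "0 \<le> \<delta>" "\<delta> \<le> 4 * pi * \<theta>" using D2 by (auto simp: \<delta>_def field_simps)
    qed
    obtain B Y where B: "B \<in> bloch_unit_ball" "B 0 = 0" and P: "digit_process d Y (\<lambda>k. t + 1)"
      and Yvar: "\<And>k. circle_mean (hyp_radius t) (\<lambda>z. (cmod (\<beta> z))\<^sup>2) / 2 - (t + 1) * (4 * pi * exp t / D) \<le> (\<integral>x. (Y k x)\<^sup>2 \<partial>U01)"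
      and BY: "\<And>n x. 1 \<le> n \<Longrightarrow> \<bar>(1 + 3 * \<eta>) * Re (B (of_real (1 - 1 / real (d n)) * cis (2 * pi * x))) - (\<Sum>k<n. Y k x)\<bar>
         \<le> 3 + (\<Sum>k<n. 4 * pi * exp t / D)"
      by (rule digit_process_bloch[where T = "\<lambda>_. t" and b = "\<lambda>_. \<beta>" and D = "\<lambda>_. D" and d = d and \<eta> = \<eta>])
         (use \<eta> t0 \<beta> MD in \<open>auto simp: d_def M_def\<close>)
    interpret P: digit_process d Y "\<lambda>k. t + 1" by (fact P)
    define w where "w = c1 * t / 2 - (t + 1) * (4 * pi * \<theta>)"
    have w: "w \<le> P.var k" for k
    proof -
      have "(t + 1) * \<delta> \<le> (t + 1) * (4 * pi * \<theta>)" using \<delta> t0 by (intro mult_left_mono) auto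
      then show ?thesis using Yvar[of k] \<beta>(3) by (simp add: w_def P.var_def \<delta>_def)
    qed
    define a where "a = \<theta> * (t + 1)"
    have a: "0 \<le> a" "a < 1 / 2" using hyp(3) \<theta> t0 by (auto simp: a_def)
    define k1 where "k1 = \<theta>\<^sup>2 * w / 2 * (1 - 2 * a)"
    have mom: "exp (n * k1) \<le> (\<integral>x. exp (\<theta> * P.block 0 n x) \<partial>U01)" for n :: nat
    proof -
      have "n * w \<le> (\<Sum>k = 0..<n. P.var k)" using sum_mono[of "{0..<n}" "\<lambda>_. w" P.var] w by simp
      then have "\<theta>\<^sup>2 * (n * w) / 2 * (1 - 2 * a) \<le> \<theta>\<^sup>2 * (\<Sum>k = 0..<n. P.var k) / 2 * (1 - 2 * a)"
        using a by (intro mult_right_mono divide_right_mono mult_left_mono) auto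
      then have "exp (n * k1) \<le> exp (\<theta>\<^sup>2 * (\<Sum>k = 0..<n. P.var k) / 2 * (1 - 2 * a))"
        by (simp add: k1_def mult_ac)
      also have "\<dots> \<le> (\<integral>x. exp (\<theta> * P.block 0 n x) \<partial>U01)"
        using P.exp_moment_block(1)[of 0 n \<theta> a] \<theta> a by (simp add: a_def)
      finally show ?thesis .
    qed
    \<comment> \<open>Rotating the values of \<open>B\<close> makes \<tau> b = |\<tau>| B, so that
      only Re B matters for every direction of \<tau>.\<close>
    define \<alpha> where "\<alpha> = cnj (sgn \<tau>)"
    have \<alpha>: "cmod \<alpha> = 1" using \<tau> by (simp add: \<alpha>_def norm_sgn)
    have \<tau>\<alpha>: "\<tau> * \<alpha> = of_real (cmod \<tau>)"
    proof -
      have "\<tau> * cnj \<tau> = of_real ((cmod \<tau>)\<^sup>2)" by (rule complex_norm_square[symmetric])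
      then show ?thesis using \<tau> by (simp add: \<alpha>_def sgn_div_norm scaleR_conv_of_real power2_eq_square field_simps)
    qed
    define b where "b z = \<alpha> * B z" for z
    have b: "b \<in> bloch_unit_ball" unfolding b_def by (rule bloch_unit_ball_mult[OF B(1)]) (simp add: \<alpha>)
    have be: "cmod (exp (\<tau> * b z)) = exp (cmod \<tau> * Re (B z))" for z
      unfolding b_def mult.assoc[symmetric] \<tau>\<alpha> by (simp add: norm_exp_eq_Re)
    define r where "r n = 1 - 1 / real (d n)" for n
    have dn: "n < d n" for n
    proof -
      have "n < 2 ^ n" by (rule less_exp)
      also have "2 ^ n \<le> D ^ n" using D2 by (intro power_mono) auto
      finally show ?thesis by (simp add: dD)
    qed
    have rn: "1 / 2 \<le> r n" "r n < 1" if "1 \<le> n" for n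
    proof -
      have "2 \<le> d n" using dn[of n] that by simp
      then have "2 \<le> real (d n)" by simp
      then show "1 / 2 \<le> r n" "r n < 1" by (auto simp: r_def field_simps)
    qed
    have mean: "exp (n * k1 - \<theta> * (3 + n * \<delta>)) \<le> circle_mean (r n) (\<lambda>z. cmod (exp (\<tau> * b z)))" if n: "1 \<le> n" for n
    proof -
      have Bc: "continuous_on UNIV (\<lambda>x. B (of_real (r n) * cis (2 * pi * x)))"
        using rn[OF n] by (intro continuous_on_circle bloch_unit_ball_continuous B) auto
      have "exp (n * k1 - \<theta> * (3 + n * \<delta>)) = exp (- (\<theta> * (3 + n * \<delta>))) * exp (n * k1)"
        by (simp add: exp_add[symmetric])
      also have "\<dots> \<le> exp (- (\<theta> * (3 + n * \<delta>))) * (\<integral>x. exp (\<theta> * P.block 0 n x) \<partial>U01)"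
        by (intro mult_left_mono mom) auto
      also have "\<dots> = (\<integral>x. exp (- (\<theta> * (3 + n * \<delta>))) * exp (\<theta> * P.block 0 n x) \<partial>U01)" by simp
      also have "\<dots> \<le> (\<integral>x. exp (cmod \<tau> * Re (B (of_real (r n) * cis (2 * pi * x)))) \<partial>U01)"
      proof (rule integral_mono)
        show "integrable U01 (\<lambda>x. exp (- (\<theta> * (3 + n * \<delta>))) * exp (\<theta> * P.block 0 n x))"
          by (intro integrable_mult_right P.integrable_exp_block)
        have "cmod (B (of_real (r n) * cis (2 * pi * x))) \<le> ln ((1 + r n) / (1 - r n)) / 2" for x
          using bloch_growth_0[OF B(1), of "of_real (r n) * cis (2 * pi * x)"] rn[OF n] B(2) by (simp add: norm_mult)
        then have "Re (B (of_real (r n) * cis (2 * pi * x))) \<le> ln ((1 + r n) / (1 - r n)) / 2" for x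
          using complex_Re_le_cmod order_trans by blast
        then have "cmod \<tau> * Re (B (of_real (r n) * cis (2 * pi * x))) \<le> cmod \<tau> * (ln ((1 + r n) / (1 - r n)) / 2)" for x
          by (intro mult_left_mono) auto
        then have "\<bar>exp (cmod \<tau> * Re (B (of_real (r n) * cis (2 * pi * x))))\<bar> \<le> exp (cmod \<tau> * (ln ((1 + r n) / (1 - r n)) / 2))" for x
          by simp
        then show "integrable U01 (\<lambda>x. exp (cmod \<tau> * Re (B (of_real (r n) * cis (2 * pi * x)))))"
          by (intro integrable_U01[where B = "exp (cmod \<tau> * (ln ((1 + r n) / (1 - r n)) / 2))"] borel_measurable_continuous_onI continuous_intros Bc)
        fix x
        have "P.block 0 n x - (3 + n * \<delta>) \<le> (1 + 3 * \<eta>) * Re (B (of_real (r n) * cis (2 * pi * x)))"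
          using BY[OF n, of x] by (simp add: P.block_def atLeast0LessThan r_def \<delta>_def)
        then have "\<theta> * (P.block 0 n x - (3 + n * \<delta>)) \<le> \<theta> * ((1 + 3 * \<eta>) * Re (B (of_real (r n) * cis (2 * pi * x))))"
          using \<theta> by (intro mult_left_mono) auto
        then show "exp (- (\<theta> * (3 + n * \<delta>))) * exp (\<theta> * P.block 0 n x) \<le> exp (cmod \<tau> * Re (B (of_real (r n) * cis (2 * pi * x))))"
          unfolding \<theta>(3) by (simp add: exp_add[symmetric] algebra_simps)
      qed
      also have "\<dots> = circle_mean (r n) (\<lambda>z. cmod (exp (\<tau> * b z)))"
        unfolding be circle_mean_def by (intro integral_U01_continuous continuous_intros Bc)
      finally show ?thesis .
    qed
    have lnD: "0 < ln D" "ln D \<le> t + ln (2 * M / \<theta>)"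
    proof -
      show "0 < ln D" using D2 by simp
      have "real D \<le> 2 * M / \<theta> * exp t" using D(2) Mt by simp
      then have "ln D \<le> ln (2 * M / \<theta> * exp t)" using D2 by (intro ln_mono) auto
      also have "\<dots> = t + ln (2 * M / \<theta>)" using M \<theta> by (subst ln_mult) auto
      finally show "ln D \<le> t + ln (2 * M / \<theta>)" .
    qed
    define G where "G = (k1 - \<theta> * \<delta>) / ln D"
    have "ereal G \<le> integral_means_spectrum b \<tau>"
      unfolding integral_means_spectrum_def
    proof (rule Limsup_ge_along_sequence)
      show "filterlim r (at_left 1) sequentially" unfolding r_def by (rule filterlim_radii[OF dn])
      have "(\<lambda>n. - 3 * \<theta> / ln D * (1 / real n) + G) \<longlonglongrightarrow> - 3 * \<theta> / ln D * 0 + G"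
        by (intro tendsto_intros lim_1_over_n)
      then show "(\<lambda>n. - 3 * \<theta> / ln D * (1 / real n) + G) \<longlonglongrightarrow> G" by simp
      show "\<forall>\<^sub>F n in sequentially. - 3 * \<theta> / ln D * (1 / real n) + G \<le>
          1 / \<bar>ln (1 - r n)\<bar> * ln (circle_integral (r n) (\<lambda>z. cmod (exp (\<tau> * b z))))"
        using eventually_ge_at_top[of 1]
      proof eventually_elim
        case (elim n)
        have lnr: "\<bar>ln (1 - r n)\<bar> = n * ln D"
        proof -
          have "ln (1 - r n) = - (n * ln D)" using D2 by (simp add: r_def dD ln_div ln_realpow)
          then show ?thesis using lnD(1) by simp
        qed
        have ec: "continuous_on (ball 0 1) (\<lambda>z. cmod (exp (\<tau> * b z)))"
          by (intro continuous_intros bloch_unit_ball_continuous b)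
        have "1 * exp (n * k1 - \<theta> * (3 + n * \<delta>)) \<le> (2 * pi * r n) * circle_mean (r n) (\<lambda>z. cmod (exp (\<tau> * b z)))"
        proof (intro mult_mono mean elim)
          have "1 \<le> 2 * 3 * (1 / 2 :: real)" by simp
          also have "\<dots> \<le> 2 * pi * r n" using rn[OF elim] pi_gt3 by (intro mult_mono) auto
          finally show "1 \<le> 2 * pi * r n" .
          show "0 \<le> 2 * pi * r n" using rn[OF elim] by simp
        qed auto
        then have "exp (n * k1 - \<theta> * (3 + n * \<delta>)) \<le> circle_integral (r n) (\<lambda>z. cmod (exp (\<tau> * b z)))"
          using circle_integral_eq[OF ec, of "r n"] rn[OF elim] by simp
        then have "n * k1 - \<theta> * (3 + n * \<delta>) \<le> ln (circle_integral (r n) (\<lambda>z. cmod (exp (\<tau> * b z))))"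
          by (subst ln_ge_iff) (auto intro: less_le_trans[OF exp_gt_zero])
        then have "(n * k1 - \<theta> * (3 + n * \<delta>)) / (n * ln D) \<le> ln (circle_integral (r n) (\<lambda>z. cmod (exp (\<tau> * b z)))) / (n * ln D)"
          using lnD(1) by (intro divide_right_mono) auto
        moreover have "(n * k1 - \<theta> * (3 + n * \<delta>)) / (n * ln D) = - 3 * \<theta> / ln D * (1 / real n) + G"
          using lnD(1) elim by (simp add: G_def field_simps)
        ultimately show ?case by (simp add: lnr)
      qed
    qed
    moreover have "(cmod \<tau>)\<^sup>2 / 4 * c \<le> G"
    proof -
      define L where "L = t + ln (2 * M / \<theta>)"
      have L: "ln D \<le> L" "0 < L" using lnD by (auto simp: L_def)
      have fL: "f \<theta> * L = w / 2 * (1 - 2 * a) - 4 * pi"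
        using L(2) unfolding f_def L_def t_def w_def a_def by simp
      have f0: "0 < f \<theta>" using hyp(1) c \<eta> by (smt (verit) divide_nonneg_pos mult_nonneg_nonneg zero_le_power2)
      have "\<theta>\<^sup>2 * (f \<theta> * ln D) \<le> \<theta>\<^sup>2 * (f \<theta> * L)" using L f0 by (intro mult_left_mono) auto
      also have "\<dots> = k1 - \<theta> * (4 * pi * \<theta>)" unfolding fL by (simp add: k1_def algebra_simps power2_eq_square)
      also have "\<dots> \<le> k1 - \<theta> * \<delta>" using \<delta> \<theta> by (intro diff_left_mono mult_left_mono) auto
      finally have "\<theta>\<^sup>2 * f \<theta> \<le> G" using lnD(1) by (simp add: G_def field_simps)
      moreover have "\<theta>\<^sup>2 * ((1 + 3 * \<eta>)\<^sup>2 * c / 4) \<le> \<theta>\<^sup>2 * f \<theta>" using hyp(1) by (intro mult_left_mono) auto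
      ultimately show ?thesis unfolding \<theta>(3) by (simp add: power_mult_distrib mult_ac)
    qed
    ultimately show "\<exists>b\<in>bloch_unit_ball. ereal ((cmod \<tau>)\<^sup>2 / 4 * c) \<le> integral_means_spectrum b \<tau>"
      using b by (meson ereal_less_eq(3) order_trans)
  qed
qed

section \<open>One function for the variance and the iterated logarithm\<close>

lemma Limsup_ge_frequently:
  fixes f :: "real \<Rightarrow> real"
  assumes r: "filterlim r F sequentially" and fr: "\<exists>\<^sub>F j in sequentially. c \<le> f (r j)"
  shows "ereal c \<le> Limsup F (\<lambda>x. ereal (f x))"
proof (rule ccontr)
  assume "\<not> ereal c \<le> Limsup F (\<lambda>x. ereal (f x))"
  then have "Limsup F (\<lambda>x. ereal (f x)) < ereal c" by (simp add: not_le)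
  from Limsup_lessD[OF this] have "\<forall>\<^sub>F x in F. f x < c" by simp
  from eventually_compose_filterlim[OF this r] have "\<forall>\<^sub>F j in sequentially. \<not> c \<le> f (r j)" by (simp add: not_le)
  with fr show False by (simp add: frequently_def)
qed

text \<open>For k < n each square root is at least (k + 1) / sqrt n, which reduces to the sum of the
  first integers.\<close>

lemma sum_sqrt_ge:
  assumes "1 \<le> n" shows "n * sqrt n / 2 \<le> (\<Sum>k<n. sqrt (real k + 1))"
proof -
  have n0: "0 < sqrt (real n)" using assms by simp
  have "(\<Sum>k<n. real k + 1) = real n * (real n + 1) / 2"
    by (induction n) (auto simp: field_simps)
  then have "real n * real n / 2 \<le> (\<Sum>k<n. real k + 1)" by (simp add: field_simps)
  then have "real n * real n / 2 / sqrt n \<le> (\<Sum>k<n. real k + 1) / sqrt n"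
    using n0 by (intro divide_right_mono) auto
  also have "\<dots> = (\<Sum>k<n. (real k + 1) / sqrt n)" by (rule sum_divide_distrib)
  also have "\<dots> \<le> (\<Sum>k<n. sqrt (real k + 1))"
  proof (intro sum_mono)
    fix k assume "k \<in> {..<n}"
    then have "sqrt (real k + 1) * sqrt (real k + 1) \<le> sqrt (real k + 1) * sqrt n" by (intro mult_left_mono) auto
    then show "(real k + 1) / sqrt n \<le> sqrt (real k + 1)" using n0 by (simp add: field_simps)
  qed
  also have "real n * real n / 2 / sqrt n = n * sqrt n / 2"
  proof -
    have "real n = sqrt n * sqrt n" by simp
    then show ?thesis using n0 by (simp add: field_simps)
  qed
  finally show ?thesis .
qed

text \<open>The sizes T k = T0 + sqrt (k + 1) meet three demands: they lie where
  \<open>bloch_osc T / T\<close> exceeds \<open>c1\<close>; they dominate ln k, so the factor (k +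
  1)^2 in \<open>D k\<close>, which makes the rounding errors summable, changes ln (D k) by a factor
  of at most 1 + \<eta>; and T n is small against the square root of the sum of the earlier sizes,
  as the large deviation estimate requires.\<close>

lemma extremal_bloch_function:
  assumes c: "0 < c" "c < bloch_variance"
  obtains B where "B \<in> bloch_unit_ball" "ereal c \<le> asymptotic_variance B"
    "AE x in U01. ereal (sqrt c) \<le> Limsup (at_left 1) (\<lambda>r. ereal (cmod (B (of_real r * cis (2 * pi * x))) /
      sqrt (ln (1 / (1 - r)) * ln (ln (ln (1 / (1 - r)))))))"
proof -
  \<comment> \<open>\<open>c1\<close> bounds \<open>bloch_osc T / T\<close> from below,
    \<open>c2\<close> is what remains after rounding, and \<open>c\<close> what remains after the
    losses governed by \<eta>.\<close>
  define c2 where "c2 = c + (bloch_variance - c) / 3"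
  define c1 where "c1 = c + 2 * (bloch_variance - c) / 3"
  have cs: "c < c2" "c2 < c1" "c1 < bloch_variance" "0 < c2" "0 < c1" using c by (auto simp: c1_def c2_def field_simps)
  \<comment> \<open>This inequality absorbs all losses in the iterated logarithm; it implies the
    weaker one for the variance.\<close>
  have "((\<lambda>\<eta>. (1 - \<eta>)\<^sup>2 * (1 - 3 * \<eta>) * c2 - c * ((1 + \<eta>) * (1 + 3 * \<eta>))\<^sup>2) \<longlongrightarrow>
      (1 - 0)\<^sup>2 * (1 - 3 * 0) * c2 - c * ((1 + 0) * (1 + 3 * 0))\<^sup>2) (at_right 0)"
    by (intro tendsto_intros)
  then have "\<forall>\<^sub>F \<eta> in at_right 0. 0 < (1 - \<eta>)\<^sup>2 * (1 - 3 * \<eta>) * c2 - c * ((1 + \<eta>) * (1 + 3 * \<eta>))\<^sup>2"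
    using cs by (intro order_tendstoD(1)[where y = "c2 - c"]) auto
  then obtain \<eta>1 where \<eta>1: "0 < \<eta>1" "\<And>x. 0 < x \<Longrightarrow> x < \<eta>1 \<Longrightarrow> 0 < (1 - x)\<^sup>2 * (1 - 3 * x) * c2 - c * ((1 + x) * (1 + 3 * x))\<^sup>2"
    unfolding eventually_at_right_field by auto
  define \<eta> where "\<eta> = min (1 / 4) (\<eta>1 / 2)"
  have \<eta>: "0 < \<eta>" "\<eta> \<le> 1 / 4" "c * ((1 + \<eta>) * (1 + 3 * \<eta>))\<^sup>2 < (1 - \<eta>)\<^sup>2 * (1 - 3 * \<eta>) * c2"
    using \<eta>1(1) \<eta>1(2)[of \<eta>] by (auto simp: \<eta>_def min_def)
  \<comment> \<open>The last summand makes the loss \<open>(T k + 1) * \<delta> k\<close> in the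
    variance at most (c1 - c2) T k / 2.\<close>
  define M where "M = 2 + 64 / \<eta>\<^sup>2 + 16 * pi / (c1 - c2)"
  have M: "2 + 64 / \<eta>\<^sup>2 \<le> M" "16 * pi / (c1 - c2) \<le> M" "2 \<le> M" using cs by (auto simp: M_def)
  have "\<forall>\<^sub>F k in sequentially. 2 * ln (real k + 1) + ln (2 * M) \<le> \<eta> * sqrt (real k + 1)"
  proof -
    have "filterlim (\<lambda>k. \<eta> * sqrt (real k + 1) - (2 * ln (real k + 1) + ln (2 * M))) at_top sequentially"
      using \<eta>(1) by real_asymp
    then have "\<forall>\<^sub>F k in sequentially. 0 \<le> \<eta> * sqrt (real k + 1) - (2 * ln (real k + 1) + ln (2 * M))"
      unfolding filterlim_at_top by blast
    then show ?thesis by eventually_elim simp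
  qed
  then obtain k0 where k0: "\<And>k. k \<ge> k0 \<Longrightarrow> 2 * ln (real k + 1) + ln (2 * M) \<le> \<eta> * sqrt (real k + 1)"
    by (auto simp: eventually_sequentially)
  have "\<forall>\<^sub>F T in at_top. c1 < bloch_osc T / T" using bloch_variance_tendsto cs(3) by (intro order_tendstoD(1)) auto
  then obtain T1 where T1: "\<And>T. T \<ge> T1 \<Longrightarrow> c1 < bloch_osc T / T" by (auto simp: eventually_at_top_linorder)
  \<comment> \<open>The last entry takes care of k < k0, where sqrt (k + 1) does not yet dominate
    the logarithms.\<close>
  define T0 where "T0 = max (max 1 T1) ((2 * ln (real k0 + 1) + ln (2 * M)) / \<eta>)"
  define T where "T k = T0 + sqrt (real k + 1)" for k :: nat
  have T0: "1 \<le> T0" "T1 \<le> T0" "(2 * ln (real k0 + 1) + ln (2 * M)) \<le> \<eta> * T0"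
  proof -
    have "(2 * ln (real k0 + 1) + ln (2 * M)) / \<eta> \<le> T0" by (simp add: T0_def)
    then show "(2 * ln (real k0 + 1) + ln (2 * M)) \<le> \<eta> * T0" using \<eta>(1) by (simp add: field_simps)
  qed (auto simp: T0_def)
  have Tk: "1 \<le> T k" "T1 \<le> T k" for k using T0 by (auto simp: T_def add_increasing2)
  have Tmono: "T i \<le> T j" if "i \<le> j" for i j using that by (simp add: T_def)
  have lnk: "2 * ln (real k + 1) + ln (2 * M) \<le> \<eta> * T k" for k
  proof (cases "k0 \<le> k")
    case True
    have "\<eta> * sqrt (real k + 1) \<le> \<eta> * T k" using \<eta> T0 by (intro mult_left_mono) (auto simp: T_def)
    with k0[OF True] show ?thesis by linarith
  next
    case False
    then have "ln (real k + 1) \<le> ln (real k0 + 1)" by simp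
    moreover have "\<eta> * T0 \<le> \<eta> * T k" using \<eta> by (intro mult_left_mono) (auto simp: T_def)
    ultimately show ?thesis using T0(3) by linarith
  qed
  have "\<exists>b. b \<in> bloch_unit_ball \<and> b 0 = 0 \<and> c1 * T k < circle_mean (hyp_radius (T k)) (\<lambda>z. (cmod (b z))\<^sup>2)" for k
  proof -
    have "c1 * T k < bloch_osc (T k)" using T1[OF Tk(2)[of k]] Tk(1)[of k] by (simp add: field_simps)
    moreover have "0 \<le> T k" using Tk(1)[of k] by linarith
    ultimately show ?thesis by (blast elim: bloch_osc_lower)
  qed
  then obtain b where b: "\<And>k. b k \<in> bloch_unit_ball" "\<And>k. b k 0 = 0"
    "\<And>k. c1 * T k < circle_mean (hyp_radius (T k)) (\<lambda>z. (cmod (b k z))\<^sup>2)" by metis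
  define D where "D k = nat \<lceil>M * (real k + 1)\<^sup>2 * exp (T k)\<rceil>" for k
  have Mx: "M * exp (T k) \<le> M * (real k + 1)\<^sup>2 * exp (T k)" "2 \<le> M * (real k + 1)\<^sup>2 * exp (T k)" "exp (T k) \<le> M * (real k + 1)\<^sup>2 * exp (T k)" for k
  proof -
    have k1: "1 \<le> (real k + 1)\<^sup>2" by (simp add: one_le_power)
    have "M * 1 * exp (T k) \<le> M * (real k + 1)\<^sup>2 * exp (T k)" using M k1 by (intro mult_right_mono mult_left_mono) auto
    then show 1: "M * exp (T k) \<le> M * (real k + 1)\<^sup>2 * exp (T k)" by simp
    have "2 * 1 \<le> M * exp (T k)" using M Tk(1)[of k] by (intro mult_mono) auto
    with 1 show "2 \<le> M * (real k + 1)\<^sup>2 * exp (T k)" by linarith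
    have "1 * exp (T k) \<le> M * exp (T k)" using M by (intro mult_right_mono) auto
    with 1 show "exp (T k) \<le> M * (real k + 1)\<^sup>2 * exp (T k)" by linarith
  qed
  have D: "M * (real k + 1)\<^sup>2 * exp (T k) \<le> D k" "D k \<le> M * (real k + 1)\<^sup>2 * exp (T k) + 1" for k
    using Mx(2)[of k] by (auto simp: D_def of_nat_ceiling)
  have D2: "2 \<le> real (D k)" for k using D(1)[of k] Mx(2)[of k] by linarith
  have lnD: "T k \<le> ln (D k)" "ln (D k) \<le> (1 + \<eta>) * T k" for k
  proof -
    have "ln (exp (T k)) \<le> ln (D k)" using order_trans[OF Mx(3)[of k] D(1)[of k]] by (intro ln_mono) simp_all
    then show "T k \<le> ln (D k)" by simp
    have "real (D k) \<le> 2 * M * (real k + 1)\<^sup>2 * exp (T k)" using D(2)[of k] Mx(2)[of k] by simp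
    then have "ln (D k) \<le> ln (2 * M * (real k + 1)\<^sup>2 * exp (T k))" using D2[of k] by (intro ln_mono) auto
    also have "\<dots> = ln (2 * M) + 2 * ln (real k + 1) + T k"
      using M by (simp add: ln_mult ln_realpow)
    finally show "ln (D k) \<le> (1 + \<eta>) * T k" using lnk[of k] by (simp add: distrib_right)
  qed
  define d where "d n = (\<Prod>k<n. D k)" for n :: nat
  define \<delta> where "\<delta> k = 4 * pi * exp (T k) / D k" for k
  have \<delta>: "0 \<le> \<delta> k" "\<delta> k \<le> 4 * pi / M" "\<delta> k \<le> 4 * pi / M * (1 / (real k + 1)\<^sup>2)" for k
  proof -
    show "0 \<le> \<delta> k" by (simp add: \<delta>_def)
    have "\<delta> k \<le> 4 * pi * exp (T k) / (M * (real k + 1)\<^sup>2 * exp (T k))"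
      unfolding \<delta>_def using D(1)[of k] Mx(2)[of k] by (intro divide_left_mono) (auto intro!: mult_pos_pos)
    also have "\<dots> = 4 * pi / M * (1 / (real k + 1)\<^sup>2)" by simp
    finally show 1: "\<delta> k \<le> 4 * pi / M * (1 / (real k + 1)\<^sup>2)" .
    have "4 * pi / M * (1 / (real k + 1)\<^sup>2) \<le> 4 * pi / M * 1"
      using M by (intro mult_left_mono) (auto simp: divide_simps one_le_power)
    with 1 show "\<delta> k \<le> 4 * pi / M" by linarith
  qed
  have sm: "summable (\<lambda>k. 4 * pi / M * (1 / (real k + 1)\<^sup>2))"
  proof -
    have "summable (\<lambda>k. inverse (real (Suc k) ^ 2))"
      using inverse_power_summable[of 2, where 'a = real] by (subst summable_Suc_iff) simp
    then show ?thesis by (intro summable_mult) (simp add: inverse_eq_divide add.commute)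
  qed
  define C1 where "C1 = 3 + (\<Sum>k. 4 * pi / M * (1 / (real k + 1)\<^sup>2))"
  have C1: "3 + (\<Sum>k<n. \<delta> k) \<le> C1" for n
  proof -
    have "(\<Sum>k<n. \<delta> k) \<le> (\<Sum>k<n. 4 * pi / M * (1 / (real k + 1)\<^sup>2))" by (intro sum_mono \<delta>)
    also have "\<dots> \<le> (\<Sum>k. 4 * pi / M * (1 / (real k + 1)\<^sup>2))" using M by (intro sum_le_suminf sm) auto
    finally show ?thesis by (simp add: C1_def)
  qed
  have C10: "0 \<le> C1" using C1[of 0] by simp
  obtain B Y where B: "B \<in> bloch_unit_ball" "B 0 = 0" and P: "digit_process d Y (\<lambda>k. T k + 1)"
    and Yvar: "\<And>k. circle_mean (hyp_radius (T k)) (\<lambda>z. (cmod (b k z))\<^sup>2) / 2 - (T k + 1) * (4 * pi * exp (T k) / D k) \<le> (\<integral>x. (Y k x)\<^sup>2 \<partial>U01)"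
    and BY: "\<And>n x. 1 \<le> n \<Longrightarrow> \<bar>(1 + 3 * \<eta>) * Re (B (of_real (1 - 1 / real (d n)) * cis (2 * pi * x))) - (\<Sum>k<n. Y k x)\<bar>
       \<le> 3 + (\<Sum>k<n. 4 * pi * exp (T k) / D k)"
  proof (rule digit_process_bloch[where T = T and b = b and D = D and d = d and \<eta> = \<eta>])
    show "(2 + 64 / \<eta>\<^sup>2) * exp (T k) \<le> real (D k)" for k
    proof -
      have "(2 + 64 / \<eta>\<^sup>2) * exp (T k) \<le> M * exp (T k)" using M by (intro mult_right_mono) auto
      with Mx(1)[of k] D(1)[of k] show ?thesis by linarith
    qed
    show "0 \<le> T k" for k using Tk(1)[of k] by linarith
  qed (use \<eta> b in \<open>auto simp: d_def\<close>)
  interpret P: digit_process d Y "\<lambda>k. T k + 1" by (fact P)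
  have var: "c2 / 2 * T k \<le> P.var k" for k
  proof -
    have "(T k + 1) * \<delta> k \<le> (2 * T k) * (4 * pi / M)" using \<delta>[of k] Tk(1)[of k] by (intro mult_mono) auto
    also have "\<dots> = T k * (8 * pi / M)" by simp
    also have "\<dots> \<le> T k * ((c1 - c2) / 2)"
    proof (intro mult_left_mono)
      have "16 * pi \<le> M * (c1 - c2)" using M(2) cs by (simp add: field_simps)
      then show "8 * pi / M \<le> (c1 - c2) / 2" using M by (simp add: field_simps)
    qed (use Tk(1)[of k] in auto)
    finally have "(T k + 1) * \<delta> k \<le> T k * ((c1 - c2) / 2)" .
    moreover have "c1 * T k / 2 - (T k + 1) * \<delta> k \<le> P.var k"
      using Yvar[of k] b(3)[of k] by (simp add: P.var_def \<delta>_def)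
    ultimately show ?thesis by (simp add: algebra_simps)
  qed
  define r where "r n = 1 - 1 / real (d n)" for n
  define s where "s n = (\<Sum>k<n. T k)" for n
  define t where "t n = ln (d n)" for n
  have dn: "n < d n" for n
  proof -
    have "n < 2 ^ n" by (rule less_exp)
    also have "2 ^ n \<le> (\<Prod>k<n. D k)" using prod_mono[of "{..<n}" "\<lambda>_. 2" D] D2 by (auto simp: of_nat_le_iff[of 2, simplified])
    finally show ?thesis by (simp add: d_def)
  qed
  have rlim: "filterlim r (at_left 1) sequentially" unfolding r_def by (rule filterlim_radii[OF dn])
  have rn: "0 \<le> r n" "r n < 1" for n using dn[of n] by (auto simp: r_def)
  have lnr: "ln (1 / (1 - r n)) = t n" for n using dn[of n] by (simp add: r_def t_def)
  have tsum: "t n = (\<Sum>k<n. ln (D k))" for n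
  proof -
    have "real (d n) = (\<Prod>k<n. real (D k))" by (simp add: d_def)
    moreover have "ln (\<Prod>k<n. real (D k)) = (\<Sum>k<n. ln (D k))" using D2 by (intro ln_prod) (auto intro: less_le_trans[of 0 2])
    ultimately show ?thesis by (simp add: t_def)
  qed
  have st: "s n \<le> t n" "t n \<le> (1 + \<eta>) * s n" for n
    unfolding tsum s_def sum_distrib_left by (intro sum_mono lnD)+
  have sn: "real n \<le> s n" for n
    unfolding s_def using sum_mono[of "{..<n}" "\<lambda>_. 1" T] Tk(1) by simp
  have slim: "filterlim s at_top sequentially"
    by (rule filterlim_at_top_mono[OF filterlim_real_sequentially]) (use sn in auto)
  have tlim: "filterlim t at_top sequentially"
    by (rule filterlim_at_top_mono[OF slim]) (use st in auto)
  have BW: "\<bar>(1 + 3 * \<eta>) * Re (B (of_real (r n) * cis (2 * pi * x))) - P.block 0 n x\<bar> \<le> C1" if "1 \<le> n" for n x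
    using BY[OF that, of x] C1[of n] by (simp add: P.block_def atLeast0LessThan r_def \<delta>_def)
  have sumvar: "c2 / 2 * (s n - s m) \<le> (\<Sum>k = m..<n. P.var k)" if "m \<le> n" for m n
  proof -
    have "s n = s m + (\<Sum>k = m..<n. T k)"
      unfolding s_def lessThan_atLeast0 using that by (intro sum.atLeastLessThan_concat[symmetric]) auto
    then have "c2 / 2 * (s n - s m) = (\<Sum>k = m..<n. c2 / 2 * T k)" by (simp add: sum_distrib_left)
    also have "\<dots> \<le> (\<Sum>k = m..<n. P.var k)" by (intro sum_mono var)
    finally show ?thesis .
  qed

  \<comment> \<open>The asymptotic variance of \<open>B\<close>\<close>
  have "ereal c \<le> asymptotic_variance B"
  proof -
    \<comment> \<open>From (u + v)^2 \<le> (1 + \<eta>) u^2 + (1 + 1 / \<eta>) v^2 with an error v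
      bounded by \<open>C1\<close>: the total error is bounded, so it vanishes after division by
      \<open>s n\<close>.\<close>
    define K where "K = (1 + 1 / \<eta>) * C1\<^sup>2"
    define E where "E = (1 + 3 * \<eta>)\<^sup>2 * (1 + \<eta>)"
    have E0: "0 < E" using \<eta> by (simp add: E_def)
    have mean: "(c2 * s n - 2 * K) / E \<le> circle_mean (r n) (\<lambda>z. (cmod (B z))\<^sup>2)" if n: "1 \<le> n" for n
    proof -
      define u where "u x = (1 + 3 * \<eta>) * Re (B (of_real (r n) * cis (2 * pi * x)))" for x
      have uc: "continuous_on UNIV u" unfolding u_def
        using rn by (intro continuous_intros continuous_on_circle bloch_unit_ball_continuous B)
      have u2: "(\<integral>x. (u x)\<^sup>2 \<partial>U01) = (1 + 3 * \<eta>)\<^sup>2 * (circle_mean (r n) (\<lambda>z. (cmod (B z))\<^sup>2) / 2)"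
      proof -
        have "(\<integral>x. (u x)\<^sup>2 \<partial>U01) = integral {0..1} (\<lambda>x. (u x)\<^sup>2)" by (intro integral_U01_continuous continuous_intros uc)
        also have "\<dots> = (1 + 3 * \<eta>)\<^sup>2 * circle_mean (r n) (\<lambda>z. (Re (B z))\<^sup>2)"
          by (simp add: u_def power_mult_distrib circle_mean_def)
        finally show ?thesis using bloch_circle_Re(2)[OF B rn(1) rn(2)] by simp
      qed
      have ub: "\<bar>u x\<bar> \<le> C1 + (\<Sum>k = 0..<n. T k + 1)" for x
        using BW[OF n, of x] P.block_bound[of 0 n x] unfolding u_def[symmetric] by linarith
      have iu: "integrable U01 (\<lambda>x. (u x)\<^sup>2)"
      proof (rule integrable_U01[where B = "(C1 + (\<Sum>k = 0..<n. T k + 1))\<^sup>2"])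
        show "(\<lambda>x. (u x)\<^sup>2) \<in> borel_measurable borel" by (intro borel_measurable_continuous_onI continuous_intros uc)
        show "\<bar>(u x)\<^sup>2\<bar> \<le> (C1 + (\<Sum>k = 0..<n. T k + 1))\<^sup>2" for x using power_mono[OF ub[of x] abs_ge_zero, of 2] by simp
      qed
      have "c2 / 2 * s n \<le> (\<Sum>k = 0..<n. P.var k)" using sumvar[of 0 n] by (simp add: s_def)
      also have "\<dots> = (\<integral>x. (P.block 0 n x)\<^sup>2 \<partial>U01)" by (simp add: P.integral_block_sq)
      also have "\<dots> \<le> (\<integral>x. (1 + \<eta>) * (u x)\<^sup>2 + K \<partial>U01)"
      proof (rule integral_mono)
        fix x
        define v where "v = P.block 0 n x - u x"
        have "\<bar>v\<bar> \<le> C1" using BW[OF n, of x] by (simp add: v_def u_def)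
        then have v: "v\<^sup>2 \<le> C1\<^sup>2" using power_mono[of "\<bar>v\<bar>" C1 2] by simp
        have "2 * (sqrt \<eta> * u x) * (v / sqrt \<eta>) \<le> (sqrt \<eta> * u x)\<^sup>2 + (v / sqrt \<eta>)\<^sup>2" by (rule sum_squares_bound)
        then have "2 * u x * v \<le> \<eta> * (u x)\<^sup>2 + v\<^sup>2 / \<eta>" using \<eta> by (simp add: power_mult_distrib power_divide)
        moreover have "v\<^sup>2 / \<eta> \<le> C1\<^sup>2 / \<eta>" using v \<eta> by (intro divide_right_mono) auto
        moreover have "(P.block 0 n x)\<^sup>2 = (u x)\<^sup>2 + 2 * u x * v + v\<^sup>2" by (simp add: v_def power2_eq_square algebra_simps)
        ultimately show "(P.block 0 n x)\<^sup>2 \<le> (1 + \<eta>) * (u x)\<^sup>2 + K" using v by (simp add: K_def distrib_right)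
      qed (use iu P.integrable_block_sq in auto)
      also have "\<dots> = (1 + \<eta>) * (\<integral>x. (u x)\<^sup>2 \<partial>U01) + K" using iu U01.prob_space by simp
      finally have "c2 * s n - 2 * K \<le> E * circle_mean (r n) (\<lambda>z. (cmod (B z))\<^sup>2)"
        unfolding u2 E_def by (simp add: field_simps)
      then show ?thesis using E0 by (simp add: field_simps)
    qed
    define g where "g n = r n * (c2 - 2 * K / s n) / (E * (1 + \<eta>))" for n
    have rl: "r \<longlonglongrightarrow> 1" using rlim by (simp add: filterlim_at)
    have "g \<longlonglongrightarrow> 1 * (c2 - 0) / (E * (1 + \<eta>))"
      unfolding g_def using E0 \<eta>
      by (intro tendsto_intros rl tendsto_divide_0[OF tendsto_const] filterlim_at_top_imp_at_infinity slim) auto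
    then have g: "g \<longlonglongrightarrow> c2 / (E * (1 + \<eta>))" by simp
    have "ereal (c2 / (E * (1 + \<eta>))) \<le> asymptotic_variance B"
      unfolding asymptotic_variance_def
    proof (rule Limsup_ge_along_sequence[OF rlim _ g])
      have "\<forall>\<^sub>F n in sequentially. max 1 (2 * K / c2) \<le> s n" using slim unfolding filterlim_at_top by blast
      then show "\<forall>\<^sub>F n in sequentially. g n \<le> 1 / (2 * pi * \<bar>ln (1 - r n)\<bar>) * circle_integral (r n) (\<lambda>z. (cmod (B z))\<^sup>2)"
        using eventually_ge_at_top[of 1]
      proof eventually_elim
        case (elim n)
        have s0: "0 < s n" "0 < t n" using elim st[of n] by auto
        have Kn: "0 \<le> c2 * s n - 2 * K" using elim cs by (simp add: field_simps)
        have "\<bar>ln (1 - r n)\<bar> = t n" using lnr[of n] rn[of n] s0 by (simp add: ln_div)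
        moreover have "circle_integral (r n) (\<lambda>z. (cmod (B z))\<^sup>2) = 2 * pi * r n * circle_mean (r n) (\<lambda>z. (cmod (B z))\<^sup>2)"
          using rn by (intro circle_integral_eq continuous_intros bloch_unit_ball_continuous B) auto
        ultimately have "1 / (2 * pi * \<bar>ln (1 - r n)\<bar>) * circle_integral (r n) (\<lambda>z. (cmod (B z))\<^sup>2) =
            r n * circle_mean (r n) (\<lambda>z. (cmod (B z))\<^sup>2) / t n" using s0 by simp
        also have "\<dots> \<ge> r n * ((c2 * s n - 2 * K) / E) / t n"
          using rn s0 mean[OF elim(2)] by (intro divide_right_mono mult_left_mono) auto
        also have "r n * ((c2 * s n - 2 * K) / E) / t n \<ge> r n * ((c2 * s n - 2 * K) / E) / ((1 + \<eta>) * s n)"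
          using st[of n] s0 \<eta> rn Kn E0 by (intro divide_left_mono mult_nonneg_nonneg divide_nonneg_nonneg mult_pos_pos) auto
        also have "r n * ((c2 * s n - 2 * K) / E) / ((1 + \<eta>) * s n) = g n"
          using s0 \<eta> E0 by (simp add: g_def field_simps)
        finally show ?case by simp
      qed
    qed
    moreover have "c \<le> c2 / (E * (1 + \<eta>))"
    proof -
      have "(1 - \<eta>)\<^sup>2 * (1 - 3 * \<eta>) * c2 \<le> 1 * 1 * c2"
        using \<eta> cs by (intro mult_right_mono mult_mono power_le_one) auto
      then have "c * (E * (1 + \<eta>)) \<le> c2" using \<eta>(3) by (simp add: E_def power2_eq_square mult_ac)
      moreover have "0 < E * (1 + \<eta>)" using E0 \<eta> by simp
      ultimately show ?thesis by (simp only: pos_le_divide_eq)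
    qed
    ultimately show ?thesis by (meson ereal_less_eq(3) order_trans)
  qed

  \<comment> \<open>The iterated logarithm of \<open>B\<close>\<close>
  moreover have "AE x in U01. ereal (sqrt c) \<le> Limsup (at_left 1) (\<lambda>r. ereal (cmod (B (of_real r * cis (2 * pi * x))) /
      sqrt (ln (1 / (1 - r)) * ln (ln (ln (1 / (1 - r)))))))"
  proof -
    \<comment> \<open>Growth beyond every geometric sequence makes all that precedes N j negligible
      against the block up to N (j + 1); yet ln (N j) is only (j + 1) ln (j + 1), so that ln ln t at
      N (j + 1) is eventually at most (1 + \<eta>) ln (j + 1).\<close>
    define N where "N j = Suc j ^ Suc j" for j :: nat
    have N1: "1 \<le> N j" for j unfolding N_def by (rule one_le_power) simp
    have Nj: "Suc j * N j \<le> N (Suc j)" for j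
    proof -
      have "Suc j * N j = Suc j ^ Suc (Suc j)" by (simp add: N_def)
      also have "\<dots> \<le> N (Suc j)" unfolding N_def by (intro power_mono) auto
      finally show ?thesis .
    qed
    have Nmono: "N j \<le> N (Suc j)" for j using Nj[of j] by (rule order_trans[rotated]) simp
    have jN: "j \<le> N j" for j using power_increasing[of 1 "Suc j" "Suc j"] by (simp add: N_def)
    have Nlim: "filterlim N at_top sequentially"
      by (rule filterlim_at_top_mono[OF filterlim_ident]) (use jN in auto)
    define t' where "t' j = t (N (Suc j))" for j
    define s' where "s' j = s (N (Suc j))" for j
    define \<Lambda> where "\<Lambda> j = sqrt (t' j * ln (ln (t' j)))" for j
    have t'lim: "filterlim t' at_top sequentially"
      unfolding t'_def by (intro filterlim_compose[OF tlim] filterlim_compose[OF Nlim] filterlim_Suc)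
    have \<Lambda>lim: "filterlim \<Lambda> at_top sequentially"
    proof -
      have "filterlim (\<lambda>t. sqrt (t * ln (ln t))) at_top (at_top :: real filter)" by real_asymp
      from filterlim_compose[OF this t'lim] show ?thesis by (simp add: \<Lambda>_def[abs_def])
    qed
    \<comment> \<open>As \<open>T\<close> increases, averages of its initial segments increase, so s
      m / m \<le> s n / n.\<close>
    have savg: "s m \<le> s n / real j" if "1 \<le> j" "j * m \<le> n" for m n j :: nat
    proof -
      have "m \<le> n" using that by (metis dual_order.trans mult_le_mono1 nat_mult_1)
      have "s m \<le> m * T m"
        unfolding s_def using sum_mono[of "{..<m}" T "\<lambda>_. T m"] Tmono by simp
      moreover have "(n - m) * T m \<le> s n - s m"
      proof -
        have "(\<Sum>k = m..<n. T m) \<le> (\<Sum>k = m..<n. T k)" by (intro sum_mono Tmono) auto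
        moreover have "s n = s m + (\<Sum>k = m..<n. T k)"
          unfolding s_def lessThan_atLeast0 using \<open>m \<le> n\<close> by (intro sum.atLeastLessThan_concat[symmetric]) auto
        ultimately show ?thesis by simp
      qed
      ultimately have "j * s m \<le> s m + (real j - 1) * (m * T m)" "(real n - real m) * T m \<le> s n - s m"
        using that \<open>m \<le> n\<close> mult_left_mono[of "s m" "m * T m" "real j - 1"] by (auto simp: of_nat_diff algebra_simps)
      moreover have "(real j - 1) * (m * T m) \<le> (real n - real m) * T m"
      proof -
        have "real (j * m) \<le> real n" using that by (simp only: of_nat_le_iff)
        then have "(real j - 1) * m \<le> real n - real m" by (simp add: algebra_simps)
        then have "(real j - 1) * m * T m \<le> (real n - real m) * T m" using Tk(1)[of m] by (intro mult_right_mono) auto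
        then show ?thesis by (simp add: mult_ac)
      qed
      ultimately have "j * s m \<le> s n" by linarith
      then show ?thesis using that by (simp add: field_simps)
    qed
    have sN: "s (N j) \<le> s' j / real (Suc j)" for j unfolding s'_def by (rule savg[OF _ Nj]) simp
    define v where "v j = (\<Sum>k = N j..<N (Suc j). P.var k)" for j
    have v: "c2 / 2 * (s' j * (1 - 1 / real (Suc j))) \<le> v j" for j
    proof -
      have "c2 / 2 * (s' j * (1 - 1 / real (Suc j))) \<le> c2 / 2 * (s' j - s (N j))"
        using sN[of j] cs by (intro mult_left_mono) (auto simp: algebra_simps)
      also have "\<dots> \<le> v j" unfolding v_def s'_def by (rule sumvar[OF Nmono])
      finally show ?thesis .
    qed
    have s'big: "real (N (Suc j)) * sqrt (N (Suc j)) / 2 \<le> s' j" for j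
    proof -
      have "(\<Sum>k<N (Suc j). sqrt (real k + 1)) \<le> s' j" unfolding s'_def s_def T_def using T0 by (intro sum_mono) auto
      with sum_sqrt_ge[OF N1[of "Suc j"]] show ?thesis by linarith
    qed
    have s'0: "0 < s' j" for j
      using less_le_trans[OF _ s'big[of j]] N1[of "Suc j"] by simp
    have v0: "0 < v j" if "1 \<le> j" for j
    proof -
      have "0 < 1 - 1 / real (Suc j)" using that by simp
      then have "0 < c2 / 2 * (s' j * (1 - 1 / real (Suc j)))" using cs s'0[of j] by (intro mult_pos_pos) auto
      with v[of j] show ?thesis by linarith
    qed
    \<comment> \<open>The exponent of the rare event: even after the factor 1 + 3 \<eta> of
      \<open>block_tail_lower\<close> the probability is at least half of 1 / (j + 1), whose sum
      diverges. The tilt \<open>l j\<close> solves l^2 v / 2 = Q.\<close>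
    define Q where "Q j = (1 - 3 * \<eta>) * ln (real (Suc j))" for j
    define l where "l j = sqrt (2 * Q j / v j)" for j
    have Q0: "0 < Q j" if "1 \<le> j" for j using that \<eta> by (auto simp: Q_def intro!: mult_pos_pos)
    have lv: "(l j)\<^sup>2 * v j / 2 = Q j" "0 < l j" "l j * v j = sqrt (2 * Q j * v j)" if "1 \<le> j" for j
    proof -
      show l0: "0 < l j" using Q0[OF that] v0[OF that] by (simp add: l_def)
      have l2: "(l j)\<^sup>2 = 2 * Q j / v j" using Q0[OF that] v0[OF that] by (simp add: l_def)
      show "(l j)\<^sup>2 * v j / 2 = Q j" unfolding l2 using v0[OF that] by simp
      show "l j * v j = sqrt (2 * Q j * v j)"
      proof (rule real_sqrt_unique[symmetric])
        show "(l j * v j)\<^sup>2 = 2 * Q j * v j" unfolding power_mult_distrib l2 using v0[OF that] by (simp add: power2_eq_square)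
      qed (use l0 v0[OF that] in auto)
    qed
    \<comment> \<open>With n = N (j + 1), the squared tilt is at most of order ln j / n^(3/2) and
      the squared size of a summand at most of order n, so their product tends to 0.\<close>
    have small: "\<forall>\<^sub>F j in sequentially. 4 * l j * T (N (Suc j)) \<le> \<eta>\<^sup>2 / 20"
    proof -
      define K where "K = 16 / c2 * (T0 + 2)\<^sup>2"
      have "((\<lambda>j. K * (ln (real j + 1) / sqrt (real j + 1))) \<longlongrightarrow> 0) sequentially" by real_asymp
      moreover have "0 < (\<eta>\<^sup>2 / 80)\<^sup>2" using \<eta> by simp
      ultimately have "\<forall>\<^sub>F j in sequentially. K * (ln (real j + 1) / sqrt (real j + 1)) < (\<eta>\<^sup>2 / 80)\<^sup>2"
        by (rule order_tendstoD(2))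
      then show ?thesis using eventually_ge_at_top[of 1]
      proof eventually_elim
        case (elim j)
        define n where "n = real (N (Suc j))"
        have n1: "1 \<le> n" using N1[of "Suc j"] by (simp add: n_def)
        have nj: "real j + 1 \<le> n" using jN[of "Suc j"] by (simp add: n_def)
        have n0: "0 < sqrt n" using n1 by simp
        have "T (N (Suc j)) \<le> (T0 + 2) * sqrt n"
        proof -
          have "sqrt (n + 1) \<le> sqrt (4 * n)" using n1 by simp
          then have "sqrt (n + 1) \<le> 2 * sqrt n" by (simp add: real_sqrt_mult)
          moreover have "T0 * 1 \<le> T0 * sqrt n" using T0 n1 by (intro mult_left_mono) auto
          ultimately show ?thesis by (simp add: T_def n_def distrib_right)
        qed
        then have "(T (N (Suc j)))\<^sup>2 \<le> ((T0 + 2) * sqrt n)\<^sup>2" using Tk(1)[of "N (Suc j)"] by (intro power_mono) auto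
        then have T2: "(T (N (Suc j)))\<^sup>2 \<le> (T0 + 2)\<^sup>2 * n" using n1 by (simp add: power_mult_distrib)
        have vb: "c2 / 8 * (n * sqrt n) \<le> v j"
        proof -
          have "1 / real (Suc j) \<le> 1 / 2" using elim(2) by (intro divide_left_mono) auto
          then have "n * sqrt n / 2 * (1 / 2) \<le> s' j * (1 - 1 / real (Suc j))"
            using s'big[of j] s'0[of j] n1 by (intro mult_mono) (auto simp: n_def)
          then have "c2 / 2 * (n * sqrt n / 2 * (1 / 2)) \<le> c2 / 2 * (s' j * (1 - 1 / real (Suc j)))"
            using cs by (intro mult_left_mono) auto
          moreover have "c2 / 2 * (n * sqrt n / 2 * (1 / 2)) = c2 / 8 * (n * sqrt n)" by simp
          ultimately show ?thesis using v[of j] by linarith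
        qed
        have vb0: "0 < c2 / 8 * (n * sqrt n)" using cs n1 by (intro mult_pos_pos) auto
        have Qle: "2 * Q j \<le> 2 * ln (real j + 1)"
        proof -
          have "(1 - 3 * \<eta>) * ln (real (Suc j)) \<le> 1 * ln (real (Suc j))" using \<eta> by (intro mult_right_mono) auto
          then show ?thesis by (simp add: Q_def add.commute)
        qed
        have lnj: "0 \<le> ln (real j + 1)" by simp
        have "(l j)\<^sup>2 = 2 * Q j / v j" using Q0[OF elim(2)] v0[OF elim(2)] by (simp add: l_def)
        also have "\<dots> \<le> 2 * ln (real j + 1) / (c2 / 8 * (n * sqrt n))"
          using Qle vb vb0 Q0[OF elim(2)] by (intro frac_le) auto
        finally have l2: "(l j)\<^sup>2 \<le> 2 * ln (real j + 1) / (c2 / 8 * (n * sqrt n))" .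
        have "(l j * T (N (Suc j)))\<^sup>2 = (l j)\<^sup>2 * (T (N (Suc j)))\<^sup>2" by (rule power_mult_distrib)
        also have "\<dots> \<le> 2 * ln (real j + 1) / (c2 / 8 * (n * sqrt n)) * ((T0 + 2)\<^sup>2 * n)"
          using l2 T2 vb0 lnj by (intro mult_mono) (auto intro!: divide_nonneg_pos)
        also have "\<dots> = K * (ln (real j + 1) / sqrt n)" using cs n1 by (simp add: K_def field_simps)
        also have "\<dots> \<le> K * (ln (real j + 1) / sqrt (real j + 1))"
          using nj cs lnj by (intro mult_left_mono divide_left_mono) (auto simp: K_def)
        also have "\<dots> \<le> (\<eta>\<^sup>2 / 80)\<^sup>2" using elim(1) by simp
        finally have "l j * T (N (Suc j)) \<le> \<eta>\<^sup>2 / 80" by (rule power2_le_imp_le) simp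
        then show ?case by simp
      qed
    qed
    have lnlim: "filterlim (\<lambda>j. ln (real (Suc j))) at_top sequentially" by real_asymp
    have "filterlim (\<lambda>j. Q j * (3 / 5 * \<eta>\<^sup>2)) at_top sequentially"
      unfolding Q_def using \<eta> by real_asymp
    then have Qbig: "\<forall>\<^sub>F j in sequentially. ln 4 \<le> Q j * (3 / 5 * \<eta>\<^sup>2)" by (simp add: filterlim_at_top)
    define p where "p j = measure U01 {x \<in> space U01. (1 - \<eta>) * l j * v j \<le> P.block (N j) (N (Suc j)) x}" for j
    have pj: "\<forall>\<^sub>F j in sequentially. 1 / 2 * (1 / real (Suc j)) \<le> p j"
      using small Qbig eventually_ge_at_top[of 1]
    proof eventually_elim
      case (elim j)
      have "exp (- (Q j * (1 + 3 * \<eta>))) / 2 \<le> p j"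
        unfolding p_def lv(1)[OF elim(3), symmetric] unfolding v_def
      proof (rule P.block_tail_lower)
        fix k assume "N j \<le> k" "k < N (Suc j)"
        then have "T k + 1 \<le> 2 * T (N (Suc j))" using Tmono[of k "N (Suc j)"] Tk(1)[of "N (Suc j)"] by simp
        then have "2 * l j * (T k + 1) \<le> 2 * l j * (2 * T (N (Suc j)))" using lv(2)[OF elim(3)] by (intro mult_left_mono) auto
        then show "2 * l j * (T k + 1) \<le> \<eta>\<^sup>2 / 20" using elim(1) by simp
      next
        show "ln 4 \<le> (l j)\<^sup>2 * (\<Sum>k = N j..<N (Suc j). P.var k) / 2 * (3 / 5 * \<eta>\<^sup>2)"
          using elim(2) lv(1)[OF elim(3)] by (simp add: v_def)
      qed (use Nmono \<eta> lv(2)[OF elim(3)] in auto)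
      moreover have "Q j * (1 + 3 * \<eta>) \<le> ln (real (Suc j))"
      proof -
        have "(1 - 3 * \<eta>) * (1 + 3 * \<eta>) \<le> 1" by (simp add: algebra_simps)
        then have "(1 - 3 * \<eta>) * (1 + 3 * \<eta>) * ln (real (Suc j)) \<le> 1 * ln (real (Suc j))" by (intro mult_right_mono) auto
        then show ?thesis by (simp add: Q_def mult_ac)
      qed
      then have "exp (- ln (real (Suc j))) \<le> exp (- (Q j * (1 + 3 * \<eta>)))" by simp
      moreover have "exp (- ln (real (Suc j))) = 1 / real (Suc j)" by (simp add: exp_minus inverse_eq_divide)
      ultimately show ?case by linarith
    qed
    have "\<not> summable p"
    proof
      assume "summable p"
      then have "summable (\<lambda>j. 1 / 2 * (1 / real (Suc j)))"
        by (rule summable_comparison_test_ev[rotated]) (use pj in \<open>simp add: abs_of_nonneg\<close>)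
      then have "summable (\<lambda>j. 2 * (1 / 2 * (1 / real (Suc j))))" by (rule summable_mult)
      then have "summable (\<lambda>j. inverse (real (Suc j)))" by (simp add: inverse_eq_divide del: of_nat_Suc)
      then have "summable (\<lambda>j. inverse (real j))" by (subst (asm) summable_Suc_iff)
      then show False using not_summable_harmonic[where 'a = real] by simp
    qed
    then have io: "AE x in U01. \<exists>\<^sub>F j in sequentially. (1 - \<eta>) * l j * v j \<le> P.block (N j) (N (Suc j)) x"
      unfolding p_def by (intro P.block_borel_cantelli Nmono) auto
    \<comment> \<open>A crude constant suffices in the upper law, which is applied only at N j:
      there the normalising scale is below \<open>\<Lambda> j\<close> by a factor of order sqrt (j +
      1).\<close>
    define cu where "cu = sqrt bloch_variance + 1"
    have cu: "sqrt bloch_variance < cu" "0 < cu" using bloch_variance_nonneg by (auto simp: cu_def add_nonneg_pos)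
    have up: "AE x in U01. \<forall>\<^sub>F u in at_top. cmod (B (of_real (hyp_radius u) * cis (2 * pi * x))) \<le> cu * sqrt (u * ln (ln u))"
      using bloch_LIL_upper[OF B cu(1)] unfolding U01_def by (subst AE_restrict_space_iff) auto
    \<comment> \<open>The first term comes from the current block; subtracted are the bound of the
      upper law for the value at N j and the bounded errors \<open>C1\<close> at both ends of the
      block, all relative to \<open>\<Lambda> j\<close>.\<close>
    define R where "R j = ((1 - \<eta>) / (1 + \<eta>) * sqrt ((1 - 3 * \<eta>) * c2 * (1 - 1 / (real j + 1))) -
        (1 + 3 * \<eta>) * cu * sqrt ((1 + \<eta>) / (real j + 1)) - 2 * C1 / \<Lambda> j) / (1 + 3 * \<eta>)" for j
    have "(R \<longlongrightarrow> ((1 - \<eta>) / (1 + \<eta>) * sqrt ((1 - 3 * \<eta>) * c2 * (1 - 0)) - (1 + 3 * \<eta>) * cu * sqrt 0 - 0) / (1 + 3 * \<eta>)) sequentially"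
      unfolding R_def
    proof (intro tendsto_intros)
      show "(\<lambda>j. 1 / (real j + 1)) \<longlonglongrightarrow> 0" "(\<lambda>j. (1 + \<eta>) / (real j + 1)) \<longlonglongrightarrow> 0" by real_asymp+
      show "(\<lambda>j. 2 * C1 / \<Lambda> j) \<longlonglongrightarrow> 0"
        by (rule tendsto_divide_0[OF tendsto_const filterlim_at_top_imp_at_infinity[OF \<Lambda>lim]])
    qed (use \<eta> in auto)
    moreover have "sqrt c < (1 - \<eta>) / (1 + \<eta>) * sqrt ((1 - 3 * \<eta>) * c2) / (1 + 3 * \<eta>)"
    proof -
      have "(sqrt c * ((1 + \<eta>) * (1 + 3 * \<eta>)))\<^sup>2 < ((1 - \<eta>) * sqrt ((1 - 3 * \<eta>) * c2))\<^sup>2"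
        using \<eta> c cs by (simp add: power_mult_distrib mult_ac)
      then have "sqrt c * ((1 + \<eta>) * (1 + 3 * \<eta>)) < (1 - \<eta>) * sqrt ((1 - 3 * \<eta>) * c2)"
        by (rule power2_less_imp_less) (use \<eta> cs in auto)
      then have "sqrt c < (1 - \<eta>) * sqrt ((1 - 3 * \<eta>) * c2) / ((1 + \<eta>) * (1 + 3 * \<eta>))"
        by (subst pos_less_divide_eq) (use \<eta> in auto)
      then show ?thesis by simp
    qed
    ultimately have Rev: "\<forall>\<^sub>F j in sequentially. sqrt c < R j"
      by (intro order_tendstoD(1)[where y = "(1 - \<eta>) / (1 + \<eta>) * sqrt ((1 - 3 * \<eta>) * c2) / (1 + 3 * \<eta>)"]) auto
    have lnln: "\<forall>\<^sub>F j in sequentially. ln (ln (t' j)) \<le> (1 + \<eta>) * ln (real j + 1)"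
    proof -
      define K where "K = ln (2 * (T0 + 2))"
      have "((\<lambda>j. ln (K + 2 * (real j + 2) * ln (real j + 2)) / ln (real j + 1)) \<longlongrightarrow> 1) sequentially" by real_asymp
      then have "\<forall>\<^sub>F j in sequentially. ln (K + 2 * (real j + 2) * ln (real j + 2)) / ln (real j + 1) < 1 + \<eta>"
        using \<eta> by (intro order_tendstoD(2)) auto
      moreover have "\<forall>\<^sub>F j in sequentially. 1 < t' j" using t'lim by (simp add: filterlim_at_top_dense)
      ultimately show ?thesis using eventually_ge_at_top[of 1]
      proof eventually_elim
        case (elim j)
        define n where "n = real (N (Suc j))"
        have n1: "1 \<le> n" using N1[of "Suc j"] by (simp add: n_def)
        have sq: "sqrt n \<le> n" "1 \<le> sqrt n" using n1 mult_left_mono[of 1 n n] by (auto intro!: real_le_lsqrt simp: power2_eq_square)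
        have "sqrt (n + 1) \<le> sqrt (4 * n)" using n1 by simp
        then have "sqrt (n + 1) \<le> 2 * sqrt n" by (simp add: real_sqrt_mult)
        moreover have "T0 * 1 \<le> T0 * n" using T0 n1 by (intro mult_left_mono) auto
        ultimately have "T0 + sqrt (n + 1) \<le> T0 * n + 2 * n" using sq by linarith
        then have Tn: "T (N (Suc j)) \<le> (T0 + 2) * n" by (simp add: T_def n_def[symmetric] distrib_right)
        have "s' j \<le> n * T (N (Suc j))"
          unfolding s'_def s_def n_def using sum_mono[of "{..<N (Suc j)}" T "\<lambda>_. T (N (Suc j))"] Tmono by simp
        also have "\<dots> \<le> n * ((T0 + 2) * n)" using Tn n1 by (intro mult_left_mono) auto
        finally have s'n: "s' j \<le> (T0 + 2) * n\<^sup>2" by (simp add: power2_eq_square mult_ac)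
        have "t' j \<le> (1 + \<eta>) * s' j" unfolding t'_def s'_def by (rule st)
        also have "\<dots> \<le> 2 * ((T0 + 2) * n\<^sup>2)" using s'n s'0[of j] \<eta> by (intro mult_mono) auto
        also have "\<dots> = 2 * (T0 + 2) * n\<^sup>2" by simp
        finally have "ln (t' j) \<le> ln (2 * (T0 + 2) * n\<^sup>2)" using elim(2) by (intro ln_mono) auto
        also have "\<dots> = K + 2 * ln n" using T0 n1 by (simp add: K_def ln_mult ln_realpow)
        also have "ln n = (real j + 2) * ln (real j + 2)"
          by (simp add: n_def N_def ln_realpow add.commute algebra_simps del: power_Suc)
        finally have "ln (t' j) \<le> K + 2 * (real j + 2) * ln (real j + 2)" by (simp only: mult.assoc)
        then have "ln (ln (t' j)) \<le> ln (K + 2 * (real j + 2) * ln (real j + 2))" using elim(2) by (intro ln_mono) auto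
        also have "\<dots> \<le> (1 + \<eta>) * ln (real j + 1)" using elim(1,3) by (simp add: divide_less_eq)
        finally show ?case .
      qed
    qed
    have big: "\<forall>\<^sub>F j in sequentially. 0 < ln (ln (t (N j))) \<and> 1 < t (N j) \<and> 1 < ln (t (N j))"
    proof -
      have tN: "filterlim (\<lambda>j. t (N j)) at_top sequentially" by (intro filterlim_compose[OF tlim] Nlim)
      have "\<forall>\<^sub>F u in at_top. 0 < ln (ln u) \<and> 1 < u \<and> 1 < ln (u::real)"
        by (intro eventually_conj; real_asymp)
      from eventually_compose_filterlim[OF this tN] show ?thesis .
    qed
    have big': "\<forall>\<^sub>F j in sequentially. 0 < ln (ln (t' j)) \<and> 1 < t' j"
      using big unfolding t'_def by (subst (asm) eventually_sequentially_Suc[symmetric]) (auto elim: eventually_mono)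
    show ?thesis
      using io up
    proof eventually_elim
      case (elim x)
      define b where "b n = cmod (B (of_real (r n) * cis (2 * pi * x)))" for n
      have hr: "hyp_radius (t n) = r n" for n using hyp_radius_ln[of "r n"] rn lnr by simp
      have upN: "\<forall>\<^sub>F j in sequentially. b (N j) \<le> cu * sqrt (t (N j) * ln (ln (t (N j))))"
        using eventually_compose_filterlim[OF elim(2) filterlim_compose[OF tlim Nlim]] by (simp add: hr b_def)
      have "\<exists>\<^sub>F j in sequentially. sqrt c \<le> b (N (Suc j)) / \<Lambda> j"
      proof (rule frequently_rev_mp[OF elim(1)])
        show "\<forall>\<^sub>F j in sequentially. (1 - \<eta>) * l j * v j \<le> P.block (N j) (N (Suc j)) x \<longrightarrow> sqrt c \<le> b (N (Suc j)) / \<Lambda> j"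
          using upN Rev lnln big big' eventually_ge_at_top[of 1]
        proof eventually_elim
          case (elim j)
          show ?case
          proof
            assume blk: "(1 - \<eta>) * l j * v j \<le> P.block (N j) (N (Suc j)) x"
            define J where "J = real j + 1"
            have J: "1 \<le> J" "real (Suc j) = J" by (auto simp: J_def)
            have \<Lambda>0: "0 < \<Lambda> j" using elim(5) by (simp add: \<Lambda>_def)
            have blk': "(1 - \<eta>) / (1 + \<eta>) * sqrt ((1 - 3 * \<eta>) * c2 * (1 - 1 / J)) * \<Lambda> j \<le> (1 - \<eta>) * l j * v j"
            proof -
              define e where "e = (1 - 3 * \<eta>) * c2 * (1 - 1 / J)"
              have e0: "0 \<le> e" using \<eta> cs J by (auto simp: e_def)
              have "e * (t' j * ln (ln (t' j))) \<le> e * ((1 + \<eta>) * s' j * ((1 + \<eta>) * ln J))"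
                using st[of "N (Suc j)"] elim(3,5) e0 s'0[of j] \<eta> unfolding t'_def[symmetric] s'_def[symmetric] J_def
                by (intro mult_left_mono mult_mono) auto
              also have "\<dots> = (1 + \<eta>)\<^sup>2 * (2 * ((1 - 3 * \<eta>) * ln J) * (c2 / 2 * (s' j * (1 - 1 / J))))"
                by (simp add: e_def power2_eq_square mult_ac)
              also have "\<dots> \<le> (1 + \<eta>)\<^sup>2 * (2 * Q j * v j)"
                using v[of j] Q0[OF elim(6)] unfolding Q_def J(2) by (intro mult_left_mono) auto
              finally have "sqrt (e * (t' j * ln (ln (t' j)))) \<le> sqrt ((1 + \<eta>)\<^sup>2 * (2 * Q j * v j))" by (rule real_sqrt_le_mono)
              then have "sqrt e * \<Lambda> j \<le> (1 + \<eta>) * (l j * v j)"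
                using \<eta> by (simp add: real_sqrt_mult \<Lambda>_def lv(3)[OF elim(6)])
              then have "(1 - \<eta>) / (1 + \<eta>) * (sqrt e * \<Lambda> j) \<le> (1 - \<eta>) / (1 + \<eta>) * ((1 + \<eta>) * (l j * v j))"
                using \<eta> by (intro mult_left_mono) auto
              then show ?thesis using \<eta> by (simp add: e_def mult_ac)
            qed
            have prev: "b (N j) \<le> cu * (sqrt ((1 + \<eta>) / J) * \<Lambda> j)"
            proof -
              have "t (N j) \<le> (1 + \<eta>) * s (N j)" by (rule st)
              also have "\<dots> \<le> (1 + \<eta>) * (s' j / J)" using sN[of j] \<eta> unfolding J(2) by (intro mult_left_mono) auto
              also have "\<dots> \<le> (1 + \<eta>) * (t' j / J)"
                using st[of "N (Suc j)"] \<eta> J unfolding s'_def t'_def by (intro mult_left_mono divide_right_mono) auto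
              finally have tt: "t (N j) \<le> (1 + \<eta>) / J * t' j" by simp
              have "t (N j) \<le> t' j"
              proof -
                have "d (N j) dvd d (N (Suc j))" by (rule P.d_dvd'[OF Nmono])
                then have "d (N j) \<le> d (N (Suc j))" using P.d1[of "N (Suc j)"] by (intro dvd_imp_le) auto
                then show ?thesis unfolding t_def t'_def using P.d1[of "N j"] by simp
              qed
              then have "ln (ln (t (N j))) \<le> ln (ln (t' j))" using elim(4) by (simp add: ln_mono)
              then have "t (N j) * ln (ln (t (N j))) \<le> ((1 + \<eta>) / J * t' j) * ln (ln (t' j))"
                using tt elim(4,5) \<eta> J by (intro mult_mono) auto
              then have "sqrt (t (N j) * ln (ln (t (N j)))) \<le> sqrt ((1 + \<eta>) / J * (t' j * ln (ln (t' j))))"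
                by (intro real_sqrt_le_mono) (simp add: mult_ac)
              also have "\<dots> = sqrt ((1 + \<eta>) / J) * \<Lambda> j" by (simp only: real_sqrt_mult \<Lambda>_def)
              finally have "cu * sqrt (t (N j) * ln (ln (t (N j)))) \<le> cu * (sqrt ((1 + \<eta>) / J) * \<Lambda> j)"
                using cu by (intro mult_left_mono) auto
              with elim(1) show ?thesis by linarith
            qed
            have e0: "0 < 1 + 3 * \<eta>" using \<eta> by simp
            have reb: "\<bar>(1 + 3 * \<eta>) * Re (B (of_real (r n) * cis (2 * pi * x)))\<bar> \<le> (1 + 3 * \<eta>) * b n" for n
              unfolding abs_mult b_def using e0 by (intro mult_mono abs_Re_le_cmod) auto
            have blocks: "P.block 0 (N (Suc j)) x = P.block 0 (N j) x + P.block (N j) (N (Suc j)) x"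
              unfolding P.block_def using Nmono[of j] by (intro sum.atLeastLessThan_concat[symmetric]) auto
            have "(1 - \<eta>) * l j * v j - (1 + 3 * \<eta>) * b (N j) - 2 * C1 \<le> (1 + 3 * \<eta>) * b (N (Suc j))"
              using BW[OF N1[of j], of x] BW[OF N1[of "Suc j"], of x] reb[of "N j"] reb[of "N (Suc j)"] blk blocks by linarith
            moreover have "(1 + 3 * \<eta>) * b (N j) \<le> (1 + 3 * \<eta>) * (cu * (sqrt ((1 + \<eta>) / J) * \<Lambda> j))"
              using prev e0 by (intro mult_left_mono) auto
            ultimately have "(1 - \<eta>) / (1 + \<eta>) * sqrt ((1 - 3 * \<eta>) * c2 * (1 - 1 / J)) * \<Lambda> j -
                (1 + 3 * \<eta>) * (cu * (sqrt ((1 + \<eta>) / J) * \<Lambda> j)) - 2 * C1 \<le> (1 + 3 * \<eta>) * b (N (Suc j))"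
              using blk' by linarith
            also have "(1 - \<eta>) / (1 + \<eta>) * sqrt ((1 - 3 * \<eta>) * c2 * (1 - 1 / J)) * \<Lambda> j -
                (1 + 3 * \<eta>) * (cu * (sqrt ((1 + \<eta>) / J) * \<Lambda> j)) - 2 * C1 = (1 + 3 * \<eta>) * (R j * \<Lambda> j)"
            proof -
              have alg: "X * w - e * (y * (z * w)) - k = e * ((X - e * y * z - k / w) / e * w)" if "w \<noteq> 0" "e \<noteq> 0" for X w e y z k :: real
                using that by (simp add: field_simps)
              show ?thesis unfolding R_def J_def[symmetric] by (rule alg) (use \<Lambda>0 e0 in auto)
            qed
            finally have "R j * \<Lambda> j \<le> b (N (Suc j))" using e0 by simp
            then have "R j \<le> b (N (Suc j)) / \<Lambda> j" using \<Lambda>0 by (simp add: field_simps)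
            with elim(2) show "sqrt c \<le> b (N (Suc j)) / \<Lambda> j" by linarith
          qed
        qed
      qed
      then show ?case
        by (intro Limsup_ge_frequently[where r = "\<lambda>j. r (N (Suc j))"] filterlim_compose[OF rlim] filterlim_compose[OF Nlim] filterlim_Suc)
           (simp add: lnr b_def \<Lambda>_def t'_def)
    qed
  qed
  ultimately show ?thesis using B by (intro that)
qed

subsection \<open>The essential supremum of the iterated logarithm\<close>

text \<open>The dilation by 2 \<pi> maps null sets to null sets; this passes from turns to radians
  and from Borel to Lebesgue measure.\<close>

lemma AE_U01_scale:
  assumes "AE x in U01. P (2 * pi * x)"
  shows "AE \<theta> in lebesgue_on {0..<2*pi}. P \<theta>"
proof -
  have "AE x in lborel. x \<in> {0..<1} \<longrightarrow> P (2 * pi * x)"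
    using assms unfolding U01_def by (subst (asm) AE_restrict_space_iff) auto
  then obtain N where N: "N \<in> null_sets lborel" "{x. \<not> (x \<in> {0..<1} \<longrightarrow> P (2 * pi * x))} \<subseteq> N"
    by (auto simp: eventually_ae_filter)
  have "N \<in> null_sets lebesgue" using N(1) by (rule null_sets_completionI)
  then have "negligible N" by (simp add: negligible_iff_null_sets)
  then have "negligible ((\<lambda>x. 2 * pi * x) ` N)"
    by (intro negligible_differentiable_image_negligible derivative_intros) auto
  then have null: "(\<lambda>x. 2 * pi * x) ` N \<in> null_sets lebesgue" by (simp add: negligible_iff_null_sets)
  have sub: "{\<theta>. \<not> (\<theta> \<in> {0..<2*pi} \<longrightarrow> P \<theta>)} \<subseteq> (\<lambda>x. 2 * pi * x) ` N"
  proof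
    fix \<theta> assume "\<theta> \<in> {\<theta>. \<not> (\<theta> \<in> {0..<2*pi} \<longrightarrow> P \<theta>)}"
    then have \<theta>: "0 \<le> \<theta>" "\<theta> < 2 * pi" "\<not> P \<theta>" by auto
    have e: "2 * pi * (\<theta> / (2 * pi)) = \<theta>" by simp
    have "\<theta> / (2 * pi) \<in> {0..<1}" using \<theta> by (simp add: field_simps)
    then have "\<theta> / (2 * pi) \<in> N" using N(2) \<theta>(3) e by (metis (mono_tags, lifting) mem_Collect_eq subsetD)
    then show "\<theta> \<in> (\<lambda>x. 2 * pi * x) ` N" using e by (metis imageI)
  qed
  have "AE \<theta> in lebesgue. \<theta> \<in> {0..<2*pi} \<longrightarrow> P \<theta>"
    by (rule AE_I'[OF null]) (use sub in auto)
  then show ?thesis by (subst AE_restrict_space_iff) auto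
qed

definition lil_limsup :: "(complex \<Rightarrow> complex) \<Rightarrow> real \<Rightarrow> ereal" where
  "lil_limsup b \<theta> = Limsup (at_left 1)
     (\<lambda>r. ereal (cmod (b (of_real r * cis \<theta>)) / sqrt (ln (1 / (1 - r)) * ln (ln (ln (1 / (1 - r)))))))"

text \<open>A supremum over an interval of radii exceeds a threshold on a union of open sets, hence
  is lower semicontinuous in the angle; the upper limit at 1 is a countable infimum of such
  suprema.\<close>

lemma lil_limsup_measurable:
  assumes b: "b \<in> bloch_unit_ball"
  shows "lil_limsup b \<in> borel_measurable borel"
proof -
  define h where "h r \<theta> = ereal (cmod (b (of_real r * cis \<theta>)) / sqrt (ln (1 / (1 - r)) * ln (ln (ln (1 / (1 - r))))))" for r \<theta> :: real
  have sup: "(\<lambda>\<theta>. SUP r\<in>{1 - 1 / real (Suc (Suc n))<..<1}. h r \<theta>) \<in> borel_measurable borel" for n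
  proof (rule borel_measurableI_greater)
    fix y :: ereal
    let ?I = "{1 - 1 / real (Suc (Suc n))<..<1} :: real set"
    have "{\<theta> \<in> space borel. y < (SUP r\<in>?I. h r \<theta>)} = (\<Union>r\<in>?I. {\<theta>. y < h r \<theta>})"
      by (auto simp: less_SUP_iff)
    moreover have "open {\<theta>. y < h r \<theta>}" if r: "r \<in> ?I" for r
    proof -
      have "1 / real (Suc (Suc n)) \<le> 1" by simp
      then have r01: "0 \<le> r" "r < 1" using r[unfolded greaterThanLessThan_iff] by linarith+
      have "continuous_on UNIV (\<lambda>\<theta>. b (of_real r * cis \<theta>))"
        by (rule continuous_on_compose2[OF bloch_unit_ball_continuous[OF b]])
           (use r01 in \<open>auto intro!: continuous_intros simp: norm_mult\<close>)
      then have "continuous_on UNIV (h r)" unfolding h_def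
        by (intro continuous_on_ereal) (auto intro!: continuous_intros simp: divide_inverse)
      then show ?thesis by (intro open_Collect_less continuous_on_const) auto
    qed
    ultimately show "{\<theta> \<in> space borel. y < (SUP r\<in>?I. h r \<theta>)} \<in> sets borel" by (auto intro!: borel_open open_UN)
  qed
  have "lil_limsup b \<theta> = (INF n. SUP r\<in>{1 - 1 / real (Suc (Suc n))<..<1}. h r \<theta>)" for \<theta>
  proof (rule antisym)
    show "lil_limsup b \<theta> \<le> (INF n. SUP r\<in>{1 - 1 / real (Suc (Suc n))<..<1}. h r \<theta>)"
    proof (rule INF_greatest)
      fix n
      have "\<forall>\<^sub>F r in at_left (1::real). r \<in> {1 - 1 / real (Suc (Suc n))<..<1}"
        unfolding eventually_at_left_field by (intro exI[of _ "1 - 1 / real (Suc (Suc n))"]) auto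
      then show "lil_limsup b \<theta> \<le> (SUP r\<in>{1 - 1 / real (Suc (Suc n))<..<1}. h r \<theta>)"
        unfolding lil_limsup_def h_def[symmetric]
        by (intro Limsup_bounded) (auto elim!: eventually_mono intro: SUP_upper)
    qed
    show "(INF n. SUP r\<in>{1 - 1 / real (Suc (Suc n))<..<1}. h r \<theta>) \<le> lil_limsup b \<theta>"
      unfolding lil_limsup_def h_def[symmetric] Limsup_def
    proof (rule INF_greatest)
      fix P assume "P \<in> {P. eventually P (at_left (1::real))}"
      then obtain a where a: "a < 1" "\<And>r. a < r \<Longrightarrow> r < 1 \<Longrightarrow> P r" unfolding eventually_at_left_field by auto
      obtain n where n: "inverse (real (Suc n)) < 1 - a" using reals_Archimedean[of "1 - a"] a by auto
      have "1 / real (Suc (Suc n)) \<le> inverse (real (Suc n))" by (simp add: inverse_eq_divide frac_le)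
      with n have "a < 1 - 1 / real (Suc (Suc n))" by linarith
      then have sub: "{1 - 1 / real (Suc (Suc n))<..<1} \<subseteq> Collect P" using a(2) by auto
      have "(INF n. SUP r\<in>{1 - 1 / real (Suc (Suc n))<..<1}. h r \<theta>) \<le> (SUP r\<in>{1 - 1 / real (Suc (Suc n))<..<1}. h r \<theta>)"
        by (rule INF_lower) simp
      also have "\<dots> \<le> (SUP r\<in>Collect P. h r \<theta>)" by (rule SUP_subset_mono[OF sub order_refl])
      finally show "(INF n. SUP r\<in>{1 - 1 / real (Suc (Suc n))<..<1}. h r \<theta>) \<le> (SUP r\<in>Collect P. h r \<theta>)" .
    qed
  qed
  then have "lil_limsup b = (\<lambda>\<theta>. INF n. SUP r\<in>{1 - 1 / real (Suc (Suc n))<..<1}. h r \<theta>)" by (rule ext)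
  moreover have "(\<lambda>\<theta>. INF n. SUP r\<in>{1 - 1 / real (Suc (Suc n))<..<1}. h r \<theta>) \<in> borel_measurable borel"
    using sup by measurable
  ultimately show ?thesis by simp
qed

lemma lil_constant_eq: "lil_constant b = esssup (lebesgue_on {0..<2*pi}) (lil_limsup b)"
  by (simp add: lil_constant_def lil_limsup_def[abs_def])

lemma lebesgue_circle_nonnull: "emeasure (lebesgue_on {0..<2*pi}) (space (lebesgue_on {0..<2*pi})) \<noteq> 0"
  by (simp add: space_restrict_space emeasure_restrict_space)

text \<open>\<open>esssup\<close> dominates its function almost everywhere, and on a space of
  positive measure an inequality between constants that holds almost everywhere is true.\<close>

lemma lil_constant_ge:
  assumes "AE x in U01. ereal a \<le> lil_limsup b (2 * pi * x)"
  shows "ereal a \<le> lil_constant b"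
proof -
  let ?M = "lebesgue_on {0..<2*pi}"
  have "AE \<theta> in ?M. ereal a \<le> lil_limsup b \<theta>" by (rule AE_U01_scale[OF assms])
  moreover have "AE \<theta> in ?M. lil_limsup b \<theta> \<le> lil_constant b" unfolding lil_constant_eq by (rule esssup_AE)
  ultimately have "AE \<theta> in ?M. ereal a \<le> lil_constant b" by eventually_elim (rule order_trans)
  moreover have "ae_filter ?M \<noteq> bot" using lebesgue_circle_nonnull by (simp add: ae_filter_eq_bot_iff)
  ultimately show ?thesis by (simp add: eventually_const)
qed

lemma lil_limsup_nonneg: "0 \<le> lil_limsup b \<theta>"
proof -
  have pos: "\<forall>\<^sub>F r in at_left (1::real). 0 \<le> ln (1 / (1 - r)) * ln (ln (ln (1 / (1 - r))))" by real_asymp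
  have "Limsup (at_left (1::real)) (\<lambda>r. 0 :: ereal) \<le> lil_limsup b \<theta>"
    unfolding lil_limsup_def by (rule Limsup_mono) (use pos in \<open>auto elim!: eventually_mono\<close>)
  then show ?thesis by (simp add: Limsup_const)
qed

lemma lil_constant_nonneg: "0 \<le> lil_constant b"
  using lil_constant_ge[of 0 b] lil_limsup_nonneg by (simp add: zero_ereal_def)

lemma lil_constant_le:
  assumes b: "b \<in> bloch_unit_ball"
  shows "lil_constant b \<le> ereal (sqrt bloch_variance)"
proof (rule ereal_le_epsilon2)
  fix e :: real assume e: "0 < e"
  define c where "c = sqrt bloch_variance + e / 2"
  define g where "g z = b z - b 0" for z
  have g: "g \<in> bloch_unit_ball" "g 0 = 0" unfolding g_def using bloch_unit_ball_minus_const[OF b] by auto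
  have up: "AE x in U01. \<forall>\<^sub>F u in at_top. cmod (g (of_real (hyp_radius u) * cis (2 * pi * x))) \<le> c * sqrt (u * ln (ln u))"
    using bloch_LIL_upper[OF g, of c] e unfolding U01_def c_def by (subst AE_restrict_space_iff) auto
  have "AE x in U01. lil_limsup b (2 * pi * x) \<le> ereal (c + e / 2)"
    using up
  proof eventually_elim
    case (elim x)
    define s where "s u = sqrt (u * ln (ln u))" for u :: real
    have slim: "filterlim s at_top at_top" unfolding s_def by real_asymp
    have "((\<lambda>u. cmod (b 0) / s u) \<longlongrightarrow> 0) at_top"
      by (intro tendsto_divide_0[OF tendsto_const] filterlim_at_top_imp_at_infinity slim)
    then have 1: "\<forall>\<^sub>F u in at_top. cmod (b 0) / s u < e / 2" using e by (intro order_tendstoD(2)) auto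
    have 2: "\<forall>\<^sub>F u in at_top. 0 < s u" using slim by (simp add: filterlim_at_top_dense)
    have "\<forall>\<^sub>F u in at_top. cmod (b (of_real (hyp_radius u) * cis (2 * pi * x))) / s u \<le> c + e / 2"
      using elim 1 2
    proof eventually_elim
      case (elim u)
      let ?z = "of_real (hyp_radius u) * cis (2 * pi * x)"
      have "cmod (b ?z) \<le> cmod (g ?z) + cmod (b 0)" using norm_triangle_ineq[of "g ?z" "b 0"] by (simp add: g_def)
      also have "\<dots> \<le> c * s u + e / 2 * s u" using elim by (simp add: s_def field_simps)
      finally show ?case using elim(3) by (simp add: field_simps)
    qed
    from eventually_compose_filterlim[OF this filterlim_hyp_radius_inverse]
    have "\<forall>\<^sub>F r in at_left 1. cmod (b (of_real (hyp_radius (ln (1 / (1 - r)))) * cis (2 * pi * x))) / s (ln (1 / (1 - r))) \<le> c + e / 2" .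
    then have "\<forall>\<^sub>F r in at_left 1. cmod (b (of_real r * cis (2 * pi * x))) / sqrt (ln (1 / (1 - r)) * ln (ln (ln (1 / (1 - r))))) \<le> c + e / 2"
      using eventually_at_left_1 by eventually_elim (simp add: s_def hyp_radius_ln)
    then show ?case unfolding lil_limsup_def by (intro Limsup_bounded) (auto elim!: eventually_mono)
  qed
  then have "AE \<theta> in lebesgue_on {0..<2*pi}. lil_limsup b \<theta> \<le> ereal (c + e / 2)" by (rule AE_U01_scale)
  \<comment> \<open>On a function that is not measurable \<open>esssup\<close> is infinite by
    convention, so the upper bound depends on this.\<close>
  moreover have "lil_limsup b \<in> borel_measurable (lebesgue_on {0..<2*pi})"
    using lil_limsup_measurable[OF b] by (intro measurable_restrict_space1 measurable_completion) simp
  ultimately have "lil_constant b \<le> ereal (c + e / 2)" unfolding lil_constant_eq by (rule esssup_I[rotated])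
  then show "lil_constant b \<le> ereal (sqrt bloch_variance) + ereal e" by (simp add: c_def add.commute)
qed

lemma ereal_power2_mono: "0 \<le> x \<Longrightarrow> x \<le> y \<Longrightarrow> x\<^sup>2 \<le> (y::ereal)\<^sup>2"
  unfolding power2_eq_square by (intro ereal_mult_mono) auto

text \<open>The zero function settles thresholds y \<le> 0, so that lower bounds are asked only for
  positive \<open>c\<close> and a vanishing \<open>bloch_variance\<close> is no separate
  case.\<close>

lemma SUP_eq_bloch_variance:
  fixes f :: "(complex \<Rightarrow> complex) \<Rightarrow> ereal"
  assumes le: "\<And>b. b \<in> bloch_unit_ball \<Longrightarrow> f b \<le> ereal bloch_variance"
    and nonneg: "0 \<le> f (\<lambda>_. 0)"
    and ge: "\<And>c. \<lbrakk>0 < c; c < bloch_variance\<rbrakk> \<Longrightarrow> \<exists>b\<in>bloch_unit_ball. ereal c \<le> f b"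
  shows "(SUP b\<in>bloch_unit_ball. f b) = ereal bloch_variance"
proof (rule antisym)
  show "(SUP b\<in>bloch_unit_ball. f b) \<le> ereal bloch_variance" by (intro SUP_least le)
  show "ereal bloch_variance \<le> (SUP b\<in>bloch_unit_ball. f b)"
  proof (rule dense_le)
    fix y assume y: "y < ereal bloch_variance"
    show "y \<le> (SUP b\<in>bloch_unit_ball. f b)"
    proof (cases "y \<le> 0")
      case True
      then show ?thesis using nonneg zero_in_bloch_unit_ball by (meson SUP_upper2 order_trans)
    next
      case False
      with y obtain c where c: "y = ereal c" "0 < c" "c < bloch_variance" by (cases y) auto
      then show ?thesis using ge by (metis SUP_upper2)
    qed
  qed
qed

lemma integral_means_spectrum_zero: "0 \<le> integral_means_spectrum (\<lambda>_. 0) \<tau>"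
proof -
  \<comment> \<open>Beyond radius 1 / 2 the circle is longer than 1, so the logarithm of its length
    is nonnegative.\<close>
  have "\<forall>\<^sub>F r in at_left (1::real). 1 / 2 < r" unfolding eventually_at_left_field by (intro exI[of _ "1 / 2"]) auto
  then have "\<forall>\<^sub>F r in at_left 1. (0::ereal) \<le> ereal (1 / \<bar>ln (1 - r)\<bar> * ln (circle_integral r (\<lambda>z. cmod (exp (\<tau> * 0)))))"
  proof eventually_elim
    case (elim r)
    have "circle_integral r (\<lambda>z. cmod (exp (\<tau> * 0))) = 2 * pi * r" by (simp add: circle_integral_def)
    moreover have "2 * 3 * (1 / 2) \<le> 2 * pi * r" using elim pi_gt3 by (intro mult_mono) auto
    ultimately show ?case by simp
  qed
  from Limsup_mono[OF this] show ?thesis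
    unfolding integral_means_spectrum_def by (simp add: Limsup_const)
qed

theorem theorem1p1:
  shows "\<exists>S::real.
    (SUP b\<in>bloch_unit_ball. asymptotic_variance b) = ereal S \<and>
    (SUP b\<in>bloch_unit_ball. (lil_constant b)\<^sup>2) = ereal S \<and>
    ((\<lambda>\<tau>. ereal (4 / (cmod \<tau>)\<^sup>2) * (SUP b\<in>bloch_unit_ball. integral_means_spectrum b \<tau>))
       \<longlongrightarrow> ereal S) (at 0)"
proof (intro exI[of _ bloch_variance] conjI)
  show "(SUP b\<in>bloch_unit_ball. asymptotic_variance b) = ereal bloch_variance"
  proof (rule SUP_eq_bloch_variance[OF asymptotic_variance_le])
    show "0 \<le> asymptotic_variance (\<lambda>_. 0)"
      by (simp add: asymptotic_variance_def circle_integral_def Limsup_const zero_ereal_def)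
    show "\<exists>b\<in>bloch_unit_ball. ereal c \<le> asymptotic_variance b" if "0 < c" "c < bloch_variance" for c
      using extremal_bloch_function[OF that] by blast
  qed
  show "(SUP b\<in>bloch_unit_ball. (lil_constant b)\<^sup>2) = ereal bloch_variance"
  proof (rule SUP_eq_bloch_variance)
    show "(lil_constant b)\<^sup>2 \<le> ereal bloch_variance" if "b \<in> bloch_unit_ball" for b
      using ereal_power2_mono[OF lil_constant_nonneg lil_constant_le[OF that]] bloch_variance_nonneg by simp
    show "0 \<le> (lil_constant (\<lambda>_. 0))\<^sup>2"
      unfolding power2_eq_square by (intro ereal_0_le_mult lil_constant_nonneg)
    fix c assume c: "0 < c" "c < bloch_variance"
    obtain B where B: "B \<in> bloch_unit_ball" "AE x in U01. ereal (sqrt c) \<le> lil_limsup B (2 * pi * x)"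
      unfolding lil_limsup_def by (rule extremal_bloch_function[OF c])
    have "(ereal (sqrt c))\<^sup>2 \<le> (lil_constant B)\<^sup>2"
      by (intro ereal_power2_mono lil_constant_ge B(2)) (use c in simp)
    then show "\<exists>b\<in>bloch_unit_ball. ereal c \<le> (lil_constant b)\<^sup>2" using B(1) c by auto
  qed
  show "((\<lambda>\<tau>. ereal (4 / (cmod \<tau>)\<^sup>2) * (SUP b\<in>bloch_unit_ball. integral_means_spectrum b \<tau>))
       \<longlongrightarrow> ereal bloch_variance) (at 0)"
  proof (rule order_tendstoI)
    fix y assume y: "y < ereal bloch_variance"
    have near: "\<forall>\<^sub>F \<tau> in at (0::complex). \<tau> \<noteq> 0 \<and> cmod \<tau> < \<tau>0" if "0 < \<tau>0" for \<tau>0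
      unfolding eventually_at using that by (intro exI[of _ \<tau>0]) auto
    show "\<forall>\<^sub>F \<tau> in at 0. y < ereal (4 / (cmod \<tau>)\<^sup>2) * (SUP b\<in>bloch_unit_ball. integral_means_spectrum b \<tau>)"
    proof (cases "0 \<le> y")
      case True
      obtain c where c: "y < ereal c" "0 < c" "c < bloch_variance"
      proof -
        from y True obtain a where a: "y = ereal a" "0 \<le> a" "a < bloch_variance" by (cases y) auto
        then show ?thesis using that[of "(a + bloch_variance) / 2"] by auto
      qed
      obtain \<tau>0 where \<tau>0: "0 < \<tau>0" "\<And>\<tau>. \<lbrakk>\<tau> \<noteq> 0; cmod \<tau> < \<tau>0\<rbrakk> \<Longrightarrow>
          \<exists>b\<in>bloch_unit_ball. ereal ((cmod \<tau>)\<^sup>2 / 4 * c) \<le> integral_means_spectrum b \<tau>"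
        using integral_means_spectrum_lower[OF c(2,3)] by metis
      show ?thesis using near[OF \<tau>0(1)]
      proof eventually_elim
        case (elim \<tau>)
        have "ereal ((cmod \<tau>)\<^sup>2 / 4 * c) \<le> (SUP b\<in>bloch_unit_ball. integral_means_spectrum b \<tau>)"
          using \<tau>0(2)[of \<tau>] elim by (meson SUP_upper2)
        then have "ereal (4 / (cmod \<tau>)\<^sup>2) * ereal ((cmod \<tau>)\<^sup>2 / 4 * c) \<le>
            ereal (4 / (cmod \<tau>)\<^sup>2) * (SUP b\<in>bloch_unit_ball. integral_means_spectrum b \<tau>)"
          by (intro ereal_mult_left_mono) auto
        moreover have "ereal (4 / (cmod \<tau>)\<^sup>2) * ereal ((cmod \<tau>)\<^sup>2 / 4 * c) = ereal c" using elim by simp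
        ultimately show ?case using c(1) by simp
      qed
    next
      \<comment> \<open>The zero function makes the supremum nonnegative, so a negative threshold is
        exceeded at every \<tau>.\<close>
      case False
      show ?thesis
      proof (intro always_eventually allI)
        fix \<tau> :: complex
        have "0 \<le> integral_means_spectrum (\<lambda>_. 0) \<tau>" by (rule integral_means_spectrum_zero)
        also have "\<dots> \<le> (SUP b\<in>bloch_unit_ball. integral_means_spectrum b \<tau>)"
          by (rule SUP_upper[OF zero_in_bloch_unit_ball])
        finally have "0 \<le> ereal (4 / (cmod \<tau>)\<^sup>2) * (SUP b\<in>bloch_unit_ball. integral_means_spectrum b \<tau>)"
          by (intro ereal_0_le_mult) auto
        with False show "y < ereal (4 / (cmod \<tau>)\<^sup>2) * (SUP b\<in>bloch_unit_ball. integral_means_spectrum b \<tau>)"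
          by (simp add: not_le less_le_trans)
      qed
    qed
  next
    fix y assume y: "ereal bloch_variance < y"
    have near: "\<forall>\<^sub>F \<tau> in at (0::complex). \<tau> \<noteq> 0 \<and> cmod \<tau> < \<tau>0" if "0 < \<tau>0" for \<tau>0
      unfolding eventually_at using that by (intro exI[of _ \<tau>0]) auto
    obtain e where e: "0 < e" "ereal (bloch_variance + e) < y"
    proof -
      obtain z where z: "ereal bloch_variance < ereal z" "ereal z < y" using ereal_dense2[OF y] by auto
      then show ?thesis using that[of "z - bloch_variance"] by auto
    qed
    obtain \<tau>0 where \<tau>0: "0 < \<tau>0" "\<And>\<tau> b. \<lbrakk>cmod \<tau> \<le> \<tau>0; b \<in> bloch_unit_ball\<rbrakk> \<Longrightarrow>
       integral_means_spectrum b \<tau> \<le> ereal ((cmod \<tau>)\<^sup>2 / 4 * (bloch_variance + e))"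
      using integral_means_spectrum_upper[OF e(1)] by metis
    show "\<forall>\<^sub>F \<tau> in at 0. ereal (4 / (cmod \<tau>)\<^sup>2) * (SUP b\<in>bloch_unit_ball. integral_means_spectrum b \<tau>) < y"
      using near[OF \<tau>0(1)]
    proof eventually_elim
      case (elim \<tau>)
      have "(SUP b\<in>bloch_unit_ball. integral_means_spectrum b \<tau>) \<le> ereal ((cmod \<tau>)\<^sup>2 / 4 * (bloch_variance + e))"
        using \<tau>0(2)[of \<tau>] elim by (intro SUP_least) auto
      then have "ereal (4 / (cmod \<tau>)\<^sup>2) * (SUP b\<in>bloch_unit_ball. integral_means_spectrum b \<tau>) \<le>
          ereal (4 / (cmod \<tau>)\<^sup>2) * ereal ((cmod \<tau>)\<^sup>2 / 4 * (bloch_variance + e))"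
        by (intro ereal_mult_left_mono) auto
      also have "\<dots> = ereal (bloch_variance + e)"
        using elim by simp
      also note e(2)
      finally show ?case .
    qed
  qed
qed

end
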